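(* Let $1\le p<\infty$, $1\le q<\infty$, and $1\le r<\infty$. If $f\in\mathcal D_\varphi$ and $T_f\in\Pi_r(F_\varphi^p,F_\varphi^q)$, then $\widetilde f\in\mathfrak D_{p,q}^{\,r}$ and $$\|\widetilde f\|_{\mathfrak D_{p,q}^{\,r}}\lesssim\pi_r(T_f),$$ with a constant independent of $f$.
   Context: $n\ge1$; $v$ is Lebesgue measure on $\mathbb C^n\cong\mathbb R^{2n}$. $\varphi\in C^2(\mathbb C^n;\mathbb R)$ satisfies $m_\varphi I_{2n}\le\operatorname{Hess}_{\mathbb R}\varphi(z)\le M_\varphi I_{2n}$ for all $z$, with constants $0<m_\varphi\le M_\varphi<\infty$. For $1\le s<\infty$, $L_\varphi^s=L^s(\mathbb C^n,e^{-s\varphi}dv)$ with norm $\|g\|_{s,\varphi}=\|ge^{-\varphi}\|_{L^s(v)}$; $F_\varphi^s$ is the subspace of entire functions in $L^s_\varphi$. $K$ is the reproducing kernel of $F_\varphi^2$, $k_z(w)=K(w,z)/K(z,z)^{1/2}$, and $\Gamma=\operatorname{span}\{k_z:z\in\mathbb C^n\}$, which is dense in $F_\varphi^s$ for $1\le s<\infty$. $Pg(z)=\int_{\mathbb C^n}g(w)K(z,w)e^{-2\varphi(w)}dv(w)$ is the orthogonal projection $L^2_\varphi\to F^2_\varphi$, and it extends boundedly from $L_\varphi^s$ onto $F_\varphi^s$ for $1\le s<\infty$. $\mathcal D_\varphi=\{f\text{ measurable}: fk_z\in L_\varphi^1\text{ for every }z\in\mathbb C^n\}$. For $f\in\mathcal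 D_\varphi$ and $g\in\Gamma$, $T_fg=P(fg)$. The Berezin transform is $\widetilde f(z)=\int f(w)|k_z(w)|^2e^{-2\varphi(w)}dv(w)$. $A:X\to Y$ is $r$-summing if $(\sum_j\|Ax_j\|^r)^{1/r}\le C\sup_{x^*\in B_{X^*}}(\sum_j|x^*(x_j)|^r)^{1/r}$ for all finite families $(x_j)$ in $X$; $\pi_r(A)$ is the least $C$ and $\Pi_r(X,Y)$ is the class of such operators. $T_f\in\Pi_r(F_\varphi^p,F_\varphi^q)$ means that $T_f$ maps $\Gamma$ into $F_\varphi^q$ and admits an $r$-summing extension to $F_\varphi^p$. For a scalar sequence $b=(b_j)$, $D_b:\ell^p\to\ell^q$, $D_b(c_j)=(b_jc_j)$; $\mathfrak d_{p,q}^{\,r}=\{b:D_b\in\Pi_r(\ell^p,\ell^q)\}$ with norm $\|b\|=\pi_r(D_b)$ (invariant under permutations of coordinates). For $j\in\mathbb Z^{2n}$ (enumerated by $\mathbb N$) let $E_j=j+[-1/2,1/2)^{2n}$. For measurable $u$ put $u_j^\#=\operatorname{ess\,sup}_{E_j}|u|$ and $\|u\|_{\mathfrak D_{p,q}^{\,r}}=\|(u_j^\#)_j\|_{\mathfrak d_{p,q}^{\,r}}$; $\mathfrak D_{p,q}^{\,r}$ is the space of $u$ with finite norm. The constant in $\lesssim$ may depend on $p,q,r,n$, the Hessian bounds and fixed lattice parameters. *)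

theory Defs
  imports "HOL-Analysis.Analysis" "HOL-Probability.Essential_Supremum"
begin

section \<open>Absolutely summing operators between normed spaces of functions\<close>

text \<open>A complex normed space is given by a carrier \<open>X\<close> of complex-valued functions, closed under
  the pointwise operations, and a norm \<open>N\<close> on it. This covers both the sequence spaces and the
  spaces of entire functions below. Operators and functionals are total functions whose
  values outside the carrier are irrelevant.\<close>

definition linear_between ::
    "('a \<Rightarrow> complex) set \<Rightarrow> ('b \<Rightarrow> complex) set \<Rightarrow> (('a \<Rightarrow> complex) \<Rightarrow> ('b \<Rightarrow> complex)) \<Rightarrow> bool" where
  "linear_between X Y A \<longleftrightarrow>
     (\<forall>x\<in>X. A x \<in> Y) \<and>
     (\<forall>x\<in>X. \<forall>y\<in>X. A (\<lambda>t. x t + y t) = (\<lambda>t. A x t + A y t)) \<and>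
     (\<forall>c. \<forall>x\<in>X. A (\<lambda>t. c * x t) = (\<lambda>t. c * A x t))"

definition dual_ball ::
    "('a \<Rightarrow> complex) set \<Rightarrow> (('a \<Rightarrow> complex) \<Rightarrow> real) \<Rightarrow> (('a \<Rightarrow> complex) \<Rightarrow> complex) set" where
  "dual_ball X N = {l.
     (\<forall>x\<in>X. \<forall>y\<in>X. l (\<lambda>t. x t + y t) = l x + l y) \<and>
     (\<forall>c. \<forall>x\<in>X. l (\<lambda>t. c * x t) = c * l x) \<and>
     (\<forall>x\<in>X. cmod (l x) \<le> N x)}"

definition summing_bound ::
    "real \<Rightarrow> ('a \<Rightarrow> complex) set \<Rightarrow> (('a \<Rightarrow> complex) \<Rightarrow> real) \<Rightarrow> (('b \<Rightarrow> complex) \<Rightarrow> real) \<Rightarrow>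
     (('a \<Rightarrow> complex) \<Rightarrow> ('b \<Rightarrow> complex)) \<Rightarrow> real \<Rightarrow> bool" where
  "summing_bound r X NX NY A C \<longleftrightarrow> 0 \<le> C \<and>
     (\<forall>(k::nat) x. (\<forall>j<k. x j \<in> X) \<longrightarrow>
        (\<Sum>j<k. NY (A (x j)) powr r) powr (1 / r)
          \<le> C * (SUP l\<in>dual_ball X NX. (\<Sum>j<k. cmod (l (x j)) powr r) powr (1 / r)))"

definition summing_ops ::
    "real \<Rightarrow> ('a \<Rightarrow> complex) set \<Rightarrow> (('a \<Rightarrow> complex) \<Rightarrow> real) \<Rightarrow>
     ('b \<Rightarrow> complex) set \<Rightarrow> (('b \<Rightarrow> complex) \<Rightarrow> real) \<Rightarrow>
     (('a \<Rightarrow> complex) \<Rightarrow> ('b \<Rightarrow> complex)) set" where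
  "summing_ops r X NX Y NY = {A. linear_between X Y A \<and> (\<exists>C. summing_bound r X NX NY A C)}"

definition summing_norm ::
    "real \<Rightarrow> ('a \<Rightarrow> complex) set \<Rightarrow> (('a \<Rightarrow> complex) \<Rightarrow> real) \<Rightarrow> (('b \<Rightarrow> complex) \<Rightarrow> real) \<Rightarrow>
     (('a \<Rightarrow> complex) \<Rightarrow> ('b \<Rightarrow> complex)) \<Rightarrow> real" where
  "summing_norm r X NX NY A = Inf {C. summing_bound r X NX NY A C}"


section \<open>Diagonal operators and the local lattice spaces\<close>

definition lseq :: "real \<Rightarrow> (nat \<Rightarrow> complex) set" where
  "lseq p = {c. summable (\<lambda>j. cmod (c j) powr p)}"

definition lseq_norm :: "real \<Rightarrow> (nat \<Rightarrow> complex) \<Rightarrow> real" where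
  "lseq_norm p c = (\<Sum>j. cmod (c j) powr p) powr (1 / p)"

definition diag_op :: "(nat \<Rightarrow> complex) \<Rightarrow> (nat \<Rightarrow> complex) \<Rightarrow> (nat \<Rightarrow> complex)" where
  "diag_op b c = (\<lambda>j. b j * c j)"

definition diag_space :: "real \<Rightarrow> real \<Rightarrow> real \<Rightarrow> (nat \<Rightarrow> complex) set" where
  "diag_space p q r = {b. diag_op b \<in> summing_ops r (lseq p) (lseq_norm p) (lseq q) (lseq_norm q)}"

definition diag_norm :: "real \<Rightarrow> real \<Rightarrow> real \<Rightarrow> (nat \<Rightarrow> complex) \<Rightarrow> real" where
  "diag_norm p q r b = summing_norm r (lseq p) (lseq_norm p) (lseq_norm q) (diag_op b)"

text \<open>The lattice of integer points of \<open>\<complex>\<^sup>n = \<real>\<^sup>2\<^sup>n\<close>: an index \<open>j\<close> stores the real and imaginary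
  part of the \<open>i\<close>-th coordinate as \<open>fst (j $ i)\<close> and \<open>snd (j $ i)\<close>.\<close>

type_synonym 'n lattice = "(int \<times> int) ^ 'n"

definition cell :: "'n::finite lattice \<Rightarrow> (complex ^ 'n) set" where
  "cell j = {z. \<forall>i.
     Re (z $ i) \<in> {real_of_int (fst (j $ i)) - 1/2 ..< real_of_int (fst (j $ i)) + 1/2} \<and>
     Im (z $ i) \<in> {real_of_int (snd (j $ i)) - 1/2 ..< real_of_int (snd (j $ i)) + 1/2}}"

definition lattice_enum :: "nat \<Rightarrow> 'n::finite lattice" where
  "lattice_enum = from_nat_into UNIV"

lemma infinite_lattice: "infinite (UNIV :: ('n::finite lattice) set)"
proof -
  have "inj (\<lambda>k::int. (\<chi> i. (k, 0)) :: 'n lattice)"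
    by (auto simp: inj_def vec_eq_iff)
  then show ?thesis
    using finite_imageD[of "\<lambda>k::int. (\<chi> i. (k, 0)) :: 'n lattice" UNIV] infinite_UNIV_int
    by (meson finite_subset subset_UNIV)
qed

lemma bij_lattice_enum: "bij (lattice_enum :: nat \<Rightarrow> 'n::finite lattice)"
  unfolding lattice_enum_def
  by (rule bij_betw_from_nat_into[OF countableI_type infinite_lattice])

definition cell_sup :: "(complex ^ 'n::finite \<Rightarrow> complex) \<Rightarrow> 'n lattice \<Rightarrow> ereal" where
  "cell_sup u j = esssup (lebesgue_on (cell j)) (\<lambda>z. ereal (cmod (u z)))"

definition cell_seq :: "(complex ^ 'n::finite \<Rightarrow> complex) \<Rightarrow> nat \<Rightarrow> complex" where
  "cell_seq u k = complex_of_real (real_of_ereal (cell_sup u (lattice_enum k)))"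

text \<open>\<^const>\<open>cell_seq\<close> turns an infinite essential supremum into \<open>0\<close>, so membership has to
  require finiteness on each cell separately.\<close>

definition lattice_space :: "real \<Rightarrow> real \<Rightarrow> real \<Rightarrow> (complex ^ 'n::finite \<Rightarrow> complex) set" where
  "lattice_space p q r = {u. u \<in> borel_measurable lebesgue \<and>
     (\<forall>j. cell_sup u j < \<infinity>) \<and> cell_seq u \<in> diag_space p q r}"

definition lattice_norm :: "real \<Rightarrow> real \<Rightarrow> real \<Rightarrow> (complex ^ 'n::finite \<Rightarrow> complex) \<Rightarrow> real" where
  "lattice_norm p q r u = diag_norm p q r (cell_seq u)"


section \<open>Weighted Fock spaces\<close>

text \<open>\<open>\<phi>\<close> is twice continuously differentiable with gradient \<open>G\<close> and real Hessian \<open>H\<close> (the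
  derivative of the gradient), for the real inner product of \<open>\<complex>\<^sup>n = \<real>\<^sup>2\<^sup>n\<close>.\<close>

definition admissible_weight :: "real \<Rightarrow> real \<Rightarrow> (complex ^ 'n::finite \<Rightarrow> real) \<Rightarrow> bool" where
  "admissible_weight m M \<phi> \<longleftrightarrow>
     (\<exists>(G :: complex ^ 'n \<Rightarrow> complex ^ 'n) (H :: complex ^ 'n \<Rightarrow> (complex ^ 'n) \<Rightarrow>\<^sub>L (complex ^ 'n)).
        (\<forall>z. (\<phi> has_derivative (\<lambda>v. G z \<bullet> v)) (at z)) \<and>
        (\<forall>z. (G has_derivative blinfun_apply (H z)) (at z)) \<and>
        continuous_on UNIV H \<and>
        (\<forall>z v. m * (norm v)\<^sup>2 \<le> v \<bullet> blinfun_apply (H z) v \<and>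
               v \<bullet> blinfun_apply (H z) v \<le> M * (norm v)\<^sup>2))"

definition entire :: "(complex ^ 'n::finite \<Rightarrow> complex) \<Rightarrow> bool" where
  "entire g \<longleftrightarrow> (\<forall>z. \<exists>L. (g has_derivative L) (at z) \<and> (\<forall>c v. L (c *s v) = c * L v))"

definition Lphi :: "(complex ^ 'n::finite \<Rightarrow> real) \<Rightarrow> real \<Rightarrow> (complex ^ 'n \<Rightarrow> complex) set" where
  "Lphi \<phi> s = {g. g \<in> borel_measurable lebesgue \<and>
     integrable lebesgue (\<lambda>z. (cmod (g z) * exp (- \<phi> z)) powr s)}"

definition Lphi_norm :: "(complex ^ 'n::finite \<Rightarrow> real) \<Rightarrow> real \<Rightarrow> (complex ^ 'n \<Rightarrow> complex) \<Rightarrow> real" where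
  "Lphi_norm \<phi> s g = (LINT z|lebesgue. (cmod (g z) * exp (- \<phi> z)) powr s) powr (1 / s)"

definition Fock :: "(complex ^ 'n::finite \<Rightarrow> real) \<Rightarrow> real \<Rightarrow> (complex ^ 'n \<Rightarrow> complex) set" where
  "Fock \<phi> s = {g \<in> Lphi \<phi> s. entire g}"

definition reproducing_kernel ::
    "(complex ^ 'n::finite \<Rightarrow> real) \<Rightarrow> (complex ^ 'n \<Rightarrow> complex ^ 'n \<Rightarrow> complex) \<Rightarrow> bool" where
  "reproducing_kernel \<phi> K \<longleftrightarrow>
     (\<forall>z. (\<lambda>w. K w z) \<in> Fock \<phi> 2 \<and>
       (\<forall>g\<in>Fock \<phi> 2.
          g z = (LINT w|lebesgue. g w * cnj (K w z) * complex_of_real (exp (- 2 * \<phi> w)))))"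

definition normalized_kernel ::
    "(complex ^ 'n \<Rightarrow> complex ^ 'n \<Rightarrow> complex) \<Rightarrow> complex ^ 'n \<Rightarrow> complex ^ 'n \<Rightarrow> complex" where
  "normalized_kernel K z w = K w z / csqrt (K z z)"

definition kernel_span ::
    "(complex ^ 'n \<Rightarrow> complex ^ 'n \<Rightarrow> complex) \<Rightarrow> (complex ^ 'n \<Rightarrow> complex) set" where
  "kernel_span K = {(\<lambda>w. \<Sum>z\<in>S. c z * normalized_kernel K z w) | S c. finite S}"

definition bergman_proj ::
    "(complex ^ 'n::finite \<Rightarrow> real) \<Rightarrow> (complex ^ 'n \<Rightarrow> complex ^ 'n \<Rightarrow> complex) \<Rightarrow>
     (complex ^ 'n \<Rightarrow> complex) \<Rightarrow> (complex ^ 'n \<Rightarrow> complex)" where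
  "bergman_proj \<phi> K g =
     (\<lambda>z. LINT w|lebesgue. g w * K z w * complex_of_real (exp (- 2 * \<phi> w)))"


section \<open>Toeplitz operators\<close>

definition symbol_class ::
    "(complex ^ 'n::finite \<Rightarrow> real) \<Rightarrow> (complex ^ 'n \<Rightarrow> complex ^ 'n \<Rightarrow> complex) \<Rightarrow>
     (complex ^ 'n \<Rightarrow> complex) set" where
  "symbol_class \<phi> K = {f. f \<in> borel_measurable lebesgue \<and>
     (\<forall>z. (\<lambda>w. f w * normalized_kernel K z w) \<in> Lphi \<phi> 1)}"

definition toeplitz ::
    "(complex ^ 'n::finite \<Rightarrow> real) \<Rightarrow> (complex ^ 'n \<Rightarrow> complex ^ 'n \<Rightarrow> complex) \<Rightarrow>
     (complex ^ 'n \<Rightarrow> complex) \<Rightarrow> (complex ^ 'n \<Rightarrow> complex) \<Rightarrow> (complex ^ 'n \<Rightarrow> complex)" where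
  "toeplitz \<phi> K f g = bergman_proj \<phi> K (\<lambda>w. f w * g w)"

definition berezin ::
    "(complex ^ 'n::finite \<Rightarrow> real) \<Rightarrow> (complex ^ 'n \<Rightarrow> complex ^ 'n \<Rightarrow> complex) \<Rightarrow>
     (complex ^ 'n \<Rightarrow> complex) \<Rightarrow> (complex ^ 'n \<Rightarrow> complex)" where
  "berezin \<phi> K f = (\<lambda>z. LINT w|lebesgue.
     f w * complex_of_real ((cmod (normalized_kernel K z w))\<^sup>2 * exp (- 2 * \<phi> w)))"

text \<open>The \<open>r\<close>-summing extensions of the Toeplitz operator from \<^const>\<open>kernel_span\<close> to all
  of \<open>Fock \<phi> p\<close>.\<close>

definition toeplitz_extensions ::
    "(complex ^ 'n::finite \<Rightarrow> real) \<Rightarrow> (complex ^ 'n \<Rightarrow> complex ^ 'n \<Rightarrow> complex) \<Rightarrow>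
     real \<Rightarrow> real \<Rightarrow> real \<Rightarrow> (complex ^ 'n \<Rightarrow> complex) \<Rightarrow>
     ((complex ^ 'n \<Rightarrow> complex) \<Rightarrow> (complex ^ 'n \<Rightarrow> complex)) set" where
  "toeplitz_extensions \<phi> K p q r f =
     {A \<in> summing_ops r (Fock \<phi> p) (Lphi_norm \<phi> p) (Fock \<phi> q) (Lphi_norm \<phi> q).
        \<forall>g\<in>kernel_span K. A g = toeplitz \<phi> K f g}"

definition toeplitz_summing ::
    "(complex ^ 'n::finite \<Rightarrow> real) \<Rightarrow> (complex ^ 'n \<Rightarrow> complex ^ 'n \<Rightarrow> complex) \<Rightarrow>
     real \<Rightarrow> real \<Rightarrow> real \<Rightarrow> (complex ^ 'n \<Rightarrow> complex) \<Rightarrow> bool" where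
  "toeplitz_summing \<phi> K p q r f \<longleftrightarrow>
     (\<forall>g\<in>kernel_span K. toeplitz \<phi> K f g \<in> Fock \<phi> q) \<and> toeplitz_extensions \<phi> K p q r f \<noteq> {}"

text \<open>Since \<^const>\<open>kernel_span\<close> is dense in \<open>Fock \<phi> p\<close> and summing operators are bounded, the
  extension is unique on \<open>Fock \<phi> p\<close>, so the infimum below runs over a single value.\<close>

definition toeplitz_summing_norm ::
    "(complex ^ 'n::finite \<Rightarrow> real) \<Rightarrow> (complex ^ 'n \<Rightarrow> complex ^ 'n \<Rightarrow> complex) \<Rightarrow>
     real \<Rightarrow> real \<Rightarrow> real \<Rightarrow> (complex ^ 'n \<Rightarrow> complex) \<Rightarrow> real" where
  "toeplitz_summing_norm \<phi> K p q r f =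
     (INF A\<in>toeplitz_extensions \<phi> K p q r f.
        summing_norm r (Fock \<phi> p) (Lphi_norm \<phi> p) (Lphi_norm \<phi> q) A)"

end

theory Submission
  imports Defs "HOL-Complex_Analysis.Cauchy_Integral_Formula" "HOL-Probability.Distributions"
begin

text \<open>Berezin values are diagonal entries of the operator. Since
  \<open>|k\<^sub>z(w)|\<^sup>2 = k\<^sub>z(w) K(z,w) / K(z,z)\<^sup>1\<^sup>/\<^sup>2\<close>, the Berezin transform of \<open>f\<close> at \<open>z\<close> is \<open>(T\<^sub>f k\<^sub>z)(z) / K(z,z)\<^sup>1\<^sup>/\<^sup>2\<close>
  (\<open>toeplitz_at_kernel\<close>). Choose one point \<open>z\<^sub>j\<close> in each lattice cell, and let \<open>S c = \<Sum> c\<^sub>j k\<^sub>z\<^sub>j\<close> and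
  \<open>R g = (g(z\<^sub>j) / K(z\<^sub>j,z\<^sub>j)\<^sup>1\<^sup>/\<^sup>2)\<^sub>j\<close>. For an extension \<open>A\<close> of \<open>T\<^sub>f\<close>, the diagonal of the matrix of \<open>R A S\<close> is
  the sequence of Berezin values at the points \<open>z\<^sub>j\<close>. If \<open>S\<close> is bounded from \<open>l\<^sup>p\<close> to the Fock space and
  \<open>R\<close> from the Fock space to \<open>l\<^sup>q\<close>, with bounds that depend neither on the points nor on \<open>f\<close>, then
  \<open>R A S\<close> is \<open>r\<close>-summing, and averaging its conjugates by diagonal matrices of roots of unity keeps
  the summing constant and leaves the diagonal (\<open>diagonal_summing\<close>). Points at which the Berezin
  transform is at least half of its essential supremum over the cell (\<open>cell_seq_attained\<close>) turn
  this into the asserted estimate, at the price of a factor \<open>2\<close>.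

  Boundedness of \<open>R\<close> (\<open>sampling\<close>) and of \<open>S\<close> (\<open>synthesis\<close>) needs two facts about the kernel:
  \<open>K(z,z) \<ge> c exp (2 \<phi>(z))\<close> and \<open>\<integral> |K(w,z)| exp (- \<phi>(w)) dw \<le> C exp (\<phi>(z))\<close>. With these, \<open>R\<close> is
  controlled by the sub-mean-value inequality on unit balls and \<open>S\<close> by a Schur test. The lower
  bound (\<open>kernel_diag_lower\<close>) comes from convexity in the real sense: the exponential of the
  complex-linear function whose real part is the tangent of \<open>\<phi>\<close> at \<open>z\<close> is an entire function with a
  Gaussian peak at \<open>z\<close> relative to \<open>exp \<phi>\<close>.

  The integral bound (\<open>kernel_L1\<close>) is proved in two stages. First, there is an explicit kernel \<open>Q\<close>,
  not the orthogonal one, that reproduces all entire \<open>g\<close> with \<open>g = O(exp \<phi>)\<close> and has Gaussian decay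
  off the diagonal relative to \<open>exp \<phi>\<close> (\<open>gaussian_reproducing_kernel\<close>). It is a weighted integral
  representation \<open>\<integral> g(u) exp (\<Sum> F\<^sub>i(u) (z\<^sub>i - u\<^sub>i)) det (\<partial>F\<^sub>i/\<partial>\<zeta>\<^sub>l-bar) du\<close> whose phase \<open>F\<close> is the
  conjugate gradient of \<open>\<phi>\<close>, averaged over unit balls so that it can be differentiated twice. The
  value of such an integral does not change when the phase is deformed (\<open>phase_homotopy\<close>), because
  the derivative of the integrand is a divergence by the Piola identity; deforming to an affine
  phase leaves a Gaussian mean, which evaluates to \<open>g(z)\<close> by the mean value property. Second,
  reproduction by a kernel with Gaussian decay forces \<open>K(w,z) exp (- \<phi>(w))\<close> to be square
  integrable against a growing exponential weight centred at \<open>z\<close>, by the method of Agmon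
  (\<open>agmon_estimate\<close>); Cauchy's inequality between this weight and its inverse gives the bound. All
  constants are functions of \<open>m\<close>, \<open>M\<close>, the exponents and the dimension.\<close>

section \<open>Gaussian integrals and symmetries of Lebesgue measure\<close>

lemma gaussian_integrable_real:
  assumes "0 < c" shows "integrable lborel (\<lambda>x::real. exp (- c * x\<^sup>2))"
proof -
  define s where "s = sqrt (1 / (2 * c))"
  have s: "s > 0" "s\<^sup>2 = 1 / (2*c)" using assms by (auto simp: s_def)
  have "integrable lborel (\<lambda>x. sqrt (2 * pi * s\<^sup>2) * normal_density 0 s x)"
    using s by auto
  moreover have "sqrt (2 * pi * s\<^sup>2) * normal_density 0 s x = exp (- c * x\<^sup>2)" for x
    using s assms unfolding normal_density_def by (simp add: field_simps)
  ultimately show ?thesis by simp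
qed

lemma gaussian_integrable:
  assumes "0 < c"
  shows "integrable lborel (\<lambda>x::'a::euclidean_space. exp (- c * (norm x)\<^sup>2))"
proof (rule integrableI_nonneg)
  have e: "exp (- c * (norm x)\<^sup>2) = (\<Prod>b\<in>Basis. exp (- c * (x \<bullet> b)\<^sup>2))" for x :: 'a
    by (simp add: exp_sum[symmetric] sum_distrib_left[symmetric] norm_eq_sqrt_inner
        euclidean_inner[of x x] power2_eq_square)
       (simp add: sum_negf sum_distrib_left sum_nonneg)
  have fin: "(\<integral>\<^sup>+x. ennreal (exp (- c * x\<^sup>2)) \<partial>lborel) < \<infinity>"
    using gaussian_integrable_real[OF assms] by (simp add: integrable_iff_bounded)
  have "nn_integral lborel (\<lambda>x::'a. ennreal (exp (- c * (norm x)\<^sup>2)))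
      = nn_integral lborel (\<lambda>x::'a. (\<Prod>b\<in>Basis. ennreal (exp (- c * (x \<bullet> b)\<^sup>2))))"
    unfolding e by (simp add: prod_ennreal)
  also have "\<dots> = (\<Prod>b\<in>(Basis::'a set). (\<integral>\<^sup>+x. ennreal (exp (- c * x\<^sup>2)) \<partial>lborel))"
    by (rule nn_integral_lborel_prod) auto
  also have "\<dots> < \<infinity>" using fin by (simp add: ennreal_prod_eq_top less_top power_less_top_ennreal)
  finally show "nn_integral lborel (\<lambda>x::'a. ennreal (exp (- c * (norm x)\<^sup>2))) < \<infinity>" .
qed auto

lemma gaussian_integral_pos:
  assumes "0 < c"
  shows "0 < (LINT x|lborel. exp (- c * (norm (x :: 'a::euclidean_space))\<^sup>2))"
proof -
  let ?f = "\<lambda>x :: 'a. exp (- c * (norm x)\<^sup>2)"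
  have i: "integrable lborel ?f" by (rule gaussian_integrable[OF assms])
  have "(LINT x|lborel. ?f x) \<noteq> 0"
  proof
    assume "(LINT x|lborel. ?f x) = 0"
    then have "AE x in lborel. ?f x = 0" using integral_nonneg_eq_0_iff_AE[OF i] by simp
    then have "AE x::'a in lborel. False" by simp
    then have "emeasure lborel (UNIV :: 'a set) = 0"
      by (subst (asm) AE_iff_measurable[OF _ refl]) auto
    then show False by simp
  qed
  moreover have "(LINT x|lborel. ?f x) \<ge> 0" by (intro integral_nonneg_AE) auto
  ultimately show ?thesis by (simp only: less_le) simp
qed

lemma linear_minus_quadratic_le:
  fixes a c t :: real assumes "0 < c"
  shows "a * t - c * t\<^sup>2 \<le> a\<^sup>2 / (2*c) - (c/2) * t\<^sup>2"
proof -
  have "0 \<le> (a - c * t)\<^sup>2 / (2 * c)" using assms by simp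
  then show ?thesis using assms by (simp add: power2_eq_square field_simps)
qed

lemma exp_gaussian_integrable:
  assumes "0 < c"
  shows "integrable lborel (\<lambda>x::'a::euclidean_space. exp (a * norm x - c * (norm x)\<^sup>2))"
proof (rule Bochner_Integration.integrable_bound)
  show "integrable lborel (\<lambda>x::'a. exp (a\<^sup>2/(2*c)) * exp (- (c/2) * (norm x)\<^sup>2))"
    by (intro integrable_mult_right gaussian_integrable) (use assms in auto)
  show "AE x::'a in lborel. norm (exp (a * norm x - c * (norm x)\<^sup>2))
     \<le> norm (exp (a\<^sup>2/(2*c)) * exp (- (c/2) * (norm x)\<^sup>2))"
    using linear_minus_quadratic_le[OF assms, of a]
    by (intro AE_I2) (simp add: exp_add[symmetric])
qed auto

lemma poly_gaussian_integrable:
  assumes "0 < c"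
  shows "integrable lborel (\<lambda>x::'a::euclidean_space. (1 + norm x) ^ k * exp (- c * (norm x)\<^sup>2))"
proof (rule Bochner_Integration.integrable_bound)
  show "integrable lborel (\<lambda>x::'a. exp (real k * norm x - c * (norm x)\<^sup>2))"
    by (rule exp_gaussian_integrable[OF assms])
  have "(1 + norm x) ^ k \<le> exp (real k * norm x)" for x :: 'a
    using exp_ge_add_one_self[of "norm x"] power_mono[of "1 + norm x" "exp (norm x)" k]
    by (simp add: exp_of_nat_mult add.commute)
  then have "(1 + norm x) ^ k * exp (- c * (norm x)\<^sup>2) \<le> exp (real k * norm x - c * (norm x)\<^sup>2)" for x :: 'a
    by (simp add: exp_diff exp_minus field_simps)
  then show "AE x::'a in lborel. norm ((1 + norm x) ^ k * exp (- c * (norm x)\<^sup>2))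
     \<le> norm (exp (real k * norm x - c * (norm x)\<^sup>2))"
    by (intro AE_I2) simp
qed auto

lemma lborel_distr_reflect:
  fixes a :: "'a::euclidean_space"
  shows "distr lborel borel (\<lambda>x. a - x) = lborel"
  by (subst lborel_affine[of "-1" a], auto simp: density_1)

lemma lborel_integral_translate:
  fixes f :: "'a::euclidean_space \<Rightarrow> 'b::{banach, second_countable_topology}"
  shows "integrable lborel (\<lambda>x. f (a + x)) \<longleftrightarrow> integrable lborel f"
    and "(LINT x|lborel. f (a + x)) = (LINT x|lborel. f x)"
proof -
  have F: "integrable lborel (\<lambda>x. g (b + x))" if "integrable lborel g" for g :: "'a \<Rightarrow> 'b" and b
    using integrable_distr[of "(+) b" lborel borel g] that by (simp add: lborel_distr_plus)
  from F[of f a] F[of "\<lambda>x. f (a + x)" "- a"]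
  show i: "integrable lborel (\<lambda>x. f (a + x)) \<longleftrightarrow> integrable lborel f" by auto
  show "(LINT x|lborel. f (a + x)) = (LINT x|lborel. f x)"
  proof (cases "integrable lborel f")
    case True
    then show ?thesis using integral_distr[of "(+) a" lborel borel f] by (simp add: lborel_distr_plus)
  next
    case False
    then show ?thesis using i by (simp add: not_integrable_integral_eq)
  qed
qed

lemma lborel_integral_reflect:
  fixes f :: "'a::euclidean_space \<Rightarrow> 'b::{banach, second_countable_topology}"
  shows "integrable lborel (\<lambda>x. f (a - x)) \<longleftrightarrow> integrable lborel f"
    and "(LINT x|lborel. f (a - x)) = (LINT x|lborel. f x)"
proof -
  have F: "integrable lborel (\<lambda>x. g (b - x))" if "integrable lborel g" for g :: "'a \<Rightarrow> 'b" and b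
    using integrable_distr[of "\<lambda>x. b - x" lborel borel g] that by (simp add: lborel_distr_reflect)
  from F[of f a] F[of "\<lambda>x. f (a - x)" "a"]
  show i: "integrable lborel (\<lambda>x. f (a - x)) \<longleftrightarrow> integrable lborel f" by auto
  show "(LINT x|lborel. f (a - x)) = (LINT x|lborel. f x)"
  proof (cases "integrable lborel f")
    case True
    then show ?thesis using integral_distr[of "\<lambda>x. a - x" lborel borel f] by (simp add: lborel_distr_reflect)
  next
    case False
    then show ?thesis using i by (simp add: not_integrable_integral_eq)
  qed
qed

lemma nn_integral_lborel_translate:
  fixes f :: "'a::euclidean_space \<Rightarrow> ennreal" assumes [measurable]: "f \<in> borel_measurable borel"
  shows "(\<integral>\<^sup>+x. f (a + x) \<partial>lborel) = (\<integral>\<^sup>+x. f x \<partial>lborel)"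
  using nn_integral_distr[of "(+) a" lborel borel f] by (simp add: lborel_distr_plus)

lemma nn_integral_lborel_reflect:
  fixes f :: "'a::euclidean_space \<Rightarrow> ennreal" assumes [measurable]: "f \<in> borel_measurable borel"
  shows "(\<integral>\<^sup>+x. f (a - x) \<partial>lborel) = (\<integral>\<^sup>+x. f x \<partial>lborel)"
  using nn_integral_distr[of "\<lambda>x. a - x" lborel borel f] by (simp add: lborel_distr_reflect)

lemma norm_vector_scalar_mult_complex:
  fixes x :: "complex ^ 'n::finite"
  shows "norm (c *s x) = cmod c * norm x"
  by (simp add: norm_vec_def L2_set_def norm_mult power_mult_distrib sum_distrib_left[symmetric]
      real_sqrt_mult)

lemma continuous_vector_scalar_mult [continuous_intros]:
  fixes f :: "'a::topological_space \<Rightarrow> complex" and g :: "'a \<Rightarrow> complex ^ 'n::finite"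
  assumes "continuous_on S f" "continuous_on S g"
  shows "continuous_on S (\<lambda>x. f x *s g x)"
  unfolding vector_scalar_mult_def by (intro continuous_intros assms)

text \<open>The image measure is invariant under translations and reflections and gives the unit ball its
  Lebesgue measure. Evaluating the double integral of \<open>1\<^sub>B(y) 1\<^sub>A(y + x)\<close> in both orders, with \<open>B\<close> the
  unit ball, is the uniqueness proof for Haar measure; the common mass of \<open>B\<close> fixes the constant
  to \<open>1\<close>.\<close>
lemma lborel_distr_unimodular:
  fixes c :: complex
  assumes c: "cmod c = 1"
  shows "distr lborel borel (\<lambda>x::complex ^ 'n::finite. c *s x) = lborel"
proof -
  define J where "J = (\<lambda>x::complex ^ 'n. c *s x)"
  define \<mu> where "\<mu> = distr lborel borel J"
  have [measurable]: "J \<in> borel_measurable borel"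
    unfolding J_def by (intro borel_measurable_continuous_onI continuous_intros)
  have sm[simp, measurable_cong]: "sets \<mu> = sets borel" and "space \<mu> = UNIV" by (auto simp: \<mu>_def)
  have nJ: "norm (J x) = norm x" for x by (simp add: J_def norm_vector_scalar_mult_complex c)
  have Jinv: "J (cnj c *s x) = x" for x
    using c by (simp add: J_def vec_eq_iff mult.assoc[symmetric] complex_norm_square[symmetric])
  have add_J: "J (cnj c *s a + x) = a + J x" and sub_J: "J (cnj c *s a - x) = a - J x" for a x
    using Jinv[of a] by (simp_all add: J_def vec_eq_iff distrib_left right_diff_distrib)
  have nn: "(\<integral>\<^sup>+x. f x \<partial>\<mu>) = (\<integral>\<^sup>+x. f (J x) \<partial>lborel)" if "f \<in> borel_measurable borel" for f
    using that unfolding \<mu>_def by (subst nn_integral_distr) auto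
  have tr: "(\<integral>\<^sup>+x. f (a + x) \<partial>\<mu>) = (\<integral>\<^sup>+x. f x \<partial>\<mu>)" if [measurable]: "f \<in> borel_measurable borel" for f a
  proof -
    have "(\<integral>\<^sup>+x. f (a + x) \<partial>\<mu>) = (\<integral>\<^sup>+x. f (J ((cnj c *s a) + x)) \<partial>lborel)"
      by (simp add: nn add_J)
    also have "\<dots> = (\<integral>\<^sup>+x. f (J x) \<partial>lborel)"
      by (rule nn_integral_lborel_translate) simp
    finally show ?thesis by (simp add: nn)
  qed
  have re: "(\<integral>\<^sup>+x. f (a - x) \<partial>\<mu>) = (\<integral>\<^sup>+x. f x \<partial>\<mu>)" if [measurable]: "f \<in> borel_measurable borel" for f a
  proof -
    have "(\<integral>\<^sup>+x. f (a - x) \<partial>\<mu>) = (\<integral>\<^sup>+x. f (J ((cnj c *s a) - x)) \<partial>lborel)"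
      by (simp add: nn sub_J)
    also have "\<dots> = (\<integral>\<^sup>+x. f (J x) \<partial>lborel)"
      by (rule nn_integral_lborel_reflect) simp
    finally show ?thesis by (simp add: nn)
  qed
  have h: "indicator (ball 0 1) (J x) = (indicator (ball 0 1) x :: ennreal)" for x
    by (simp add: indicator_def nJ)
  interpret mu: sigma_finite_measure \<mu>
  proof
    have "emeasure \<mu> (ball 0 (real n)) \<noteq> \<infinity>" for n
    proof -
      have "emeasure \<mu> (ball 0 (real n)) = emeasure lborel (J -` ball 0 (real n) \<inter> space lborel)"
        unfolding \<mu>_def by (rule emeasure_distr) auto
      also have "J -` ball 0 (real n) \<inter> space lborel = ball 0 (real n)" by (auto simp: nJ)
      finally show ?thesis using emeasure_bounded_finite[of "ball (0::complex^'n) (real n)"] by simp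
    qed
    moreover have "(\<Union>n. ball (0::complex^'n) (real n)) = space \<mu>"
      by (auto simp: reals_Archimedean2 \<mu>_def)
    ultimately show "\<exists>A. countable A \<and> A \<subseteq> sets \<mu> \<and> \<Union> A = space \<mu> \<and> (\<forall>a\<in>A. emeasure \<mu> a \<noteq> \<infinity>)"
      by (intro exI[of _ "range (\<lambda>n::nat. ball 0 (real n))"]) auto
  qed
  interpret pair_sigma_finite lborel \<mu> ..
  show ?thesis unfolding J_def[symmetric] \<mu>_def[symmetric]
  proof (rule measure_eqI)
    fix A assume "A \<in> sets \<mu>"
    then have A[measurable]: "A \<in> sets borel" by simp
    let ?h = "indicator (ball 0 1) :: complex^'n \<Rightarrow> ennreal"
    let ?V = "emeasure lborel (ball (0::complex^'n) 1)"
    have [measurable]: "ball (0::complex^'n) 1 \<in> sets borel" by auto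
    have "?V * emeasure \<mu> A = (\<integral>\<^sup>+y. ?h y * emeasure \<mu> A \<partial>lborel)"
      by (simp add: nn_integral_multc)
    also have "\<dots> = (\<integral>\<^sup>+y. (\<integral>\<^sup>+x. ?h y * indicator A (y + x) \<partial>\<mu>) \<partial>lborel)"
    proof (rule nn_integral_cong)
      fix y
      have "(\<integral>\<^sup>+x. ?h y * indicator A (y + x) \<partial>\<mu>) = ?h y * (\<integral>\<^sup>+x. indicator A (y + x) \<partial>\<mu>)"
        by (rule nn_integral_cmult) measurable
      also have "(\<integral>\<^sup>+x. indicator A (y + x) \<partial>\<mu>) = (\<integral>\<^sup>+x. indicator A x \<partial>\<mu>)"
        by (rule tr) simp
      finally show "?h y * emeasure \<mu> A = (\<integral>\<^sup>+x. ?h y * indicator A (y + x) \<partial>\<mu>)" by simp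
    qed
    also have "\<dots> = (\<integral>\<^sup>+x. (\<integral>\<^sup>+y. ?h y * indicator A (y + x) \<partial>lborel) \<partial>\<mu>)"
      by (rule Fubini'[symmetric]) (measurable)
    also have "\<dots> = (\<integral>\<^sup>+x. (\<integral>\<^sup>+y. ?h (y - x) * indicator A y \<partial>lborel) \<partial>\<mu>)"
    proof (rule nn_integral_cong)
      fix x
      show "(\<integral>\<^sup>+y. ?h y * indicator A (y + x) \<partial>lborel) = (\<integral>\<^sup>+y. ?h (y - x) * indicator A y \<partial>lborel)"
        using nn_integral_lborel_translate[of "\<lambda>y. ?h (y - x) * indicator A y" x]
        by (simp add: add.commute)
    qed
    also have "\<dots> = (\<integral>\<^sup>+y. (\<integral>\<^sup>+x. ?h (y - x) * indicator A y \<partial>\<mu>) \<partial>lborel)"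
      by (rule Fubini') measurable
    also have "\<dots> = (\<integral>\<^sup>+y. ?V * indicator A y \<partial>lborel)"
    proof (rule nn_integral_cong)
      fix y
      have "(\<integral>\<^sup>+x. ?h (y - x) * indicator A y \<partial>\<mu>) = (\<integral>\<^sup>+x. ?h (y - x) \<partial>\<mu>) * indicator A y"
        by (rule nn_integral_multc) measurable
      also have "(\<integral>\<^sup>+x. ?h (y - x) \<partial>\<mu>) = (\<integral>\<^sup>+x. ?h x \<partial>\<mu>)" by (rule re) simp
      also have "\<dots> = (\<integral>\<^sup>+x. ?h (J x) \<partial>lborel)" by (rule nn) simp
      also have "\<dots> = ?V" by (simp add: h)
      finally show "(\<integral>\<^sup>+x. ?h (y - x) * indicator A y \<partial>\<mu>) = ?V * indicator A y" .
    qed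
    also have "\<dots> = ?V * emeasure lborel A" by (simp add: nn_integral_cmult)
    finally have "?V * emeasure \<mu> A = ?V * emeasure lborel A" .
    moreover have "?V \<noteq> 0"
      using emeasure_lborel_ball_finite open_not_negligible[of "ball (0::complex^'n) 1"]
      by (auto simp: negligible_iff_null_sets null_sets_def)
    moreover have "?V \<noteq> \<infinity>" using emeasure_bounded_finite[of "ball (0::complex^'n) 1"] by simp
    ultimately show "emeasure \<mu> A = emeasure lborel A"
      by (simp add: ennreal_mult_cancel_left)
  qed simp
qed

lemma lborel_integral_unimodular:
  fixes f :: "complex ^ 'n::finite \<Rightarrow> 'b::{banach, second_countable_topology}"
  assumes "cmod c = 1" and "f \<in> borel_measurable borel"
  shows "(LINT x|lborel. f (c *s x)) = (LINT x|lborel. f x)"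
proof -
  have "(\<lambda>x::complex^'n. c *s x) \<in> borel_measurable borel"
    by (intro borel_measurable_continuous_onI continuous_intros)
  then show ?thesis
    using integral_distr[of "\<lambda>x. c *s x" lborel borel f] assms
    by (simp add: lborel_distr_unimodular)
qed

section \<open>Entire functions on complex lines\<close>

lemma entire_continuous: "entire g \<Longrightarrow> continuous_on UNIV g"
  unfolding entire_def
  by (meson continuous_at_imp_continuous_on has_derivative_continuous)

lemma entire_measurable: "entire g \<Longrightarrow> g \<in> borel_measurable borel"
  by (simp add: borel_measurable_continuous_onI entire_continuous)

lemma has_derivative_complex_line:
  fixes z v :: "complex ^ 'n::finite"
  shows "((\<lambda>t. z + t *s v) has_derivative (\<lambda>t. t *s v)) (at t0)"
proof -
  have "bounded_linear (\<lambda>t. t *s v)"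
    unfolding linear_conv_bounded_linear[symmetric]
    by (auto simp: linear_iff vec_eq_iff algebra_simps)
  from bounded_linear.has_derivative[OF this has_derivative_ident]
  show ?thesis by (auto intro!: derivative_eq_intros)
qed

lemma entire_line_holomorphic:
  fixes z v :: "complex ^ 'n::finite"
  assumes "entire g"
  shows "(\<lambda>t. g (z + t *s v)) holomorphic_on S"
proof -
  have "(\<lambda>t. g (z + t *s v)) field_differentiable (at t0)" for t0
  proof -
    from assms obtain L where L: "(g has_derivative L) (at (z + t0 *s v))" "\<And>c v. L (c *s v) = c * L v"
      unfolding entire_def by blast
    have "((\<lambda>t. g (z + t *s v)) has_derivative (\<lambda>t. L (t *s v))) (at t0)"
      by (rule has_derivative_compose[OF has_derivative_complex_line L(1)])
    moreover have "(\<lambda>t. L (t *s v)) = (*) (L v)" by (auto simp: L(2) mult.commute)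
    ultimately have "((\<lambda>t. g (z + t *s v)) has_field_derivative (L v)) (at t0)"
      unfolding has_field_derivative_def by simp
    then show ?thesis by (auto simp: field_differentiable_def)
  qed
  then show ?thesis by (auto simp: holomorphic_on_def intro: field_differentiable_at_within)
qed

lemma circle_mean_value:
  assumes "h holomorphic_on UNIV"
  shows "((\<lambda>\<theta>. h (exp (2 * of_real pi * \<i> * of_real \<theta>))) has_integral h 0) {0..1}"
proof -
  have "((\<lambda>u. h u / (u - 0)) has_contour_integral (2 * of_real pi * \<i> * h 0)) (circlepath 0 1)"
    by (rule Cauchy_integral_circlepath_simple) (use assms in \<open>auto intro: holomorphic_on_subset\<close>)
  then have "((\<lambda>x. h (circlepath 0 1 x) / circlepath 0 1 x * vector_derivative (circlepath 0 1) (at x))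
      has_integral (2 * of_real pi * \<i> * h 0)) {0..1}"
    by (simp add: has_contour_integral)
  then have "((\<lambda>x. (2 * of_real pi * \<i>) * h (exp (2 * of_real pi * \<i> * of_real x)))
      has_integral (2 * of_real pi * \<i> * h 0)) {0..1}"
    unfolding vector_derivative_circlepath by (simp add: circlepath mult_ac)
  from has_integral_mult_right[OF this, of "1 / (2 * of_real pi * \<i>)"] show ?thesis
    by (simp add: mult.assoc[symmetric])
qed

text \<open>Replacing \<open>x\<close> by \<open>exp (2 \<pi> i \<theta>) x\<close> does not change the integral; averaging over \<open>\<theta>\<close> first leaves,
  for each \<open>x\<close>, the mean of \<open>g\<close> over a circle around \<open>z\<close> in the complex line through \<open>z\<close> in direction \<open>x\<close>.\<close>
lemma entire_mean_value:
  fixes g :: "complex ^ 'n::finite \<Rightarrow> complex" and w :: "complex ^ 'n \<Rightarrow> real"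
  assumes g: "entire g" and w[measurable]: "w \<in> borel_measurable borel"
    and inv: "\<And>c x. cmod c = 1 \<Longrightarrow> w (c *s x) = w x"
    and int: "integrable lborel (\<lambda>x. g (z + x) * w x)"
  shows "(LINT x|lborel. g (z + x) * w x) = g z * (LINT x|lborel. w x)"
proof -
  define e where "e = (\<lambda>\<theta>::real. exp (2 * of_real pi * \<i> * of_real \<theta>))"
  have ce[continuous_intros]: "continuous_on S e" for S unfolding e_def by (intro continuous_intros)
  have e1: "cmod (e \<theta>) = 1" for \<theta> by (simp add: e_def norm_exp_eq_Re)
  have [measurable]: "g \<in> borel_measurable borel" by (rule entire_measurable[OF g])
  let ?f = "\<lambda>x. g (z + x) * w x"
  let ?h = "\<lambda>(\<theta>, x). indicator {0..1::real} \<theta> *\<^sub>R (g (z + e \<theta> *s x) * w x)"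
  have [measurable]: "(\<lambda>p. e (fst p) *s snd p) \<in> borel_measurable (borel \<Otimes>\<^sub>M (borel :: (complex^'n) measure))"
    unfolding borel_prod by (intro borel_measurable_continuous_onI continuous_intros ce[THEN continuous_on_compose2]) auto
  have hm[measurable]: "?h \<in> borel_measurable (lborel \<Otimes>\<^sub>M lborel)"
    unfolding case_prod_beta by measurable
  have rot: "(LINT x|lborel. F (e \<theta> *s x)) = (LINT x|lborel. F x)" if "F \<in> borel_measurable borel" for F :: "complex^'n \<Rightarrow> 'c::{banach, second_countable_topology}" and \<theta>
    by (rule lborel_integral_unimodular[OF e1 that])
  have fe: "?f (e \<theta> *s x) = g (z + e \<theta> *s x) * w x" for \<theta> x by (simp add: inv e1)
  have r1: "(LINT x|lborel. g (z + e \<theta> *s x) * w x) = (LINT x|lborel. ?f x)" for \<theta>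
    using rot[of ?f \<theta>] by (simp add: fe)
  have r2: "(LINT x|lborel. norm (g (z + e \<theta> *s x) * w x)) = (LINT x|lborel. norm (?f x))" for \<theta>
    using rot[of "\<lambda>x. norm (?f x)" \<theta>] by (simp add: fe[symmetric])
  have ei: "integrable lborel (\<lambda>x. g (z + e \<theta> *s x) * w x)" for \<theta>
  proof -
    have [measurable]: "(\<lambda>x. e \<theta> *s x) \<in> borel_measurable (borel :: (complex^'n) measure)"
      by (intro borel_measurable_continuous_onI continuous_intros)
    have "integrable (distr lborel borel (\<lambda>x. e \<theta> *s x)) ?f"
      using int by (simp add: lborel_distr_unimodular e1)
    from integrable_distr[OF _ this] show ?thesis by (simp add: fe)
  qed
  have hint: "integrable (lborel \<Otimes>\<^sub>M lborel) ?h"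
  proof (rule lborel_pair.Fubini_integrable)
    have "(\<lambda>\<theta>. LINT x|lborel. norm (?h (\<theta>, x))) = (\<lambda>\<theta>. indicator {0..1} \<theta> *\<^sub>R (LINT x|lborel. norm (?f x)))"
      using r2 by (auto simp: fun_eq_iff indicator_def)
    then show "integrable lborel (\<lambda>\<theta>. LINT x|lborel. norm (?h (\<theta>, x)))"
      by (simp add: integrable_mult_indicator)
    show "AE \<theta> in lborel. integrable lborel (\<lambda>x. ?h (\<theta>, x))"
      using ei by (auto simp: indicator_def)
  qed (rule hm)
  have m0: "(LINT \<theta>|lborel. ?h (\<theta>, x)) = g z * w x" for x
  proof -
    have "((\<lambda>\<theta>. g (z + e \<theta> *s x)) has_integral g z) {0..1}"
      using circle_mean_value[OF entire_line_holomorphic[OF g, of z x]] unfolding e_def by simp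
    then have hi: "((\<lambda>\<theta>. g (z + e \<theta> *s x) * w x) has_integral g z * w x) {0..1}"
      by (rule has_integral_mult_left)
    have "continuous_on {0..1} (\<lambda>\<theta>. g (z + e \<theta> *s x) * w x)"
      by (intro continuous_intros continuous_on_compose2[OF entire_continuous[OF g]]) auto
    then have "set_integrable lborel {0..1} (\<lambda>\<theta>. g (z + e \<theta> *s x) * w x)"
      by (rule borel_integrable_atLeastAtMost')
    from set_borel_integral_eq_integral(2)[OF this] integral_unique[OF hi]
    show ?thesis unfolding set_lebesgue_integral_def prod.case by (rule trans)
  qed
  have "(LINT x|lborel. ?f x) = (LINT \<theta>|lborel. LINT x|lborel. ?h (\<theta>, x))"
    by (simp add: r1)
  also have "\<dots> = (LINT x|lborel. LINT \<theta>|lborel. ?h (\<theta>, x))"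
    using lborel_pair.Fubini_integral[OF hint] by simp
  also have "\<dots> = g z * (LINT x|lborel. w x)"
    unfolding m0 by simp
  finally show ?thesis .
qed

section \<open>Strictly convex weights\<close>

text \<open>The pairing is complex bilinear, not Hermitian, so that it is holomorphic in its second
  argument; conjugating the first argument recovers the real inner product as the real part.\<close>
definition bil :: "complex ^ 'n::finite \<Rightarrow> complex ^ 'n \<Rightarrow> complex" where
  "bil a b = (\<Sum>i\<in>UNIV. a $ i * b $ i)"

definition vcnj :: "complex ^ 'n \<Rightarrow> complex ^ 'n" where
  "vcnj a = (\<chi> i. cnj (a $ i))"

lemma Re_bil_vcnj: "Re (bil (vcnj a) b) = a \<bullet> b"
  by (simp add: bil_def vcnj_def inner_vec_def inner_complex_def)

lemma bil_linear:
  "bil a (b + c) = bil a b + bil a c" "bil a (b - c) = bil a b - bil a c"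
  "bil (a + d) b = bil a b + bil d b" "bil (a - d) b = bil a b - bil d b"
  "bil a (t *s b) = t * bil a b" "bil a 0 = 0" "bil a (- b) = - bil a b"
  "bil (x *\<^sub>R a) b = of_real x * bil a b"
  by (simp_all add: bil_def algebra_simps sum.distrib sum_subtractf sum_distrib_left sum_negf)
     (simp_all add: scaleR_conv_of_real mult_ac)

lemma continuous_bil [continuous_intros]:
  assumes "continuous_on S f" "continuous_on S g"
  shows "continuous_on S (\<lambda>x. bil (f x) (g x))"
  unfolding bil_def by (intro continuous_intros assms)

lemma continuous_vcnj [continuous_intros]:
  assumes "continuous_on S f" shows "continuous_on S (\<lambda>x. vcnj (f x))"
  unfolding vcnj_def by (intro continuous_intros assms)

lemma bounded_linear_bil: "bounded_linear (bil a)"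
  unfolding linear_conv_bounded_linear[symmetric]
  by (auto simp: linear_iff bil_linear) (simp add: bil_def scaleR_sum_right)

text \<open>The Hessian bounds integrated twice along segments: at every point the graph of \<open>\<phi>\<close> lies between
  two paraboloids that touch it there, and \<open>G\<close> is the gradient.\<close>
definition quadratic_weight :: "real \<Rightarrow> real \<Rightarrow> (complex ^ 'n::finite \<Rightarrow> real) \<Rightarrow> (complex ^ 'n \<Rightarrow> complex ^ 'n) \<Rightarrow> bool" where
  "quadratic_weight m M \<phi> G \<longleftrightarrow> 0 < m \<and> m \<le> M \<and> continuous_on UNIV \<phi> \<and> continuous_on UNIV G \<and>
     (\<forall>z w. \<phi> z + G z \<bullet> (w - z) + m/2 * (norm (w - z))\<^sup>2 \<le> \<phi> w) \<and>
     (\<forall>z w. \<phi> w \<le> \<phi> z + G z \<bullet> (w - z) + M/2 * (norm (w - z))\<^sup>2)"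

lemma second_order_bound:
  fixes f f' f'' :: "real \<Rightarrow> real"
  assumes d1: "\<And>t. (f has_real_derivative f' t) (at t)"
    and d2: "\<And>t. (f' has_real_derivative f'' t) (at t)"
    and b: "\<And>t. f'' t \<le> B"
  shows "f 1 \<le> f 0 + f' 0 + B / 2"
proof -
  have 1: "f' t - B * t \<le> f' 0" if "0 \<le> t" for t
  proof -
    have "f' t - B * t \<le> f' 0 - B * 0"
      by (rule DERIV_nonpos_imp_nonincreasing[OF that])
         (auto intro!: exI derivative_eq_intros d2 simp: b)
    then show ?thesis by simp
  qed
  have "f 1 - f' 0 * 1 - B / 2 * 1\<^sup>2 \<le> f 0 - f' 0 * 0 - B / 2 * 0\<^sup>2"
  proof (rule DERIV_nonpos_imp_nonincreasing[where f="\<lambda>x. f x - f' 0 * x - B / 2 * x\<^sup>2"])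
    fix t :: real assume t: "0 \<le> t" "t \<le> 1"
    have "((\<lambda>x. f x - f' 0 * x - B / 2 * x\<^sup>2) has_real_derivative (f' t - f' 0 - B * t)) (at t)"
      by (auto intro!: derivative_eq_intros d1)
    moreover have "f' t - f' 0 - B * t \<le> 0" using 1[OF t(1)] by simp
    ultimately show "\<exists>y. ((\<lambda>x. f x - f' 0 * x - B / 2 * x\<^sup>2) has_real_derivative y) (at t) \<and> y \<le> 0" by blast
  qed simp
  then show ?thesis by simp
qed

lemma admissible_quadratic:
  assumes "admissible_weight m M \<phi>" "0 < m" "m \<le> M"
  obtains G where "quadratic_weight m M \<phi> G"
proof -
  from assms obtain G H where
    G: "\<And>z. (\<phi> has_derivative (\<lambda>v. G z \<bullet> v)) (at z)"
    and H: "\<And>z. (G has_derivative blinfun_apply (H z)) (at z)"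
    and b1: "\<And>z v. m * (norm v)\<^sup>2 \<le> v \<bullet> blinfun_apply (H z) v"
    and b2: "\<And>z v. v \<bullet> blinfun_apply (H z) v \<le> M * (norm v)\<^sup>2"
    unfolding admissible_weight_def by blast
  have line: "((\<lambda>t. z + t *\<^sub>R v) has_derivative (\<lambda>t. t *\<^sub>R v)) (at t)" for z v :: "complex^'n" and t :: real
    by (auto intro!: derivative_eq_intros)
  have 1: "((\<lambda>t. \<phi> (z + t *\<^sub>R v)) has_real_derivative (G (z + t *\<^sub>R v) \<bullet> v)) (at t)" for z v t
    using has_derivative_compose[OF line[of z v t] G]
    by (simp add: has_field_derivative_def mult_commute_abs)
  have 2: "((\<lambda>t. G (z + t *\<^sub>R v) \<bullet> v) has_real_derivative (v \<bullet> H (z + t *\<^sub>R v) v)) (at t)" for z v t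
    using has_derivative_inner_left[OF has_derivative_compose[OF line[of z v t] H], of v]
    by (simp add: has_field_derivative_def blinfun.scaleR_right mult_commute_abs inner_commute)
  have up: "\<phi> w \<le> \<phi> z + G z \<bullet> (w - z) + M/2 * (norm (w - z))\<^sup>2" for z w
    using second_order_bound[OF 1[of z "w - z"] 2[of z "w - z"] b2] by simp
  have "- \<phi> w \<le> - \<phi> z - G z \<bullet> (w - z) - m/2 * (norm (w - z))\<^sup>2" for z w
    using second_order_bound[of "\<lambda>t. - \<phi> (z + t *\<^sub>R (w - z))" _ _ "- m * (norm (w - z))\<^sup>2",
        OF DERIV_minus[OF 1[of z "w - z"]] DERIV_minus[OF 2[of z "w - z"]]] b1
    by simp
  then have lo: "\<phi> z + G z \<bullet> (w - z) + m/2 * (norm (w - z))\<^sup>2 \<le> \<phi> w" for z w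
    by (smt (verit))
  have "continuous_on UNIV \<phi>" "continuous_on UNIV G"
    using G H by (meson continuous_at_imp_continuous_on has_derivative_continuous)+
  with up lo assms show ?thesis by (intro that) (auto simp: quadratic_weight_def)
qed

text \<open>Compares the two tangent bounds at the point \<open>y + d\<close>, where \<open>d\<close> has length \<open>|x - y|\<close> and points
  along \<open>G x - G y\<close>.\<close>
lemma quadratic_weight_Lipschitz:
  assumes "quadratic_weight m M \<phi> G"
  shows "norm (G x - G y) \<le> M * norm (x - y)"
proof (cases "G x = G y")
  case True then show ?thesis using assms by (simp add: quadratic_weight_def)
next
  case False
  from assms have lo: "\<And>z w. \<phi> z + G z \<bullet> (w - z) \<le> \<phi> w"
    and up: "\<And>z w. \<phi> w \<le> \<phi> z + G z \<bullet> (w - z) + M/2 * (norm (w - z))\<^sup>2" and M: "0 < M"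
    unfolding quadratic_weight_def by (smt (verit) mult_nonneg_nonneg zero_le_power2 divide_nonneg_nonneg)+
  define d where "d = (norm (x - y) / norm (G x - G y)) *\<^sub>R (G x - G y)"
  have nd: "norm d = norm (x - y)" using False by (simp add: d_def)
  have "\<phi> x + G x \<bullet> (y + d - x) \<le> \<phi> y + G y \<bullet> d + M/2 * (norm d)\<^sup>2"
    using lo[of x "y + d"] up[of "y + d" y] by simp
  moreover have "\<phi> y \<le> \<phi> x + G x \<bullet> (y - x) + M/2 * (norm (x - y))\<^sup>2"
    using up[of y x] by (simp add: norm_minus_commute)
  ultimately have "(G x - G y) \<bullet> d \<le> M * (norm (x - y))\<^sup>2"
    by (simp add: nd inner_simps algebra_simps)
  moreover have "(G x - G y) \<bullet> d = norm (x - y) * norm (G x - G y)"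
    using False by (simp add: d_def power2_norm_eq_inner[symmetric] power2_eq_square)
  ultimately have "norm (x - y) * norm (G x - G y) \<le> norm (x - y) * (M * norm (x - y))"
    by (simp add: power2_eq_square mult_ac)
  then show ?thesis using False by (cases "x = y") auto
qed

section \<open>Pointwise estimates for entire functions\<close>

lemma entire_mult: "entire f \<Longrightarrow> entire g \<Longrightarrow> entire (\<lambda>z. f z * g z)"
  unfolding entire_def
proof
  fix z :: "complex ^ 'a"
  assume "\<forall>z. \<exists>L. (f has_derivative L) (at z) \<and> (\<forall>c v. L (c *s v) = c * L v)"
    "\<forall>z. \<exists>L. (g has_derivative L) (at z) \<and> (\<forall>c v. L (c *s v) = c * L v)"
  then obtain L1 L2 where "(f has_derivative L1) (at z)" "\<And>c v. L1 (c *s v) = c * L1 v"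
    "(g has_derivative L2) (at z)" "\<And>c v. L2 (c *s v) = c * L2 v" by blast
  then show "\<exists>L. ((\<lambda>z. f z * g z) has_derivative L) (at z) \<and> (\<forall>c v. L (c *s v) = c * L v)"
    by (intro exI[of _ "\<lambda>v. f z * L2 v + L1 v * g z"] conjI has_derivative_mult)
       (auto simp: algebra_simps)
qed

lemma entire_const_mult: "entire g \<Longrightarrow> entire (\<lambda>z. c * g z)"
  by (rule entire_mult) (auto simp: entire_def intro!: exI[of _ "\<lambda>v. 0"])

lemma entire_sum:
  assumes "\<And>j. j \<in> S \<Longrightarrow> entire (g j)" shows "entire (\<lambda>z. \<Sum>j\<in>S. g j z)"
  unfolding entire_def
proof
  fix z
  from assms have "\<forall>j\<in>S. \<exists>L. (g j has_derivative L) (at z) \<and> (\<forall>c v. L (c *s v) = c * L v)"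
    unfolding entire_def by blast
  then obtain L where L: "\<And>j. j\<in>S \<Longrightarrow> (g j has_derivative L j) (at z)" "\<And>j c v. j\<in>S \<Longrightarrow> L j (c *s v) = c * L j v"
    by metis
  then show "\<exists>L. ((\<lambda>z. \<Sum>j\<in>S. g j z) has_derivative L) (at z) \<and> (\<forall>c v. L (c *s v) = c * L v)"
    by (intro exI[of _ "\<lambda>v. \<Sum>j\<in>S. L j v"] conjI has_derivative_sum) (auto simp: sum_distrib_left)
qed

lemma entire_exp_bil: "entire (\<lambda>w. exp (a + bil b (w - z)))"
  unfolding entire_def
proof
  fix w
  have "((\<lambda>w. exp (a + bil b (w - z))) has_derivative (\<lambda>v. exp (a + bil b (w - z)) * bil b v)) (at w)"
  proof -
    have "((\<lambda>w. a + bil b (w - z)) has_derivative (\<lambda>v. 0 + (bil b v - 0))) (at w)"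
      unfolding bil_linear
      by (intro has_derivative_add has_derivative_const has_derivative_diff
          bounded_linear_imp_has_derivative bounded_linear_bil)
    from has_derivative_compose[OF this DERIV_exp[unfolded has_field_derivative_def]]
    show ?thesis by simp
  qed
  then show "\<exists>L. ((\<lambda>w. exp (a + bil b (w - z))) has_derivative L) (at w) \<and> (\<forall>c v. L (c *s v) = c * L v)"
    by (intro exI conjI) (auto simp: bil_linear)
qed

definition ball_volume :: "'a::euclidean_space itself \<Rightarrow> real" where
  "ball_volume _ = measure lborel (ball (0::'a) 1)"

lemma ball_volume_pos: "0 < ball_volume TYPE('a::euclidean_space)"
  unfolding ball_volume_def
  using emeasure_bounded_finite[of "ball (0::'a) 1"] content_ball_pos[of 1 "0::'a"] by simp

text \<open>Multiplying \<open>g\<close> by the exponential of a complex-linear function removes the linear part of \<open>\<phi>\<close> at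
  \<open>z\<close>. The mean value property then applies to the product, and the quadratic part of \<open>\<phi>\<close> costs at
  most the factor \<open>exp (M/2)\<close> on the unit ball.\<close>
lemma flat_mean_value:
  fixes g :: "complex ^ 'n::finite \<Rightarrow> complex"
  assumes qw: "quadratic_weight m M \<phi> G" and g: "entire g"
  shows "ball_volume TYPE(complex^'n) * (cmod (g z) * exp (- \<phi> z))
    \<le> exp (M/2) * (LINT x|lborel. indicator (ball z 1) x * (cmod (g x) * exp (- \<phi> x)))"
proof -
  let ?V = "ball_volume TYPE(complex^'n)"
  let ?B = "ball (0::complex^'n) 1"
  from qw have cp: "continuous_on UNIV \<phi>" unfolding quadratic_weight_def by simp
  have [measurable]: "g \<in> borel_measurable borel" "\<phi> \<in> borel_measurable borel"
    using entire_measurable[OF g] cp by (auto intro: borel_measurable_continuous_onI)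
  \<comment> \<open>The modulus of the second factor is \<open>exp (- G z \<bullet> (w - z))\<close>.\<close>
  define f where "f = (\<lambda>w. g w * exp (of_real 0 + bil (- vcnj (G z)) (w - z)))"
  have f: "entire f" unfolding f_def by (intro entire_mult g entire_exp_bil)
  have Re: "Re (bil (- vcnj a) b) = - (a \<bullet> b)" for a b :: "complex^'n"
    using Re_bil_vcnj[of a b] by (simp add: bil_def sum_negf)
  have fz: "f z = g z" by (simp add: f_def bil_linear)
  have cs: "set_integrable lborel ?B (\<lambda>x. h (z + x))" if "continuous_on UNIV h" for h :: "complex^'n \<Rightarrow> 'c::{banach,second_countable_topology}"
  proof -
    have "set_integrable lborel (cball (0::complex^'n) 1) (\<lambda>x. h (z + x))"
      unfolding set_integrable_def
      by (rule borel_integrable_compact)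
         (auto intro!: continuous_intros continuous_on_compose2[OF that])
    then show ?thesis by (rule set_integrable_subset) auto
  qed
  have i1: "integrable lborel (\<lambda>x. f (z + x) * of_real (indicator ?B x))"
    using cs[OF entire_continuous[OF f]] unfolding set_integrable_def
    by (simp add: scaleR_conv_of_real mult.commute)
  have "(LINT x|lborel. f (z + x) * of_real (indicator ?B x)) = f z * of_real (LINT x|lborel. indicator ?B x)"
    by (subst entire_mean_value[OF f borel_measurable_indicator _ i1])
       (simp_all add: norm_vector_scalar_mult_complex indicator_def[of "ball 0 1"])
  then have "g z * of_real ?V = (LINT x|lborel. f (z + x) * of_real (indicator ?B x))"
    by (simp add: fz ball_volume_def)
  then have "cmod (g z) * ?V = norm (LINT x|lborel. f (z + x) * of_real (indicator ?B x))"
    by (metis ball_volume_pos abs_of_pos norm_mult norm_of_real)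
  also have "\<dots> \<le> (LINT x|lborel. norm (f (z + x) * of_real (indicator ?B x)))"
    by (rule integral_norm_bound)
  also have "\<dots> \<le> (LINT x|lborel. indicator ?B x * (exp (\<phi> z + M/2) * (cmod (g (z + x)) * exp (- \<phi> (z + x)))))"
  proof (rule integral_mono)
    show "integrable lborel (\<lambda>x. norm (f (z + x) * of_real (indicator ?B x)))"
      using i1 by (rule integrable_norm)
    show "integrable lborel (\<lambda>x. indicator ?B x * (exp (\<phi> z + M/2) * (cmod (g (z + x)) * exp (- \<phi> (z + x)))))"
    proof -
      have "continuous_on UNIV (\<lambda>w. exp (\<phi> z + M/2) * (cmod (g w) * exp (- \<phi> w)))"
        by (intro continuous_intros entire_continuous[OF g] cp)
      from cs[OF this] show ?thesis unfolding set_integrable_def by simp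
    qed
    fix x
    show "norm (f (z + x) * of_real (indicator ?B x))
        \<le> indicator ?B x * (exp (\<phi> z + M/2) * (cmod (g (z + x)) * exp (- \<phi> (z + x))))"
    proof (cases "x \<in> ?B")
      case True
      then have "norm x \<le> 1" by simp
      then have "(norm x)\<^sup>2 \<le> 1" by (simp add: power_le_one)
      moreover have "0 < M" using qw by (auto simp: quadratic_weight_def)
      ultimately have "M/2 * (norm x)\<^sup>2 \<le> M/2" by simp
      moreover have "\<phi> (z + x) \<le> \<phi> z + G z \<bullet> x + M/2 * (norm x)\<^sup>2"
        using qw unfolding quadratic_weight_def by (metis add_diff_cancel_left')
      ultimately have "- (G z \<bullet> x) \<le> \<phi> z + M/2 - \<phi> (z + x)" by linarith
      then have "exp (- (G z \<bullet> x)) \<le> exp (\<phi> z + M/2) * exp (- \<phi> (z + x))"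
        by (simp add: exp_add[symmetric])
      then show ?thesis using True
        by (simp add: f_def norm_mult Re mult_left_mono mult.left_commute)
    qed simp
  qed
  also have "\<dots> = exp (\<phi> z + M/2) * (LINT x|lborel. indicator (ball z 1) (z + x) * (cmod (g (z + x)) * exp (- \<phi> (z + x))))"
    by (subst integral_mult_right_zero[symmetric], rule Bochner_Integration.integral_cong)
       (simp_all add: indicator_def dist_norm)
  also have "(LINT x|lborel. indicator (ball z 1) (z + x) * (cmod (g (z + x)) * exp (- \<phi> (z + x))))
     = (LINT x|lborel. indicator (ball z 1) x * (cmod (g x) * exp (- \<phi> x)))"
    by (rule lborel_integral_translate)
  finally have "exp (- \<phi> z) * (cmod (g z) * ?V) \<le> exp (- \<phi> z) * (exp (\<phi> z + M / 2) *
    (LINT x|lborel. indicator (ball z 1) x * (cmod (g x) * exp (- \<phi> x))))"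
    by (rule mult_left_mono) simp
  moreover have "exp (- \<phi> z) * (exp (\<phi> z + M / 2) * I) = exp (M / 2) * I" for I
    by (simp add: exp_minus exp_add)
  ultimately show ?thesis by (simp add: mult_ac)
qed

text \<open>When \<open>l\<close> is a small multiple of a quantity that is to be estimated, the first term can be
  absorbed. This does the work of Hoelder's inequality in passing from the exponent \<open>1\<close> to \<open>s\<close>.\<close>
lemma le_level_plus_power:
  fixes t l s :: real assumes "0 \<le> t" "0 < l" "1 \<le> s"
  shows "t \<le> l + t powr s * l powr (1 - s)"
proof (cases "t \<le> l")
  case True then show ?thesis by (simp add: add_increasing2)
next
  case False
  then have "1 * t \<le> (t / l) powr (s - 1) * t" using assms
    by (intro mult_right_mono ge_one_powr_ge_zero) auto
  also have "\<dots> = t powr s * l powr (1 - s)"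
    using assms False by (simp add: powr_divide powr_diff powr_minus field_simps)
  finally show ?thesis using assms by simp
qed

definition mean_const :: "real \<Rightarrow> real \<Rightarrow> 'a::euclidean_space itself \<Rightarrow> real" where
  "mean_const M s T = 2 * exp (M/2) * (2 * exp (M/2)) powr (s - 1) / ball_volume T"

text \<open>Splits the average at the level \<open>l\<close> that contributes exactly half of the left-hand side of
  \<open>flat_mean_value\<close>.\<close>
lemma flat_mean_value_powr:
  fixes g :: "complex ^ 'n::finite \<Rightarrow> complex"
  assumes qw: "quadratic_weight m M \<phi> G" and g: "entire g" and s: "1 \<le> s"
  shows "(cmod (g z) * exp (- \<phi> z)) powr s
    \<le> mean_const M s TYPE(complex^'n) *
      (LINT x|lborel. indicator (ball z 1) x * (cmod (g x) * exp (- \<phi> x)) powr s)"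
proof (cases "g z = 0")
  case True
  then show ?thesis using ball_volume_pos[where 'a="complex^'n"] s
    by (auto simp: mean_const_def intro!: mult_nonneg_nonneg)
next
  case False
  let ?V = "ball_volume TYPE(complex^'n)"
  define a where "a = (\<lambda>x. cmod (g x) * exp (- \<phi> x))"
  define l where "l = a z / (2 * exp (M/2))"
  have az: "0 < a z" using False by (simp add: a_def)
  then have l: "0 < l" by (simp add: l_def)
  from qw have cp: "continuous_on UNIV \<phi>" unfolding quadratic_weight_def by simp
  have ca: "continuous_on UNIV a" unfolding a_def by (intro continuous_intros entire_continuous[OF g] cp)
  have a0: "0 \<le> a x" for x by (simp add: a_def)
  have cs: "integrable lborel (\<lambda>x. indicator (ball z 1) x * h x)" if "continuous_on UNIV h" for h :: "complex^'n \<Rightarrow> real"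
  proof -
    have "set_integrable lborel (cball z 1) h"
      unfolding set_integrable_def
      by (rule borel_integrable_compact) (auto intro!: continuous_on_subset[OF that])
    then have "set_integrable lborel (ball z 1) h" by (rule set_integrable_subset) auto
    then show ?thesis by (simp add: set_integrable_def)
  qed
  have cas: "continuous_on UNIV (\<lambda>x. a x powr s)"
    by (rule continuous_on_powr') (use s a0 ca in auto)
  let ?I = "LINT x|lborel. indicator (ball z 1) x * a x powr s"
  have "?V * a z \<le> exp (M/2) * (LINT x|lborel. indicator (ball z 1) x * a x)"
    using flat_mean_value[OF qw g] by (simp add: a_def)
  also have "(LINT x|lborel. indicator (ball z 1) x * a x)
     \<le> (LINT x|lborel. indicator (ball z 1) x * (l + a x powr s * l powr (1 - s)))"
    by (intro integral_mono cs mult_left_mono le_level_plus_power l s a0 continuous_intros cas ca) auto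
  also have "\<dots> = (LINT x|lborel. indicator (ball z 1) x * l) + (LINT x|lborel. l powr (1-s) * (indicator (ball z 1) x * a x powr s))"
    using Bochner_Integration.integral_add[OF cs[of "\<lambda>x. l"] integrable_mult_right[OF cs[OF cas], of "l powr (1-s)"]]
    by (simp add: distrib_left mult_ac)
  also have "(LINT x|lborel. indicator (ball z 1) x * l) = ?V * l"
  proof -
    have "(LINT x|lborel. indicator (ball z 1) (z + x) * l) = (LINT x|lborel. indicator (ball z 1) x * l)"
      by (rule lborel_integral_translate)
    moreover have "indicator (ball z 1) (z + x) = (indicator (ball 0 1) x :: real)" for x
      by (simp add: indicator_def dist_norm)
    ultimately show ?thesis by (auto simp: ball_volume_def)
  qed
  also have "(LINT x|lborel. l powr (1-s) * (indicator (ball z 1) x * a x powr s)) = l powr (1-s) * ?I" by simp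
  finally have "?V * a z \<le> exp (M/2) * (?V * l + l powr (1-s) * ?I)" by simp
  also have "\<dots> = ?V * a z / 2 + exp (M/2) * l powr (1-s) * ?I"
    by (simp add: l_def algebra_simps)
  finally have "?V * a z \<le> 2 * exp (M/2) * l powr (1-s) * ?I" by simp
  then have "a z powr (s - 1) * (?V * a z) \<le> a z powr (s - 1) * (2 * exp (M/2) * l powr (1-s) * ?I)"
    by (rule mult_left_mono) simp
  also have "a z powr (s - 1) * (?V * a z) = ?V * a z powr s" using az by (simp add: powr_diff)
  also have "a z powr (s - 1) * (2 * exp (M/2) * l powr (1-s) * ?I)
     = 2 * exp (M/2) * (2 * exp (M/2)) powr (s - 1) * ?I"
    using az by (simp add: l_def powr_divide powr_diff field_simps)
  finally show ?thesis using ball_volume_pos[where 'a="complex^'n"]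
    by (simp add: mean_const_def a_def field_simps)
qed

section \<open>The operators \<open>\<partial>/\<partial>\<zeta>\<^sub>k\<close>-bar and integration by parts\<close>

text \<open>Derivatives in a single real direction are enough for integration by parts, and they pass
  through a convolution one direction at a time.\<close>
definition has_dd :: "'a::real_normed_vector \<Rightarrow> ('a \<Rightarrow> complex) \<Rightarrow> ('a \<Rightarrow> complex) \<Rightarrow> bool" where
  "has_dd v X Y \<longleftrightarrow> (\<forall>x. ((\<lambda>s. X (x + s *\<^sub>R v)) has_vector_derivative Y x) (at 0))"

lemma has_dd_along_line:
  assumes "has_dd v X Y"
  shows "((\<lambda>s. X (x + s *\<^sub>R v)) has_vector_derivative Y (x + s0 *\<^sub>R v)) (at s0)"
proof -
  have 1: "((\<lambda>s. s - s0) has_vector_derivative 1) (at s0)"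
    by (auto intro!: derivative_eq_intros)
  have 2: "((\<lambda>s. X ((x + s0 *\<^sub>R v) + s *\<^sub>R v)) has_vector_derivative Y (x + s0 *\<^sub>R v)) (at (s0 - s0))"
    using assms by (simp add: has_dd_def)
  from vector_diff_chain_at[OF 1 2] show ?thesis
    by (simp add: o_def algebra_simps)
qed

lemma has_dd_add: "has_dd v X X' \<Longrightarrow> has_dd v Y Y' \<Longrightarrow> has_dd v (\<lambda>x. X x + Y x) (\<lambda>x. X' x + Y' x)"
  by (auto simp: has_dd_def intro: has_vector_derivative_add)

lemma has_dd_mult: "has_dd v X X' \<Longrightarrow> has_dd v Y Y' \<Longrightarrow> has_dd v (\<lambda>x. X x * Y x) (\<lambda>x. X x * Y' x + X' x * Y x)"
  using has_vector_derivative_mult[of "\<lambda>s. X (_ + s *\<^sub>R v)" _ 0 UNIV]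
  by (fastforce simp: has_dd_def)

lemma has_dd_const: "has_dd v (\<lambda>x. c) (\<lambda>x. 0)"
  by (auto simp: has_dd_def)

lemma has_dd_exp: "has_dd v X X' \<Longrightarrow> has_dd v (\<lambda>x. exp (X x)) (\<lambda>x. exp (X x) * X' x)"
  using field_vector_diff_chain_at[where g=exp]
  by (fastforce simp: has_dd_def o_def mult.commute intro: DERIV_exp)

text \<open>By translation invariance \<open>X (v + x) - X x\<close> has integral zero; it is also the integral of \<open>Y\<close> over
  the segment from \<open>x\<close> to \<open>x + v\<close>, and by Fubini each translate contributes the integral of \<open>Y\<close>.\<close>
lemma has_dd_integral_zero:
  fixes X :: "'a::euclidean_space \<Rightarrow> complex"
  assumes d: "has_dd v X Y" and cY: "continuous_on UNIV Y"
    and iX: "integrable lborel X" and iY: "integrable lborel Y"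
  shows "(LINT x|lborel. Y x) = 0"
proof -
  let ?h = "\<lambda>(s::real, x). indicator {0..1} s *\<^sub>R Y (s *\<^sub>R v + x)"
  have [measurable]: "(\<lambda>p. Y (fst p *\<^sub>R v + snd p)) \<in> borel_measurable (borel \<Otimes>\<^sub>M borel)"
    unfolding borel_prod
    by (intro borel_measurable_continuous_onI continuous_on_compose2[OF cY] continuous_intros) auto
  have hm: "?h \<in> borel_measurable (lborel \<Otimes>\<^sub>M lborel)"
    unfolding case_prod_beta by measurable
  have iYs: "integrable lborel (\<lambda>x. Y (s *\<^sub>R v + x))" for s
    using iY by (simp add: lborel_integral_translate)
  have hint: "integrable (lborel \<Otimes>\<^sub>M lborel) ?h"
  proof (rule lborel_pair.Fubini_integrable[OF hm])
    have "(LINT x|lborel. norm (Y (s *\<^sub>R v + x))) = (LINT x|lborel. norm (Y x))" for s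
      by (rule lborel_integral_translate(2)[of "\<lambda>x. norm (Y x)"])
    then have "(\<lambda>s. LINT x|lborel. norm (?h (s, x))) = (\<lambda>s. indicator {0..1} s *\<^sub>R (LINT x|lborel. norm (Y x)))"
      by (auto simp: fun_eq_iff indicator_def)
    then show "integrable lborel (\<lambda>s. LINT x|lborel. norm (?h (s, x)))"
      by (simp add: integrable_mult_indicator)
    show "AE s in lborel. integrable lborel (\<lambda>x. ?h (s, x))"
      using iYs by (auto simp: indicator_def)
  qed
  have m0: "(LINT s|lborel. ?h (s, x)) = X (v + x) - X x" for x
  proof -
    have hi: "((\<lambda>s. Y (s *\<^sub>R v + x)) has_integral X (x + 1 *\<^sub>R v) - X (x + 0 *\<^sub>R v)) {0..1}"
      using has_dd_along_line[OF d, of x]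
      by (intro fundamental_theorem_of_calculus)
         (auto simp: add.commute intro: has_vector_derivative_at_within)
    have "continuous_on {0..1} (\<lambda>s. Y (s *\<^sub>R v + x))"
      by (intro continuous_intros continuous_on_compose2[OF cY]) auto
    then have "set_integrable lborel {0..1} (\<lambda>s. Y (s *\<^sub>R v + x))"
      by (rule borel_integrable_atLeastAtMost')
    from set_borel_integral_eq_integral(2)[OF this] integral_unique[OF hi]
    show ?thesis by (simp add: set_lebesgue_integral_def add.commute)
  qed
  have "(LINT x|lborel. Y (s *\<^sub>R v + x)) = (LINT x|lborel. Y x)" for s
    by (rule lborel_integral_translate)
  then have "(LINT x|lborel. Y x) = (LINT s|lborel. LINT x|lborel. ?h (s, x))" by simp
  also have "\<dots> = (LINT x|lborel. LINT s|lborel. ?h (s, x))"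
    using lborel_pair.Fubini_integral[OF hint] by simp
  also have "\<dots> = (LINT x|lborel. X (v + x) - X x)" unfolding m0 ..
  also have "\<dots> = 0"
    using iX by (subst Bochner_Integration.integral_diff) (simp_all add: lborel_integral_translate)
  finally show ?thesis .
qed

text \<open>The cube makes this function twice continuously differentiable, with first and second
  directional derivatives \<open>bump_d\<close> and \<open>bump_dd\<close> below.\<close>
definition bump :: "'a::real_inner \<Rightarrow> real" where
  "bump x = (max 0 (1 - x \<bullet> x)) ^ 3"

lemma has_real_derivative_max_power:
  "((\<lambda>s::real. (max 0 s) ^ Suc (Suc k)) has_real_derivative (real (Suc (Suc k)) * (max 0 s) ^ Suc k)) (at s)"
proof -
  consider "s > 0" | "s < 0" | "s = 0" by linarith
  then show ?thesis
  proof cases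
    case 1
    have "((\<lambda>s::real. s ^ Suc (Suc k)) has_real_derivative (real (Suc (Suc k)) * (max 0 s) ^ Suc k)) (at s)"
      using DERIV_pow[of "Suc (Suc k)" s] 1 by (simp add: max_def del: power_Suc of_nat_Suc)
    then show ?thesis
      by (rule has_field_derivative_transform_within[where d=s]) (use 1 in \<open>auto simp: dist_real_def max_def\<close>)
  next
    case 2
    have "((\<lambda>s::real. 0) has_real_derivative (real (Suc (Suc k)) * (max 0 s) ^ Suc k)) (at s)"
      using 2 by (auto intro!: derivative_eq_intros)
    then show ?thesis
      by (rule has_field_derivative_transform_within[where d="-s"]) (use 2 in \<open>auto simp: dist_real_def max_def\<close>)
  next
    case 3
    have "((\<lambda>h::real. (max 0 h) ^ Suc k) \<longlongrightarrow> (max 0 0) ^ Suc k) (at 0)"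
      by (intro tendsto_intros)
    moreover have "(\<lambda>h::real. (max 0 h) ^ Suc (Suc k) / h) = (\<lambda>h. (max 0 h) ^ Suc k)"
      by (auto simp: fun_eq_iff max_def)
    ultimately have "((\<lambda>h::real. (max 0 h) ^ Suc (Suc k) / h) \<longlongrightarrow> 0) (at 0)" by simp
    then show ?thesis using 3 by (simp add: has_field_derivative_iff)
  qed
qed

lemma bump_derivative:
  fixes a x v :: "'a::real_inner"
  shows "((\<lambda>s::real. (max 0 (1 - (a + s *\<^sub>R v) \<bullet> (a + s *\<^sub>R v))) ^ Suc (Suc k)) has_real_derivative
     - 2 * real (Suc (Suc k)) * (max 0 (1 - a \<bullet> a)) ^ Suc k * (a \<bullet> v)) (at 0)"
proof -
  have "((\<lambda>s::real. 1 - (a + s *\<^sub>R v) \<bullet> (a + s *\<^sub>R v)) has_real_derivative (- 2 * (a \<bullet> v))) (at 0)"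
    unfolding has_field_derivative_def
    by (auto intro!: derivative_eq_intros simp: inner_commute)
  from DERIV_chain2[OF has_real_derivative_max_power[where k=k] this] show ?thesis
    by (rule DERIV_cong) (simp del: power_Suc of_nat_Suc)
qed

definition bump_d :: "'a::real_inner \<Rightarrow> 'a \<Rightarrow> real" where
  "bump_d v x = - 6 * (max 0 (1 - x \<bullet> x)) ^ 2 * (x \<bullet> v)"

definition bump_dd :: "'a::real_inner \<Rightarrow> 'a \<Rightarrow> 'a \<Rightarrow> real" where
  "bump_dd v w x = 24 * max 0 (1 - x \<bullet> x) * (x \<bullet> v) * (x \<bullet> w) - 6 * (max 0 (1 - x \<bullet> x)) ^ 2 * (v \<bullet> w)"

lemma has_dd_bump: "has_dd v (\<lambda>x. of_real (bump x)) (\<lambda>x. of_real (bump_d v x))"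
  unfolding has_dd_def bump_def bump_d_def
  by (intro allI has_vector_derivative_of_real)
     (use bump_derivative[where k=1] in \<open>simp add: has_real_derivative_iff_has_vector_derivative numeral_eq_Suc\<close>)

lemma has_dd_bump_d:
  fixes v w :: "'a::real_inner"
  shows "has_dd w (\<lambda>x. of_real (bump_d v x)) (\<lambda>x. of_real (bump_dd v w x))"
  unfolding has_dd_def
proof (intro allI has_vector_derivative_of_real)
  fix x :: 'a
  have A: "((\<lambda>s. (max 0 (1 - (x + s *\<^sub>R w) \<bullet> (x + s *\<^sub>R w))) ^ 2) has_real_derivative - 4 * max 0 (1 - x \<bullet> x) * (x \<bullet> w)) (at 0)"
    using bump_derivative[where k=0 and a=x and v=w] by (simp add: numeral_2_eq_2 mult_ac)
  have B: "((\<lambda>s. (x + s *\<^sub>R w) \<bullet> v) has_real_derivative (w \<bullet> v)) (at 0)"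
    unfolding has_field_derivative_def by (auto intro!: derivative_eq_intros)
  have "((\<lambda>s. (-6) * (max 0 (1 - (x + s *\<^sub>R w) \<bullet> (x + s *\<^sub>R w))) ^ 2 * ((x + s *\<^sub>R w) \<bullet> v)) has_real_derivative bump_dd v w x) (at 0)"
    by (rule DERIV_cong[OF DERIV_mult[OF DERIV_cmult[OF A, of "-6"] B]])
       (simp add: bump_dd_def algebra_simps inner_commute)
  then show "((\<lambda>s. bump_d v (x + s *\<^sub>R w)) has_real_derivative bump_dd v w x) (at 0)"
    unfolding bump_d_def .
qed

lemma continuous_bump [continuous_intros]:
  assumes "continuous_on S f"
  shows "continuous_on S (\<lambda>x. bump (f x))" "continuous_on S (\<lambda>x. bump_d v (f x))" "continuous_on S (\<lambda>x. bump_dd v w (f x))"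
  unfolding bump_def bump_d_def bump_dd_def by (intro continuous_intros assms)+

lemma bump_support:
  assumes "1 \<le> norm x" shows "bump x = 0" "bump_d v x = 0" "bump_dd v w x = 0"
proof -
  have "1 \<le> x \<bullet> x" using assms by (simp add: dot_square_norm)
  then show "bump x = 0" "bump_d v x = 0" "bump_dd v w x = 0"
    by (simp_all add: bump_def bump_d_def bump_dd_def max_def)
qed

lemma bump_range: "0 \<le> bump x" "bump x \<le> 1"
  unfolding bump_def by (auto intro!: power_le_one simp: max_def)

lemma bump_d_bound: "\<bar>bump_d v x\<bar> \<le> 6 * norm v"
proof (cases "1 \<le> norm x")
  case True then show ?thesis by (simp add: bump_support)
next
  case False
  have "\<bar>x \<bullet> v\<bar> \<le> norm x * norm v" by (rule Cauchy_Schwarz_ineq2)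
  also have "\<dots> \<le> 1 * norm v" using False by (intro mult_right_mono) auto
  finally have 1: "\<bar>x \<bullet> v\<bar> \<le> norm v" by simp
  have "(max 0 (1 - x \<bullet> x)) ^ 2 \<le> (1::real)" by (intro power_le_one) (auto simp: max_def)
  then have "6 * (max 0 (1 - x \<bullet> x)) ^ 2 * \<bar>x \<bullet> v\<bar> \<le> 6 * 1 * norm v"
    using 1 by (intro mult_mono) auto
  then show ?thesis by (simp add: bump_d_def abs_mult)
qed

lemma bump_dd_bound: "\<bar>bump_dd v w x\<bar> \<le> 30 * norm v * norm w"
proof (cases "1 \<le> norm x")
  case True then show ?thesis by (simp add: bump_support)
next
  case False
  have 0: "\<bar>x \<bullet> v\<bar> \<le> norm v" for v
  proof -
    have "\<bar>x \<bullet> v\<bar> \<le> norm x * norm v" by (rule Cauchy_Schwarz_ineq2)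
    also have "\<dots> \<le> 1 * norm v" using False by (intro mult_right_mono) auto
    finally show ?thesis by simp
  qed
  let ?m = "max 0 (1 - x \<bullet> x)"
  have m: "0 \<le> ?m" "?m \<le> 1" "?m ^ 2 \<le> 1" by (auto intro!: power_le_one simp: max_def)
  have "\<bar>24 * ?m * (x \<bullet> v) * (x \<bullet> w)\<bar> \<le> 24 * 1 * norm v * norm w"
    unfolding abs_mult using m 0 by (intro mult_mono) auto
  moreover have "\<bar>6 * ?m ^ 2 * (v \<bullet> w)\<bar> \<le> 6 * 1 * (norm v * norm w)"
    unfolding abs_mult using m Cauchy_Schwarz_ineq2[of v w] by (intro mult_mono) auto
  ultimately show ?thesis unfolding bump_dd_def by linarith
qed

lemma integrable_compact_support:
  fixes X :: "'a::euclidean_space \<Rightarrow> 'b::{banach, second_countable_topology}"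
  assumes "continuous_on UNIV X" and "\<And>x. R \<le> norm (x - a) \<Longrightarrow> X x = 0"
  shows "integrable lborel X"
proof -
  have "integrable lborel (\<lambda>x. indicator (cball a R) x *\<^sub>R X x)"
    by (rule borel_integrable_compact) (auto intro!: continuous_on_subset[OF assms(1)])
  moreover have "indicator (cball a R) x *\<^sub>R X x = X x" for x
    using assms(2)[of x] by (auto simp: indicator_def dist_norm norm_minus_commute)
  ultimately show ?thesis by simp
qed

text \<open>\<open>Y\<close> is the derivative of \<open>X\<close> with respect to the conjugate of the \<open>k\<close>-th coordinate, half of
  \<open>\<partial>/\<partial>x\<^sub>k + \<i> \<partial>/\<partial>y\<^sub>k\<close>, with continuous partial derivatives.\<close>
definition has_dbar :: "'n::finite \<Rightarrow> (complex ^ 'n \<Rightarrow> complex) \<Rightarrow> (complex ^ 'n \<Rightarrow> complex) \<Rightarrow> bool" where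
  "has_dbar k X Y \<longleftrightarrow> continuous_on UNIV X \<and>
     (\<exists>X1 X2. has_dd (axis k 1) X X1 \<and> has_dd (axis k \<i>) X X2 \<and>
        continuous_on UNIV X1 \<and> continuous_on UNIV X2 \<and> Y = (\<lambda>x. (X1 x + \<i> * X2 x) / 2))"

lemma has_dbarI:
  assumes "continuous_on UNIV X" "has_dd (axis k 1) X X1" "has_dd (axis k \<i>) X X2"
    "continuous_on UNIV X1" "continuous_on UNIV X2" "\<And>x. Y x = (X1 x + \<i> * X2 x) / 2"
  shows "has_dbar k X Y"
  unfolding has_dbar_def
  by (intro conjI exI[of _ X1] exI[of _ X2]) (use assms in auto)

lemma has_dbar_continuous:
  assumes "has_dbar k X Y" shows "continuous_on UNIV X" "continuous_on UNIV Y"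
  using assms unfolding has_dbar_def by (auto intro!: continuous_intros)

text \<open>After multiplication with the cutoff \<open>bump (x / (n+1))\<close> everything has compact support and
  \<open>has_dd_integral_zero\<close> applies; the error term contains a derivative of the cutoff, which is
  \<open>O(1/n)\<close>.\<close>
theorem has_dbar_integral_zero:
  assumes d: "has_dbar k X Y" and iX: "integrable lborel X" and iY: "integrable lborel Y"
  shows "(LINT x|lborel. Y x) = 0"
proof -
  from d obtain X1 X2 where
    d1: "has_dd (axis k 1) X X1" and d2: "has_dd (axis k \<i>) X X2" and
    c1: "continuous_on UNIV X1" and c2: "continuous_on UNIV X2" and
    Y: "\<And>x. Y x = (X1 x + \<i> * X2 x) / 2" and cX: "continuous_on UNIV X"
    unfolding has_dbar_def by auto
  define b where "b = (\<lambda>(n::nat) (x::complex^'a). bump (inverse (real (Suc n)) *\<^sub>R x))"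
  define bd where "bd = (\<lambda>(n::nat) v (x::complex^'a). inverse (real (Suc n)) * bump_d v (inverse (real (Suc n)) *\<^sub>R x))"
  have db: "has_dd v (\<lambda>x. of_real (b n x)) (\<lambda>x. of_real (bd n v x))" for n v
    unfolding has_dd_def
  proof
    fix x
    have "((\<lambda>s. of_real (bump (inverse (real (Suc n)) *\<^sub>R x + s *\<^sub>R v)) :: complex) has_vector_derivative of_real (bump_d v (inverse (real (Suc n)) *\<^sub>R x))) (at (inverse (real (Suc n)) * 0))"
      using has_dd_bump[of v] by (simp add: has_dd_def)
    moreover have "((\<lambda>s. inverse (real (Suc n)) * s) has_vector_derivative inverse (real (Suc n))) (at 0)"
      by (auto intro!: derivative_eq_intros)
    ultimately have "((\<lambda>s. of_real (bump (inverse (real (Suc n)) *\<^sub>R x + s *\<^sub>R v)) :: complex) \<circ> (\<lambda>s. inverse (real (Suc n)) * s)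
       has_vector_derivative inverse (real (Suc n)) *\<^sub>R of_real (bump_d v (inverse (real (Suc n)) *\<^sub>R x))) (at 0)"
      by (intro vector_diff_chain_at)
    then show "((\<lambda>s. of_real (b n (x + s *\<^sub>R v)) :: complex) has_vector_derivative of_real (bd n v x)) (at 0)"
      by (simp add: o_def b_def bd_def scaleR_conv_of_real[where 'a=complex] scaleR_add_right)
  qed
  have cb: "continuous_on UNIV (b n)" "continuous_on UNIV (bd n v)" for n v
    unfolding b_def bd_def by (intro continuous_intros)+
  have supp: "b n x = 0" "bd n v x = 0" if "real (Suc n) \<le> norm (x - 0)" for n v x
    using that bump_support[of "inverse (real (Suc n)) *\<^sub>R x"] unfolding b_def bd_def
    by (auto simp: field_simps)
  have z: "(LINT x|lborel. X x * of_real (bd n v x) + X' x * of_real (b n x)) = 0"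
    and i: "integrable lborel (\<lambda>x. X x * of_real (bd n v x) + X' x * of_real (b n x))"
    if "has_dd v X X'" "continuous_on UNIV X'" for v X' n
  proof -
    have c: "continuous_on UNIV (\<lambda>x. X x * of_real (bd n v x) + X' x * of_real (b n x))"
      "continuous_on UNIV (\<lambda>x. X x * of_real (b n x))"
      by (intro continuous_intros cX cb that)+
    show i: "integrable lborel (\<lambda>x. X x * of_real (bd n v x) + X' x * of_real (b n x))"
      by (rule integrable_compact_support[OF c(1), where R="real (Suc n)" and a=0]) (simp add: supp)
    show "(LINT x|lborel. X x * of_real (bd n v x) + X' x * of_real (b n x)) = 0"
      by (rule has_dd_integral_zero[OF has_dd_mult[OF that(1) db] c(1) _ i])
         (rule integrable_compact_support[OF c(2), where R="real (Suc n)" and a=0], simp add: supp)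
  qed
  define dn where "dn = (\<lambda>n x. X x * ((of_real (bd n (axis k 1) x) + \<i> * of_real (bd n (axis k \<i>) x)) / 2))"
  have e: "(LINT x|lborel. Y x * of_real (b n x)) = - (LINT x|lborel. dn n x)" for n
  proof -
    have iYb: "integrable lborel (\<lambda>x. Y x * of_real (b n x))" and idn: "integrable lborel (dn n)"
    proof -
      have c: "continuous_on UNIV (\<lambda>x. Y x * of_real (b n x))" "continuous_on UNIV (dn n)"
        unfolding dn_def by (rule continuous_intros has_dbar_continuous[OF d] cX cb | simp)+
      show "integrable lborel (\<lambda>x. Y x * of_real (b n x))"
        by (rule integrable_compact_support[OF c(1), where R="real (Suc n)" and a=0]) (simp add: supp)
      show "integrable lborel (dn n)"
        by (rule integrable_compact_support[OF c(2), where R="real (Suc n)" and a=0]) (simp add: supp dn_def)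
    qed
    have "(LINT x|lborel. (Y x * of_real (b n x) + dn n x)) =
      (LINT x|lborel. ((X x * of_real (bd n (axis k 1) x) + X1 x * of_real (b n x)) +
         \<i> * (X x * of_real (bd n (axis k \<i>) x) + X2 x * of_real (b n x))) / 2)"
      by (rule Bochner_Integration.integral_cong) (auto simp: Y dn_def field_simps)
    also have "\<dots> = 0"
      using z[OF d1 c1] z[OF d2 c2] i[OF d1 c1] i[OF d2 c2] by (simp add: Bochner_Integration.integral_add)
    finally show ?thesis using iYb idn by (simp add: eq_neg_iff_add_eq_0)
  qed
  have l1: "(\<lambda>n. LINT x|lborel. Y x * of_real (b n x)) \<longlonglongrightarrow> (LINT x|lborel. Y x)"
  proof (rule integral_dominated_convergence[where w="\<lambda>x. norm (Y x)"])
    have [measurable]: "Y \<in> borel_measurable borel" using iY by auto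
    show "Y \<in> borel_measurable lborel" by simp
    show "(\<lambda>x. Y x * of_real (b n x)) \<in> borel_measurable lborel" for n
      using borel_measurable_continuous_onI[OF cb(1)[of n]] by measurable
    show "integrable lborel (\<lambda>x. norm (Y x))" using iY by simp
    show "AE x in lborel. (\<lambda>n. Y x * of_real (b n x)) \<longlonglongrightarrow> Y x"
    proof (rule AE_I2)
      fix x :: "complex^'a"
      have "(\<lambda>n. inverse (real (Suc n)) *\<^sub>R x) \<longlonglongrightarrow> 0 *\<^sub>R x"
        using tendsto_scaleR[OF LIMSEQ_inverse_real_of_nat tendsto_const[of x sequentially]] by simp
      moreover have "isCont (bump :: complex^'a \<Rightarrow> real) 0"
        using continuous_bump(1)[OF continuous_on_id[of "UNIV :: (complex^'a) set"]] by (simp add: continuous_on_eq_continuous_at)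
      ultimately have "(\<lambda>n. b n x) \<longlonglongrightarrow> bump (0::complex^'a)"
        unfolding b_def using isCont_tendsto_compose by fastforce
      then have "(\<lambda>n. Y x * of_real (b n x)) \<longlonglongrightarrow> Y x * of_real 1"
        by (intro tendsto_intros) (simp add: bump_def)
      then show "(\<lambda>n. Y x * of_real (b n x)) \<longlonglongrightarrow> Y x" by simp
    qed
    show "AE x in lborel. norm (Y x * of_real (b n x)) \<le> norm (Y x)" for n
      by (intro AE_I2) (auto simp: norm_mult b_def abs_of_nonneg bump_range intro!: mult_left_le)
  qed
  have "norm (LINT x|lborel. dn n x) \<le> inverse (real (Suc n)) * (6 * (LINT x|lborel. norm (X x)))" for n
  proof -
    have nd: "norm (dn n x) \<le> inverse (real (Suc n)) * (6 * norm (X x))" for x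
    proof -
      have 1: "\<bar>bd n v x\<bar> \<le> inverse (real (Suc n)) * 6" if "norm v = 1" for v
        using bump_d_bound[of v] that unfolding bd_def by (simp add: abs_mult mult_left_mono)
      have n1: "norm (axis k 1 :: complex^'a) = 1" "norm (axis k \<i> :: complex^'a) = 1"
        by (simp_all add: norm_eq_sqrt_inner inner_axis_axis)
      have "norm (of_real (bd n (axis k 1) x) + \<i> * of_real (bd n (axis k \<i>) x) :: complex)
        \<le> \<bar>bd n (axis k 1) x\<bar> + \<bar>bd n (axis k \<i>) x\<bar>"
        by (rule norm_triangle_le) (simp add: norm_mult)
      also have "\<dots> \<le> 2 * (inverse (real (Suc n)) * 6)" using add_mono[OF 1[OF n1(1)] 1[OF n1(2)]] by simp
      finally have "norm (X x) * (norm (of_real (bd n (axis k 1) x) + \<i> * of_real (bd n (axis k \<i>) x) :: complex) / 2)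
         \<le> norm (X x) * (inverse (real (Suc n)) * 6)" by (intro mult_left_mono) auto
      then show ?thesis by (simp add: dn_def norm_mult norm_divide mult_ac)
    qed
    have c: "continuous_on UNIV (dn n)"
      unfolding dn_def by (rule continuous_intros cX cb | simp)+
    have idn: "integrable lborel (dn n)"
      by (rule integrable_compact_support[OF c, where R="real (Suc n)" and a=0]) (simp add: supp dn_def)
    have "norm (LINT x|lborel. dn n x) \<le> (LINT x|lborel. norm (dn n x))"
      by (rule integral_norm_bound)
    also have "\<dots> \<le> (LINT x|lborel. inverse (real (Suc n)) * (6 * norm (X x)))"
      by (rule integral_mono) (use idn iX nd in auto)
    finally have "norm (LINT x|lborel. dn n x) \<le> (LINT x|lborel. inverse (real (Suc n)) * (6 * norm (X x)))" .
    then show ?thesis by simp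
  qed
  then have ev: "\<forall>\<^sub>F n in sequentially. norm (LINT x|lborel. Y x * of_real (b n x)) \<le> inverse (real (Suc n)) * (6 * (LINT x|lborel. norm (X x)))"
    by (simp add: e)
  have "(\<lambda>n. inverse (real (Suc n)) * (6 * (LINT x|lborel. norm (X x)))) \<longlonglongrightarrow> 0 * (6 * (LINT x|lborel. norm (X x)))"
    by (rule tendsto_mult[OF LIMSEQ_inverse_real_of_nat tendsto_const])
  then have lim: "(\<lambda>n. inverse (real (Suc n)) * (6 * (LINT x|lborel. norm (X x)))) \<longlonglongrightarrow> 0"
    unfolding mult_zero_left .
  have "(\<lambda>n. LINT x|lborel. Y x * of_real (b n x)) \<longlonglongrightarrow> 0"
    by (rule Lim_null_comparison[OF ev lim])
  with l1 show ?thesis using LIMSEQ_unique by blast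
qed

lemma has_dbar_const: "has_dbar k (\<lambda>x. c) (\<lambda>x. 0)"
  by (rule has_dbarI[OF _ has_dd_const has_dd_const]) auto

lemma has_dbar_add: "has_dbar k X X' \<Longrightarrow> has_dbar k Y Y' \<Longrightarrow> has_dbar k (\<lambda>x. X x + Y x) (\<lambda>x. X' x + Y' x)"
  unfolding has_dbar_def[of k X] has_dbar_def[of k Y]
  by (elim conjE exE, rule has_dbarI[OF _ has_dd_add has_dd_add]) (auto intro!: continuous_intros simp: field_simps)

lemma has_dbar_mult: "has_dbar k X X' \<Longrightarrow> has_dbar k Y Y' \<Longrightarrow> has_dbar k (\<lambda>x. X x * Y x) (\<lambda>x. X x * Y' x + X' x * Y x)"
  unfolding has_dbar_def[of k X] has_dbar_def[of k Y]
  by (elim conjE exE, rule has_dbarI[OF _ has_dd_mult has_dd_mult]) (auto intro!: continuous_intros simp: field_simps)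

lemma has_dbar_exp: "has_dbar k X X' \<Longrightarrow> has_dbar k (\<lambda>x. exp (X x)) (\<lambda>x. exp (X x) * X' x)"
  unfolding has_dbar_def[of k X]
  by (elim conjE exE, rule has_dbarI[OF _ has_dd_exp has_dd_exp]) (auto intro!: continuous_intros simp: field_simps)

lemma has_dbar_cmult: "has_dbar k X X' \<Longrightarrow> has_dbar k (\<lambda>x. c * X x) (\<lambda>x. c * X' x)"
  using has_dbar_mult[OF has_dbar_const[of k c]] by simp

lemma has_dbar_diff: "has_dbar k X X' \<Longrightarrow> has_dbar k Y Y' \<Longrightarrow> has_dbar k (\<lambda>x. X x - Y x) (\<lambda>x. X' x - Y' x)"
  using has_dbar_add[of k X X' "\<lambda>x. (-1) * Y x" "\<lambda>x. (-1) * Y' x"] has_dbar_cmult[of k Y Y' "-1"] by simp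

lemma has_dbar_sum:
  assumes "\<And>i. i \<in> I \<Longrightarrow> has_dbar k (X i) (X' i)"
  shows "has_dbar k (\<lambda>x. \<Sum>i\<in>I. X i x) (\<lambda>x. \<Sum>i\<in>I. X' i x)"
  using assms by (induction I rule: infinite_finite_induct) (auto intro: has_dbar_const has_dbar_add)

lemma has_dbar_prod:
  assumes "finite I" "\<And>i. i \<in> I \<Longrightarrow> has_dbar k (X i) (X' i)"
  shows "has_dbar k (\<lambda>x. \<Prod>i\<in>I. X i x) (\<lambda>x. \<Sum>i\<in>I. X' i x * (\<Prod>j\<in>I - {i}. X j x))"
  using assms
proof (induction I)
  case empty
  then show ?case by (simp add: has_dbar_const)
next
  case (insert a I)
  have e: "insert a I - {a} = I" using insert by auto
  have "(\<Sum>i\<in>I. X' i x * (\<Prod>j\<in>insert a I - {i}. X j x)) = X a x * (\<Sum>i\<in>I. X' i x * (\<Prod>j\<in>I - {i}. X j x))" for x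
    unfolding sum_distrib_left
  proof (rule sum.cong)
    fix i assume "i \<in> I"
    then have "insert a I - {i} = insert a (I - {i})" using insert by auto
    then show "X' i x * (\<Prod>j\<in>insert a I - {i}. X j x) = X a x * (X' i x * (\<Prod>j\<in>I - {i}. X j x))"
      using insert by simp
  qed simp
  then show ?case using has_dbar_mult[OF insert.prems[of a] insert.IH] insert by (simp add: e add.commute)
qed

lemma has_dbar_linear:
  assumes "bounded_linear h"
  shows "has_dbar k h (\<lambda>x. (h (axis k 1) + \<i> * h (axis k \<i>)) / 2)"
proof (rule has_dbarI)
  interpret h: bounded_linear h by fact
  have "has_dd v h (\<lambda>x. h v)" for v
    unfolding has_dd_def
    by (auto simp: h.add h.scaleR intro!: derivative_eq_intros)
  then show "has_dd (axis k 1) h (\<lambda>x. h (axis k 1))" "has_dd (axis k \<i>) h (\<lambda>x. h (axis k \<i>))" by auto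
  show "continuous_on UNIV h" using assms by (rule linear_continuous_on)
qed auto

lemma has_dbar_coordinate: "has_dbar k (\<lambda>x. x $ i) (\<lambda>x. 0)"
  using has_dbar_linear[OF bounded_linear_vec_nth, of k i] by (cases "i = k") (simp_all add: axis_def)

lemma has_dbar_cnj_coordinate:
  fixes k :: "'n::finite"
  shows "has_dbar k (\<lambda>x. cnj (x $ i)) (\<lambda>x. if i = k then 1 else 0)"
proof -
  have "bounded_linear (\<lambda>x::complex^'n. cnj (x $ i))"
    by (rule bounded_linear_compose[OF bounded_linear_cnj bounded_linear_vec_nth])
  from has_dbar_linear[OF this, of k] show ?thesis by (cases "i = k") (simp_all add: axis_def)
qed

lemma axis_complex_smult: "axis k (\<i>::complex) = \<i> *s axis k 1"
  by (simp add: vec_eq_iff axis_def)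

text \<open>Cauchy's inequality on the unit disc of the complex lines in direction \<open>v\<close>. With \<open>h = g\<close> it shows
  that the derivative of an entire function is continuous.\<close>
lemma entire_derivative_bound:
  assumes g: "entire g" and L: "(g has_derivative L) (at x)" "\<And>c v. L (c *s v) = c * L v"
    and h: "entire h" and L': "(h has_derivative L') (at y)" "\<And>c v. L' (c *s v) = c * L' v"
    and b: "\<And>t. cmod t = 1 \<Longrightarrow> cmod (g (x + t *s v) - h (y + t *s v)) \<le> B"
  shows "cmod (L v - L' v) \<le> B"
proof -
  let ?f = "\<lambda>t. g (x + t *s v) - h (y + t *s v)"
  have hol: "?f holomorphic_on S" for S by (intro holomorphic_on_diff entire_line_holomorphic g h)
  have D: "((\<lambda>t. g (x + t *s v)) has_field_derivative (L v)) (at 0)"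
    if L: "(g has_derivative L) (at x)" "\<And>c v. L (c *s v) = c * L v" for g L and x :: "complex^'a"
  proof -
    have "((\<lambda>t. g (x + t *s v)) has_derivative (\<lambda>t. L (t *s v))) (at 0)"
      using has_derivative_compose[OF has_derivative_complex_line[of x v 0], of g L] L(1) by simp
    moreover have "(\<lambda>t. L (t *s v)) = (*) (L v)" by (auto simp: L(2) mult.commute)
    ultimately show ?thesis unfolding has_field_derivative_def by simp
  qed
  have "deriv ?f 0 = L v - L' v"
    by (intro DERIV_imp_deriv DERIV_diff D L L')
  moreover have "norm ((deriv ^^ 1) ?f 0) \<le> fact 1 * B / 1 ^ 1"
    by (rule Cauchy_inequality) (use hol b holomorphic_on_imp_continuous_on[OF hol] in auto)
  ultimately show ?thesis by simp
qed

lemma has_dbar_entire: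
  assumes g: "entire g"
  shows "has_dbar k g (\<lambda>x. 0)"
proof -
  from g obtain L where L: "\<And>x. (g has_derivative L x) (at x)" "\<And>x c v. L x (c *s v) = c * L x v"
    unfolding entire_def by metis
  have dd: "has_dd v g (\<lambda>x. L x v)" for v
    unfolding has_dd_def
  proof
    fix x
    have 1: "((\<lambda>s::real. x + s *\<^sub>R v) has_derivative (\<lambda>s. s *\<^sub>R v)) (at 0)"
      by (auto intro!: derivative_eq_intros)
    have "((\<lambda>s. g (x + s *\<^sub>R v)) has_derivative (\<lambda>s. L x (s *\<^sub>R v))) (at 0)"
      using has_derivative_compose[OF 1, of g "L x"] L(1)[of x] by simp
    moreover have "L x (s *\<^sub>R v) = s *\<^sub>R L x v" for s
      by (rule linear_scale[OF has_derivative_linear[OF L(1)]])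
    ultimately show "((\<lambda>s. g (x + s *\<^sub>R v)) has_vector_derivative L x v) (at 0)"
      unfolding has_vector_derivative_def by simp
  qed
  have cont: "continuous_on UNIV (\<lambda>x. L x v)" for v
    unfolding continuous_on_iff
  proof (intro ballI allI impI)
    fix x :: "complex^'a" and e :: real assume "0 < e"
    have "uniformly_continuous_on (cball x (norm v + 1)) g"
      by (rule compact_uniformly_continuous[OF continuous_on_subset[OF entire_continuous[OF g]]]) auto
    then obtain d where d: "0 < d" "\<And>a b. a \<in> cball x (norm v + 1) \<Longrightarrow> b \<in> cball x (norm v + 1) \<Longrightarrow> dist a b < d \<Longrightarrow> dist (g a) (g b) < e/2"
      unfolding uniformly_continuous_on_def using \<open>0 < e\<close> by (metis half_gt_zero dist_commute)
    have "dist (L y v) (L x v) < e" if y: "dist y x < min d 1" for y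
    proof -
      have "cmod (L y v - L x v) \<le> e/2"
      proof (rule entire_derivative_bound[OF g L g L])
        fix t :: complex assume t: "cmod t = 1"
        have "dist (g (y + t *s v)) (g (x + t *s v)) < e/2"
        proof (rule d(2))
          show "x + t *s v \<in> cball x (norm v + 1)" using t by (simp add: dist_norm norm_vector_scalar_mult_complex)
          have "norm (x - (y + t *s v)) \<le> norm (x - y) + norm (t *s v)"
            by (metis diff_diff_eq norm_triangle_ineq4)
          then show "y + t *s v \<in> cball x (norm v + 1)" using t y
            by (simp add: dist_norm norm_vector_scalar_mult_complex norm_minus_commute)
        qed (use y in \<open>simp add: dist_norm\<close>)
        then show "cmod (g (y + t *s v) - g (x + t *s v)) \<le> e/2" by (simp add: dist_norm)
      qed
      then show ?thesis using \<open>0 < e\<close> by (simp add: dist_norm)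
    qed
    then show "\<exists>d>0. \<forall>y\<in>UNIV. dist y x < d \<longrightarrow> dist (L y v) (L x v) < e"
      using d(1) by (intro exI[of _ "min d 1"]) auto
  qed
  show ?thesis
    by (rule has_dbarI[OF entire_continuous[OF g] dd dd cont cont]) (simp add: axis_complex_smult L(2))
qed

section \<open>Deforming the phase of a reproducing kernel\<close>

lemma sum_permutations_transpose_zero:
  fixes f :: "('n::finite \<Rightarrow> 'n) \<Rightarrow> complex"
  assumes "i \<noteq> j" and f: "\<And>p. p permutes UNIV \<Longrightarrow> f (p \<circ> Transposition.transpose i j) = f p"
  shows "(\<Sum>p | p permutes UNIV. of_int (sign p) * f p) = 0"
proof -
  let ?t = "Transposition.transpose i j"
  have tp: "?t permutes UNIV" by (rule permutes_swap_id) auto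
  have tt: "p \<circ> ?t \<circ> ?t = p" for p by (simp add: fun_eq_iff)
  let ?S = "\<Sum>p | p permutes UNIV. of_int (sign p) * f p"
  have "?S = (\<Sum>p | p permutes UNIV. of_int (sign (p \<circ> ?t)) * f (p \<circ> ?t))"
    by (rule sum.reindex_bij_witness[of _ "\<lambda>p. p \<circ> ?t" "\<lambda>p. p \<circ> ?t"])
       (auto simp: tt permutes_compose[OF tp])
  also have "\<dots> = (\<Sum>p | p permutes UNIV. - (of_int (sign p) * f p))"
  proof (rule sum.cong)
    fix p assume "p \<in> {p. p permutes (UNIV::'n set)}"
    then have p: "p permutes UNIV" by simp
    have "sign (p \<circ> ?t) = sign p * sign ?t"
      by (intro sign_compose permutes_imp_permutation[OF finite_class.finite_UNIV] p tp)
    then show "of_int (sign (p \<circ> ?t)) * f (p \<circ> ?t) = - (of_int (sign p) * f p)"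
      using assms(1) f[OF p] by (simp add: sign_swap_id)
  qed simp
  also have "\<dots> = - ?S" by (simp add: sum_negf)
  finally show ?thesis by simp
qed

text \<open>The left-hand side is the determinant of the matrix \<open>q\<close> with row \<open>i\<close> replaced by row \<open>j\<close>, which has
  two equal rows unless \<open>i = j\<close>.\<close>
lemma det_row_replaced:
  fixes q :: "'n::finite \<Rightarrow> 'n \<Rightarrow> complex"
  shows "(\<Sum>p | p permutes UNIV. of_int (sign p) * (q j (p i) * (\<Prod>k\<in>UNIV - {i}. q k (p k))))
    = (if i = j then det (\<chi> i l. q i l) else 0)"
proof (cases "i = j")
  case True
  then have "q j (p i) * (\<Prod>k\<in>UNIV - {i}. q k (p k)) = (\<Prod>k\<in>UNIV. q k (p k))" for p
    by (subst prod.remove[of UNIV i]) auto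
  then show ?thesis using True by (simp add: det_def)
next
  case False
  have "(\<Sum>p | p permutes UNIV. of_int (sign p) * (q j (p i) * (\<Prod>k\<in>UNIV - {i}. q k (p k)))) = 0"
  proof (rule sum_permutations_transpose_zero[OF False])
    fix p :: "'n \<Rightarrow> 'n"
    have e: "(\<Prod>k\<in>UNIV - {i}. q k (r k)) = q j (r j) * (\<Prod>k\<in>UNIV - {i} - {j}. q k (r k))" for r
      using False by (subst prod.remove[of _ j]) auto
    show "q j ((p \<circ> Transposition.transpose i j) i) * (\<Prod>k\<in>UNIV - {i}. q k ((p \<circ> Transposition.transpose i j) k)) =
          q j (p i) * (\<Prod>k\<in>UNIV - {i}. q k (p k))"
      unfolding e by (simp add: transpose_def)
  qed
  then show ?thesis using False by simp
qed

text \<open>Here \<open>q\<close> stands for the matrix of the conjugate derivatives of a phase \<open>F\<close>, \<open>s\<close> for its second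
  derivatives, \<open>a\<close> for a variation of the phase with derivatives \<open>d\<close>, and \<open>x\<close> for \<open>z - \<zeta>\<close>. The left-hand
  side is what the product rule makes of the divergence of the field \<open>a\<close> multiplied by the
  cofactors of \<open>q\<close> and the exponential of the phase. Cofactors of a Jacobian are free of
  divergence: the second derivatives are symmetric and cancel in pairs of permutations of
  opposite sign. The derivative of the exponential collapses to a determinant by
  \<open>det_row_replaced\<close>.\<close>
lemma piola_identity:
  fixes q d :: "'n::finite \<Rightarrow> 'n \<Rightarrow> complex" and s :: "'n \<Rightarrow> 'n \<Rightarrow> 'n \<Rightarrow> complex" and a x :: "'n \<Rightarrow> complex"
  assumes s: "\<And>i k l. s i k l = s i l k"
  shows "(\<Sum>p | p permutes UNIV. of_int (sign p) * (\<Sum>i\<in>UNIV.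
       a i * (\<Sum>k\<in>UNIV - {i}. s k (p k) (p i) * (\<Prod>j\<in>UNIV - {i} - {k}. q j (p j)))
       + (d i (p i) + (\<Sum>j\<in>UNIV. q j (p i) * x j) * a i) * (\<Prod>k\<in>UNIV - {i}. q k (p k))))
    = (\<Sum>i\<in>UNIV. a i * x i) * det (\<chi> i l. q i l)
      + (\<Sum>p | p permutes UNIV. of_int (sign p) * (\<Sum>i\<in>UNIV. d i (p i) * (\<Prod>k\<in>UNIV - {i}. q k (p k))))"
proof -
  let ?P = "{p. p permutes (UNIV::'n set)}"
  have 3: "(\<Sum>p\<in>?P. of_int (sign p) * (\<Sum>i\<in>UNIV. a i * (\<Sum>k\<in>UNIV - {i}. s k (p k) (p i) * (\<Prod>j\<in>UNIV - {i} - {k}. q j (p j))))) = 0"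
  proof -
    have z: "(\<Sum>p\<in>?P. of_int (sign p) * (s k (p k) (p i) * (\<Prod>j\<in>UNIV - {i} - {k}. q j (p j)))) = 0" if "i \<noteq> k" for i k
    proof (rule sum_permutations_transpose_zero[OF that])
      fix p :: "'n \<Rightarrow> 'n"
      have "(\<Prod>j\<in>UNIV - {i} - {k}. q j ((p \<circ> Transposition.transpose i k) j)) = (\<Prod>j\<in>UNIV - {i} - {k}. q j (p j))"
        by (rule prod.cong) (auto simp: transpose_def)
      then show "s k ((p \<circ> Transposition.transpose i k) k) ((p \<circ> Transposition.transpose i k) i) *
          (\<Prod>j\<in>UNIV - {i} - {k}. q j ((p \<circ> Transposition.transpose i k) j)) =
          s k (p k) (p i) * (\<Prod>j\<in>UNIV - {i} - {k}. q j (p j))"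
        by (simp add: s[of k "p i" "p k"])
    qed
    have "(\<Sum>p\<in>?P. of_int (sign p) * (\<Sum>i\<in>UNIV. a i * (\<Sum>k\<in>UNIV - {i}. s k (p k) (p i) * (\<Prod>j\<in>UNIV - {i} - {k}. q j (p j)))))
      = (\<Sum>p\<in>?P. \<Sum>i\<in>UNIV. \<Sum>k\<in>UNIV - {i}. a i * (of_int (sign p) * (s k (p k) (p i) * (\<Prod>j\<in>UNIV - {i} - {k}. q j (p j)))))"
      by (simp add: sum_distrib_left mult_ac)
    also have "\<dots> = (\<Sum>i\<in>UNIV. \<Sum>k\<in>UNIV - {i}. \<Sum>p\<in>?P. a i * (of_int (sign p) * (s k (p k) (p i) * (\<Prod>j\<in>UNIV - {i} - {k}. q j (p j)))))"
      by (subst sum.swap) (intro sum.cong refl sum.swap)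
    also have "\<dots> = 0"
      unfolding sum_distrib_left[symmetric] by (intro sum.neutral ballI) (use z in auto)
    finally show ?thesis .
  qed
  have 1: "(\<Sum>p\<in>?P. of_int (sign p) * (\<Sum>i\<in>UNIV. (\<Sum>j\<in>UNIV. q j (p i) * x j) * a i * (\<Prod>k\<in>UNIV - {i}. q k (p k))))
     = (\<Sum>i\<in>UNIV. a i * x i) * det (\<chi> i l. q i l)"
  proof -
    have "(\<Sum>p\<in>?P. of_int (sign p) * (\<Sum>i\<in>UNIV. (\<Sum>j\<in>UNIV. q j (p i) * x j) * a i * (\<Prod>k\<in>UNIV - {i}. q k (p k))))
      = (\<Sum>p\<in>?P. \<Sum>i\<in>UNIV. \<Sum>j\<in>UNIV. (a i * x j) * (of_int (sign p) * (q j (p i) * (\<Prod>k\<in>UNIV - {i}. q k (p k)))))"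
      by (simp add: sum_distrib_left sum_distrib_right mult_ac)
    also have "\<dots> = (\<Sum>i\<in>UNIV. \<Sum>j\<in>UNIV. \<Sum>p\<in>?P. (a i * x j) * (of_int (sign p) * (q j (p i) * (\<Prod>k\<in>UNIV - {i}. q k (p k)))))"
      by (subst sum.swap) (intro sum.cong refl sum.swap)
    also have "\<dots> = (\<Sum>i\<in>UNIV. \<Sum>j\<in>UNIV. (a i * x j) * (if i = j then det (\<chi> i l. q i l) else 0))"
      unfolding sum_distrib_left[symmetric] det_row_replaced ..
    also have "\<dots> = (\<Sum>i\<in>UNIV. a i * x i * det (\<chi> i l. q i l))"
      by (intro sum.cong refl) (simp add: if_distrib cong: if_cong)
    finally show ?thesis by (simp add: sum_distrib_right)
  qed
  have "(\<Sum>p\<in>?P. of_int (sign p) * (\<Sum>i\<in>UNIV.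
       a i * (\<Sum>k\<in>UNIV - {i}. s k (p k) (p i) * (\<Prod>j\<in>UNIV - {i} - {k}. q j (p j)))
       + (d i (p i) + (\<Sum>j\<in>UNIV. q j (p i) * x j) * a i) * (\<Prod>k\<in>UNIV - {i}. q k (p k))))
    = (\<Sum>p\<in>?P. of_int (sign p) * (\<Sum>i\<in>UNIV. a i * (\<Sum>k\<in>UNIV - {i}. s k (p k) (p i) * (\<Prod>j\<in>UNIV - {i} - {k}. q j (p j)))))
      + (\<Sum>p\<in>?P. of_int (sign p) * (\<Sum>i\<in>UNIV. (\<Sum>j\<in>UNIV. q j (p i) * x j) * a i * (\<Prod>k\<in>UNIV - {i}. q k (p k))))
      + (\<Sum>p\<in>?P. of_int (sign p) * (\<Sum>i\<in>UNIV. d i (p i) * (\<Prod>k\<in>UNIV - {i}. q k (p k))))"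
    by (simp add: sum.distrib distrib_left distrib_right add_ac)
  then show ?thesis unfolding 3 1 by simp
qed

lemma poly_gaussian_integrable_at:
  fixes z :: "'a::euclidean_space"
  assumes "0 < c"
  shows "integrable lborel (\<lambda>x. (1 + norm (x - z)) ^ k * exp (- c * (norm (x - z))\<^sup>2))"
proof -
  have "integrable lborel (\<lambda>x. (1 + norm (- z + x)) ^ k * exp (- c * (norm (- z + x))\<^sup>2))"
    by (rule iffD2[OF lborel_integral_translate(1) poly_gaussian_integrable[OF assms]])
  then show ?thesis by simp
qed

text \<open>The functions \<open>F i\<close> are the coefficients of a phase with pole \<open>z\<close>, and \<open>dF\<close>, \<open>ddF\<close> are their first and
  second conjugate derivatives. All of them grow at most linearly, and multiplied with the
  exponential of the phase \<open>g\<close> decays like a Gaussian. One bound \<open>B\<close> serves for everything, so that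
  the conditions are stable under convex combinations of phases.\<close>
definition phase :: "(complex ^ 'n::finite \<Rightarrow> complex) \<Rightarrow> complex ^ 'n \<Rightarrow> real \<Rightarrow> real \<Rightarrow>
   ('n \<Rightarrow> complex ^ 'n \<Rightarrow> complex) \<Rightarrow> ('n \<Rightarrow> 'n \<Rightarrow> complex ^ 'n \<Rightarrow> complex) \<Rightarrow>
   ('n \<Rightarrow> 'n \<Rightarrow> 'n \<Rightarrow> complex ^ 'n \<Rightarrow> complex) \<Rightarrow> bool" where
  "phase g z B c F dF ddF \<longleftrightarrow>
     (\<forall>i l. has_dbar l (F i) (dF i l)) \<and> (\<forall>i l k. has_dbar k (dF i l) (ddF i l k)) \<and>
     (\<forall>i l k. ddF i l k = ddF i k l) \<and>
     (\<forall>i x. cmod (F i x) \<le> B * (1 + norm (x - z))) \<and>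
     (\<forall>i l x. cmod (dF i l x) \<le> B * (1 + norm (x - z))) \<and>
     (\<forall>i l k x. cmod (ddF i l k x) \<le> B * (1 + norm (x - z))) \<and>
     (\<forall>x. cmod (g x) * exp (Re (\<Sum>i\<in>UNIV. F i x * (z $ i - x $ i))) \<le> B * exp (- c * (norm (x - z))\<^sup>2))"

text \<open>The density of a weighted Cauchy-Fantappie integral: up to a constant, the determinant is the
  coefficient of the exterior product of the \<open>\<partial>\<close>-bar derivatives of the \<open>F i\<close> and of the coordinate
  forms.\<close>
definition phase_integrand :: "(complex ^ 'n::finite \<Rightarrow> complex) \<Rightarrow> complex ^ 'n \<Rightarrow>
   ('n \<Rightarrow> complex ^ 'n \<Rightarrow> complex) \<Rightarrow> ('n \<Rightarrow> 'n \<Rightarrow> complex ^ 'n \<Rightarrow> complex) \<Rightarrow> complex ^ 'n \<Rightarrow> complex" where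
  "phase_integrand g z F dF x =
     g x * exp (\<Sum>i\<in>UNIV. F i x * (z $ i - x $ i)) * det (\<chi> i l. dF i l x)"

lemma prod_norm_le_power:
  fixes f :: "'n::finite \<Rightarrow> complex"
  assumes "\<And>i. cmod (f i) \<le> v" "1 \<le> v"
  shows "cmod (\<Prod>i\<in>A. f i) \<le> v ^ CARD('n)"
proof -
  have "cmod (\<Prod>i\<in>A. f i) \<le> (\<Prod>i\<in>A. v)"
    unfolding prod_norm[symmetric] by (rule prod_mono) (use assms in auto)
  also have "\<dots> = v ^ card A" by simp
  also have "\<dots> \<le> v ^ CARD('n)" using assms(2) by (intro power_increasing card_mono) auto
  finally show ?thesis .
qed

text \<open>The exponent is affine in the phase, so its real part on the segment is at most the larger of
  the two end values.\<close>
lemma phase_convex: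
  assumes F0: "phase g z B c F0 dF0 ddF0" and F1: "phase g z B c F1 dF1 ddF1" and t: "0 \<le> t" "t \<le> 1"
  shows "phase g z B c (\<lambda>i x. F0 i x + of_real t * (F1 i x - F0 i x))
    (\<lambda>i l x. dF0 i l x + of_real t * (dF1 i l x - dF0 i l x))
    (\<lambda>i l k x. ddF0 i l k x + of_real t * (ddF1 i l k x - ddF0 i l k x))"
proof -
  have n: "cmod (a + of_real t * (b - a)) \<le> C" if "cmod a \<le> C" "cmod b \<le> C" for a b C
  proof -
    have "a + of_real t * (b - a) = (1 - t) *\<^sub>R a + t *\<^sub>R b" by (simp add: scaleR_conv_of_real algebra_simps)
    also have "cmod \<dots> \<le> (1 - t) * cmod a + t * cmod b"
      using t by (intro norm_triangle_le) simp
    also have "\<dots> \<le> (1 - t) * C + t * C" using t that by (intro add_mono mult_left_mono) auto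
    finally show ?thesis by (simp add: algebra_simps)
  qed
  have e: "cmod (g x) * exp (Re (\<Sum>i\<in>UNIV. (F0 i x + of_real t * (F1 i x - F0 i x)) * (z $ i - x $ i)))
     \<le> B * exp (- c * (norm (x - z))\<^sup>2)" for x
  proof -
    let ?a = "Re (\<Sum>i\<in>UNIV. F0 i x * (z $ i - x $ i))" and ?b = "Re (\<Sum>i\<in>UNIV. F1 i x * (z $ i - x $ i))"
    have "(\<Sum>i\<in>UNIV. (F0 i x + of_real t * (F1 i x - F0 i x)) * (z $ i - x $ i)) =
      (1 - of_real t) * (\<Sum>i\<in>UNIV. F0 i x * (z $ i - x $ i)) + of_real t * (\<Sum>i\<in>UNIV. F1 i x * (z $ i - x $ i))"
      by (simp add: sum_distrib_left sum.distrib[symmetric] algebra_simps)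
    then have "Re (\<Sum>i\<in>UNIV. (F0 i x + of_real t * (F1 i x - F0 i x)) * (z $ i - x $ i)) = (1 - t) * ?a + t * ?b"
      by simp
    also have "\<dots> \<le> (1 - t) * max ?a ?b + t * max ?a ?b"
      using t by (intro add_mono mult_left_mono) auto
    also have "\<dots> = max ?a ?b" by (simp add: algebra_simps)
    finally have "cmod (g x) * exp (Re (\<Sum>i\<in>UNIV. (F0 i x + of_real t * (F1 i x - F0 i x)) * (z $ i - x $ i))) \<le> cmod (g x) * exp (max ?a ?b)"
      by (intro mult_left_mono) auto
    also have "\<dots> \<le> B * exp (- c * (norm (x - z))\<^sup>2)"
      using F0 F1 unfolding phase_def by (cases "?a \<le> ?b") (auto simp: max_def)
    finally show ?thesis .
  qed
  show ?thesis using F0 F1 n e unfolding phase_def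
    by (intro conjI allI) (auto intro!: has_dbar_add has_dbar_diff has_dbar_cmult)
qed

text \<open>The derivative of \<open>phase_integrand\<close> when \<open>F\<close> moves in the direction \<open>D\<close>.\<close>
definition phase_div where
  "phase_div g z F dF D dD x = g x * exp (\<Sum>i\<in>UNIV. F i x * (z $ i - x $ i)) *
    ((\<Sum>i\<in>UNIV. D i x * (z $ i - x $ i)) * det (\<chi> i l. dF i l x)
      + (\<Sum>p | p permutes UNIV. of_int (sign p) * (\<Sum>i\<in>UNIV. dD i (p i) x * (\<Prod>k\<in>UNIV - {i}. dF k (p k) x))))"

text \<open>By \<open>piola_identity\<close> the integrand is the signed sum over permutations \<open>p\<close> and indices \<open>i\<close> of the
  \<open>p i\<close>-th conjugate derivative of a product \<open>X p i\<close> that decays like a Gaussian times a polynomial,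
  and each such derivative has integral zero.\<close>
lemma phase_div_integral:
  fixes z :: "complex ^ 'n::finite"
  assumes F: "phase g z B c F dF ddF" and g: "entire g" and B: "1 \<le> B" and c: "0 < c"
    and D: "\<And>i l. has_dbar l (D i) (dD i l)"
    and D1: "\<And>i x. cmod (D i x) \<le> 2 * B * (1 + norm (x - z))"
    and D2: "\<And>i l x. cmod (dD i l x) \<le> 2 * B * (1 + norm (x - z))"
  shows "(LINT x|lborel. phase_div g z F dF D dD x) = 0"
proof -
  define E where "E = (\<lambda>x. g x * exp (\<Sum>i\<in>UNIV. F i x * (z $ i - x $ i)))"
  define S where "S = (\<lambda>k x. \<Sum>j\<in>UNIV. dF j k x * (z $ j - x $ j))"
  define X where "X = (\<lambda>p i x. E x * D i x * (\<Prod>k\<in>UNIV - {i}. dF k (p k) x))"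
  define Y where "Y = (\<lambda>p i x. E x * D i x * (\<Sum>k\<in>UNIV - {i}. ddF k (p k) (p i) x * (\<Prod>j\<in>UNIV - {i} - {k}. dF j (p j) x))
       + (E x * dD i (p i) x + E x * S (p i) x * D i x) * (\<Prod>k\<in>UNIV - {i}. dF k (p k) x))"
  from F have dF: "\<And>i l. has_dbar l (F i) (dF i l)" and ddF: "\<And>i l k. has_dbar k (dF i l) (ddF i l k)"
    and sym: "\<And>i l k. ddF i l k = ddF i k l"
    and bdF: "\<And>i l x. cmod (dF i l x) \<le> B * (1 + norm (x - z))"
    and bddF: "\<And>i l k x. cmod (ddF i l k x) \<le> B * (1 + norm (x - z))"
    and bE: "\<And>x. cmod (g x) * exp (Re (\<Sum>i\<in>UNIV. F i x * (z $ i - x $ i))) \<le> B * exp (- c * (norm (x - z))\<^sup>2)"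
    unfolding phase_def by auto
  have bE: "cmod (E x) \<le> B * exp (- c * (norm (x - z))\<^sup>2)" for x
    using bE[of x] by (simp add: E_def norm_mult)
  have dE: "has_dbar k E (\<lambda>x. E x * S k x)" for k
  proof -
    have "has_dbar k (\<lambda>x. \<Sum>i\<in>UNIV. F i x * (z $ i - x $ i)) (\<lambda>x. \<Sum>i\<in>UNIV. F i x * (0 - 0) + dF i k x * (z $ i - x $ i))"
      by (intro has_dbar_sum has_dbar_mult has_dbar_diff dF has_dbar_const has_dbar_coordinate)
    from has_dbar_mult[OF has_dbar_entire[OF g] has_dbar_exp[OF this]]
    show ?thesis unfolding E_def S_def by (simp add: mult_ac)
  qed
  have dX: "has_dbar (p i) (X p i) (Y p i)" for p i
  proof -
    have "has_dbar (p i) (\<lambda>x. \<Prod>k\<in>UNIV - {i}. dF k (p k) x) (\<lambda>x. \<Sum>k\<in>UNIV - {i}. ddF k (p k) (p i) x * (\<Prod>j\<in>UNIV - {i} - {k}. dF j (p j) x))"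
      by (intro has_dbar_prod ddF) auto
    from has_dbar_mult[OF has_dbar_mult[OF dE D] this] show ?thesis
      unfolding X_def Y_def .
  qed
  \<comment> \<open>All factors of \<open>X p i\<close> and \<open>Y p i\<close> except the exponential are bounded by \<open>v\<close>, and \<open>1 \<le> v\<close>, so powers
    of \<open>v\<close> can be compared.\<close>
  define v where "v = (\<lambda>x. 2 * B * (1 + norm (x - z)))"
  have v1: "1 \<le> v x" for x
  proof -
    have "1 * 1 \<le> (2 * B) * (1 + norm (x - z))" using B by (intro mult_mono) auto
    then show ?thesis by (simp add: v_def)
  qed
  have half: "B * (1 + norm (x - z)) \<le> v x" for x using B by (simp add: v_def)
  have vF: "cmod (dF i l x) \<le> v x" "cmod (ddF i l k x) \<le> v x" "cmod (D i x) \<le> v x" "cmod (dD i l x) \<le> v x" for i l k x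
    using bdF[of i l x] bddF[of i l k x] half[of x] D1[of i x] D2[of i l x] by (auto simp: v_def)
  have vz: "cmod (z $ i - x $ i) \<le> v x" for i x
  proof -
    have "cmod ((z - x) $ i) \<le> norm (z - x)" by (rule Finite_Cartesian_Product.norm_nth_le)
    also have "\<dots> \<le> 1 * (1 + norm (x - z))" by (simp add: norm_minus_commute)
    also have "\<dots> \<le> v x" using B unfolding v_def by (intro mult_right_mono) auto
    finally show ?thesis by simp
  qed
  let ?n = "CARD('n)"
  define b where "b = (\<lambda>x. (2 * real ?n + 1) * B * ((2 * B) ^ (?n + 3) * ((1 + norm (x - z)) ^ (?n + 3) * exp (- c * (norm (x - z))\<^sup>2))))"
  have b: "b x = (2 * real ?n + 1) * (B * exp (- c * (norm (x - z))\<^sup>2)) * v x ^ (?n + 3)" for x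
    by (simp only: b_def v_def power_mult_distrib mult_ac)
  have ib: "integrable lborel b"
    unfolding b_def by (intro integrable_mult_right poly_gaussian_integrable_at c)
  have nprod: "cmod (\<Prod>j\<in>A. dF j (p j) x) \<le> v x ^ ?n" for A p x
    by (rule prod_norm_le_power) (use vF v1 in auto)
  have mult3: "cmod (a * b) \<le> r * s" if "cmod a \<le> r" "cmod b \<le> s" for a b r s
    unfolding norm_mult by (intro mult_mono that order_trans[OF norm_ge_zero that(1)] norm_ge_zero)
  have nX: "cmod (X p i x) \<le> b x" for p i x
  proof -
    have "cmod (X p i x) \<le> B * exp (- c * (norm (x - z))\<^sup>2) * v x * v x ^ ?n"
      unfolding X_def by (intro mult3 bE vF nprod)
    also have "\<dots> = 1 * (B * exp (- c * (norm (x - z))\<^sup>2)) * v x ^ (?n + 1)" by simp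
    also have "\<dots> \<le> b x" unfolding b
      using B v1[of x] by (intro mult_mono power_increasing) auto
    finally show ?thesis .
  qed
  have nY: "cmod (Y p i x) \<le> b x" for p i x
  proof -
    let ?e = "B * exp (- c * (norm (x - z))\<^sup>2)"
    have e0: "0 \<le> ?e" using B by simp
    have v0: "0 \<le> v x" using v1[of x] by simp
    have 1: "cmod (\<Sum>k\<in>UNIV - {i}. ddF k (p k) (p i) x * (\<Prod>j\<in>UNIV - {i} - {k}. dF j (p j) x)) \<le> real ?n * (v x * v x ^ ?n)"
    proof -
      have "cmod (\<Sum>k\<in>UNIV - {i}. ddF k (p k) (p i) x * (\<Prod>j\<in>UNIV - {i} - {k}. dF j (p j) x)) \<le> real (card (UNIV - {i})) * (v x * v x ^ ?n)"
        by (rule sum_norm_bound) (intro mult3 vF nprod)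
      also have "\<dots> \<le> real ?n * (v x * v x ^ ?n)"
        using v0 by (intro mult_right_mono) (auto intro!: card_mono)
      finally show ?thesis .
    qed
    have 2: "cmod (S (p i) x) \<le> real ?n * (v x * v x)"
      unfolding S_def by (rule sum_norm_bound) (intro mult3 vF vz)
    have "cmod (Y p i x) \<le> ?e * v x * (real ?n * (v x * v x ^ ?n)) + (?e * v x + ?e * (real ?n * (v x * v x)) * v x) * v x ^ ?n"
      unfolding Y_def by (intro norm_triangle_le add_mono mult3 bE vF 1 2 nprod order_trans[OF norm_triangle_ineq])
    also have "\<dots> = ?e * (real ?n * v x ^ (?n + 2) + v x ^ (?n + 1) + real ?n * v x ^ (?n + 3))"
      by (simp add: power_add algebra_simps power2_eq_square power3_eq_cube)
    also have "\<dots> \<le> ?e * (real ?n * v x ^ (?n + 3) + v x ^ (?n + 3) + real ?n * v x ^ (?n + 3))"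
      using v1[of x] e0 by (intro mult_left_mono add_mono power_increasing) auto
    also have "\<dots> = b x" unfolding b by (simp add: algebra_simps)
    finally show ?thesis .
  qed
  have i: "integrable lborel (X p i)" "integrable lborel (Y p i)" for p i
    by (rule Bochner_Integration.integrable_bound[OF ib];
        use order_trans[OF nX abs_ge_self] order_trans[OF nY abs_ge_self] has_dbar_continuous[OF dX[of p i]]
        in \<open>simp add: borel_measurable_continuous_onI\<close>)+
  have "phase_div g z F dF D dD x = (\<Sum>p | p permutes UNIV. of_int (sign p) * (\<Sum>i\<in>UNIV. Y p i x))" for x
  proof -
    have "phase_div g z F dF D dD x = E x * (\<Sum>p | p permutes UNIV. of_int (sign p) * (\<Sum>i\<in>UNIV.
       D i x * (\<Sum>k\<in>UNIV - {i}. ddF k (p k) (p i) x * (\<Prod>j\<in>UNIV - {i} - {k}. dF j (p j) x))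
       + (dD i (p i) x + (\<Sum>j\<in>UNIV. dF j (p i) x * (z $ j - x $ j)) * D i x) * (\<Prod>k\<in>UNIV - {i}. dF k (p k) x)))"
      unfolding phase_div_def E_def
      by (subst piola_identity) (auto simp: sym[of _ _ "_"] intro: fun_cong[OF sym])
    also have "\<dots> = (\<Sum>p | p permutes UNIV. of_int (sign p) * (\<Sum>i\<in>UNIV. Y p i x))"
    proof -
      have Y': "Y p i x = E x * (D i x * (\<Sum>k\<in>UNIV - {i}. ddF k (p k) (p i) x * (\<Prod>j\<in>UNIV - {i} - {k}. dF j (p j) x))
       + (dD i (p i) x + S (p i) x * D i x) * (\<Prod>k\<in>UNIV - {i}. dF k (p k) x))" for p i
        by (simp only: Y_def distrib_left distrib_right mult.assoc)
      show ?thesis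
        unfolding Y' S_def sum_distrib_left[symmetric] mult.left_commute[of "of_int _" "E x"] ..
    qed
    finally show ?thesis .
  qed
  then have "(LINT x|lborel. phase_div g z F dF D dD x) = (\<Sum>p | p permutes UNIV. of_int (sign p) * (\<Sum>i\<in>UNIV. LINT x|lborel. Y p i x))"
    using i by simp
  also have "\<dots> = 0" using has_dbar_integral_zero[OF dX i] by simp
  finally show ?thesis .
qed

lemma continuous_on_det [continuous_intros]:
  fixes A :: "'n::finite \<Rightarrow> 'n \<Rightarrow> 'a::topological_space \<Rightarrow> complex"
  assumes "\<And>i l. continuous_on S (A i l)"
  shows "continuous_on S (\<lambda>x. det (\<chi> i l. A i l x))"
  unfolding det_def by (simp, intro continuous_intros assms)

lemma det_bound:
  fixes A :: "'n::finite \<Rightarrow> 'n \<Rightarrow> complex"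
  assumes "\<And>i l. cmod (A i l) \<le> v" "1 \<le> v"
  shows "cmod (det (\<chi> i l. A i l)) \<le> fact (CARD('n)) * v ^ CARD('n)"
proof -
  have "cmod (det (\<chi> i l. A i l)) \<le> (\<Sum>p | p permutes (UNIV::'n set). v ^ CARD('n))"
    unfolding det_def
    by (rule sum_norm_le) (simp add: norm_mult prod_norm_le_power assms sign_def)
  then show ?thesis by (simp add: card_permutations)
qed

lemma phase_integrand_bound:
  fixes z :: "complex ^ 'n::finite"
  assumes F: "phase g z B c F dF ddF" and B: "1 \<le> B"
  shows "cmod (phase_integrand g z F dF x) \<le>
    fact CARD('n) * B ^ Suc (CARD('n)) * ((1 + norm (x - z)) ^ CARD('n) * exp (- c * (norm (x - z))\<^sup>2))"
proof -
  have v: "1 \<le> B * (1 + norm (x - z))"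
    using B mult_mono[of 1 B 1 "1 + norm (x - z)"] by auto
  have "cmod (det (\<chi> i l. dF i l x)) \<le> fact CARD('n) * (B * (1 + norm (x - z))) ^ CARD('n)"
    by (rule det_bound[OF _ v]) (use F in \<open>auto simp: phase_def\<close>)
  moreover have "cmod (g x * exp (\<Sum>i\<in>UNIV. F i x * (z $ i - x $ i))) \<le> B * exp (- c * (norm (x - z))\<^sup>2)"
    using F by (auto simp: phase_def norm_mult)
  ultimately have "cmod (phase_integrand g z F dF x) \<le> (B * exp (- c * (norm (x - z))\<^sup>2)) * (fact CARD('n) * (B * (1 + norm (x - z))) ^ CARD('n))"
    unfolding phase_integrand_def norm_mult[of _ "det _"] using B by (intro mult_mono) auto
  then show ?thesis by (simp add: power_mult_distrib mult_ac)
qed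

lemma phase_integrand_integrable:
  fixes z :: "complex ^ 'n::finite"
  assumes F: "phase g z B c F dF ddF" and g: "entire g" and B: "1 \<le> B" and c: "0 < c"
  shows "integrable lborel (phase_integrand g z F dF)"
proof (rule Bochner_Integration.integrable_bound)
  show "integrable lborel (\<lambda>x. fact CARD('n) * B ^ Suc (CARD('n)) * ((1 + norm (x - z)) ^ CARD('n) * exp (- c * (norm (x - z))\<^sup>2)))"
    by (intro integrable_mult_right poly_gaussian_integrable_at c)
  have "has_dbar l (F i) (dF i l)" "has_dbar k (dF i l) (ddF i l k)" for i l k
    using F unfolding phase_def by blast+
  then have "continuous_on UNIV (F i)" "continuous_on UNIV (dF i l)" for i l
    by (blast intro: has_dbar_continuous(1))+
  then have "continuous_on UNIV (phase_integrand g z F dF)"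
    unfolding phase_integrand_def
    by (intro continuous_intros entire_continuous[OF g])
  then show "phase_integrand g z F dF \<in> borel_measurable lborel"
    by (simp add: borel_measurable_continuous_onI)
  show "AE x in lborel. cmod (phase_integrand g z F dF x) \<le> norm (fact CARD('n) * B ^ Suc (CARD('n)) * ((1 + norm (x - z)) ^ CARD('n) * exp (- c * (norm (x - z))\<^sup>2)))"
    using order_trans[OF phase_integrand_bound[OF F B] abs_ge_self] by (intro AE_I2) (simp only: real_norm_def)
qed

text \<open>Along the segment from \<open>F0\<close> to \<open>F1\<close> the derivative of the integrand with respect to the parameter
  is \<open>phase_div\<close>, whose integral vanishes; Fubini turns this into the equality of the end values.\<close>
theorem phase_homotopy:
  fixes z :: "complex ^ 'n::finite"
  assumes F0: "phase g z B c F0 dF0 ddF0" and F1: "phase g z B c F1 dF1 ddF1"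
    and g: "entire g" and B: "1 \<le> B" and c: "0 < c"
  shows "(LINT x|lborel. phase_integrand g z F1 dF1 x) = (LINT x|lborel. phase_integrand g z F0 dF0 x)"
proof -
  define P where "P = (\<lambda>t::real. \<lambda>i x. F0 i x + of_real t * (F1 i x - F0 i x))"
  define dP where "dP = (\<lambda>t::real. \<lambda>i l x. dF0 i l x + of_real t * (dF1 i l x - dF0 i l x))"
  define D where "D = (\<lambda>i x. F1 i x - F0 i x)"
  define dD where "dD = (\<lambda>i l x. dF1 i l x - dF0 i l x)"
  let ?W = "\<lambda>t. phase_integrand g z (P t) (dP t)"
  let ?Z = "\<lambda>t. phase_div g z (P t) (dP t) D dD"
  have ph: "phase g z B c (P t) (dP t) (\<lambda>i l k x. ddF0 i l k x + of_real t * (ddF1 i l k x - ddF0 i l k x))"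
    if "0 \<le> t" "t \<le> 1" for t
    unfolding P_def dP_def by (rule phase_convex[OF F0 F1 that])
  from F0 F1 have h0: "\<And>i l. has_dbar l (F0 i) (dF0 i l)" "\<And>i l k. has_dbar k (dF0 i l) (ddF0 i l k)"
    and h1: "\<And>i l. has_dbar l (F1 i) (dF1 i l)" "\<And>i l k. has_dbar k (dF1 i l) (ddF1 i l k)"
    and n0: "\<And>i x. cmod (F0 i x) \<le> B * (1 + norm (x - z))" "\<And>i l x. cmod (dF0 i l x) \<le> B * (1 + norm (x - z))"
    and n1: "\<And>i x. cmod (F1 i x) \<le> B * (1 + norm (x - z))" "\<And>i l x. cmod (dF1 i l x) \<le> B * (1 + norm (x - z))"
    unfolding phase_def by auto
  have bD: "cmod (D i x) \<le> 2 * B * (1 + norm (x - z))" "cmod (dD i l x) \<le> 2 * B * (1 + norm (x - z))" for i l x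
    unfolding D_def dD_def using norm_triangle_ineq4[of "F1 i x" "F0 i x"] norm_triangle_ineq4[of "dF1 i l x" "dF0 i l x"]
      n0(1)[of i x] n1(1)[of i x] n0(2)[of i l x] n1(2)[of i l x] by linarith+
  have zero: "(LINT x|lborel. ?Z t x) = 0" if "0 \<le> t" "t \<le> 1" for t
    by (rule phase_div_integral[OF ph[OF that] g B c _ bD]) (simp add: D_def dD_def has_dbar_diff h0 h1)
  have der: "((\<lambda>t. ?W t x) has_vector_derivative ?Z t x) (at t)" for t x
  proof -
    have d1: "((\<lambda>t. \<Sum>i\<in>UNIV. P t i x * (z $ i - x $ i)) has_vector_derivative (\<Sum>i\<in>UNIV. D i x * (z $ i - x $ i))) (at t)"
      unfolding P_def D_def by (auto intro!: derivative_eq_intros)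
    have d2: "((\<lambda>t. exp (\<Sum>i\<in>UNIV. P t i x * (z $ i - x $ i))) has_vector_derivative (\<Sum>i\<in>UNIV. D i x * (z $ i - x $ i)) * exp (\<Sum>i\<in>UNIV. P t i x * (z $ i - x $ i))) (at t)"
      using field_vector_diff_chain_at[OF d1 DERIV_exp] by (simp add: o_def)
    have d3: "((\<lambda>t. \<Prod>k\<in>UNIV. dP t k (p k) x) has_vector_derivative (\<Sum>i\<in>UNIV. dD i (p i) x * (\<Prod>k\<in>UNIV - {i}. dP t k (p k) x))) (at t)" for p
    proof -
      have "((\<lambda>t. dP t k (p k) x) has_derivative (\<lambda>h. of_real h * dD k (p k) x)) (at t)" for k
        unfolding dP_def dD_def by (auto intro!: derivative_eq_intros)
      then have "((\<lambda>t. \<Prod>k\<in>UNIV. dP t k (p k) x) has_derivative (\<lambda>h. \<Sum>i\<in>UNIV. of_real h * dD i (p i) x * (\<Prod>k\<in>UNIV - {i}. dP t k (p k) x))) (at t)"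
        by (rule has_derivative_prod)
      then show ?thesis unfolding has_vector_derivative_def
        by (rule has_derivative_eq_rhs) (simp add: fun_eq_iff scaleR_conv_of_real sum_distrib_left mult_ac)
    qed
    have d4: "((\<lambda>t. det (\<chi> i l. dP t i l x)) has_vector_derivative (\<Sum>p | p permutes UNIV. of_int (sign p) * (\<Sum>i\<in>UNIV. dD i (p i) x * (\<Prod>k\<in>UNIV - {i}. dP t k (p k) x)))) (at t)"
      unfolding det_def by (simp, intro has_vector_derivative_sum has_vector_derivative_mult_right d3)
    show ?thesis
      unfolding phase_integrand_def phase_div_def
      using has_vector_derivative_mult[OF has_vector_derivative_mult_right[OF d2, of "g x"] d4]
      by (simp add: algebra_simps)
  qed
  let ?h = "\<lambda>(t, x). indicator {0..1::real} t *\<^sub>R ?Z t x"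
  have cF: "continuous_on UNIV (F0 i)" "continuous_on UNIV (F1 i)" "continuous_on UNIV (dF0 i l)" "continuous_on UNIV (dF1 i l)" for i l
    using has_dbar_continuous[OF h0(1)] has_dbar_continuous[OF h1(1)] by auto
  have cZ: "continuous_on UNIV (\<lambda>p. ?Z (fst p) (snd p))"
    unfolding phase_div_def P_def dP_def D_def dD_def
    by (intro continuous_intros continuous_on_compose2[OF entire_continuous[OF g]]
        continuous_on_compose2[OF cF(1)] continuous_on_compose2[OF cF(2)]
        continuous_on_compose2[OF cF(3)] continuous_on_compose2[OF cF(4)]) auto
  let ?n = "CARD('n)"
  define K where "K = 3 * fact ?n * real ?n * B * (2 * B) ^ (?n + 2)"
  define b where "b = (\<lambda>x::complex^'n. K * ((1 + norm (x - z)) ^ (?n + 2) * exp (- c * (norm (x - z))\<^sup>2)))"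
  have ib: "integrable lborel b"
    unfolding b_def
    by (intro integrable_mult_right poly_gaussian_integrable_at c)
  have bZ: "cmod (?Z t x) \<le> b x" if t: "0 \<le> t" "t \<le> 1" for t x
  proof -
    define v where "v = 2 * B * (1 + norm (x - z))"
    have v1: "1 \<le> v" using B mult_mono[of 1 "2 * B" 1 "1 + norm (x - z)"] by (auto simp: v_def)
    have bP: "cmod (dP t i l x) \<le> v" for i l
      using ph[OF t] B unfolding phase_def v_def
      by (auto intro!: order_trans[OF _ mult_right_mono[of B "2 * B"]])
    have vz: "cmod (z $ i - x $ i) \<le> v" for i
    proof -
      have "cmod ((z - x) $ i) \<le> norm (z - x)" by (rule Finite_Cartesian_Product.norm_nth_le)
      also have "\<dots> \<le> 1 * (1 + norm (x - z))" by (simp add: norm_minus_commute)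
      also have "\<dots> \<le> v" using B unfolding v_def by (intro mult_right_mono) auto
      finally show ?thesis by simp
    qed
    have mult3: "cmod (a * b) \<le> r * s" if "cmod a \<le> r" "cmod b \<le> s" for a b r s
      unfolding norm_mult by (intro mult_mono that order_trans[OF norm_ge_zero that(1)] norm_ge_zero)
    have 1: "cmod (\<Sum>i\<in>UNIV. D i x * (z $ i - x $ i)) \<le> real ?n * (v * v)"
      by (rule sum_norm_bound) (intro mult3 vz bD(1)[of _ x, folded v_def])
    have 2: "cmod (det (\<chi> i l. dP t i l x)) \<le> fact ?n * v ^ ?n"
      by (rule det_bound[OF bP v1])
    have 3: "cmod (\<Sum>p | p permutes (UNIV::'n set). of_int (sign p) * (\<Sum>i\<in>UNIV. dD i (p i) x * (\<Prod>k\<in>UNIV - {i}. dP t k (p k) x))) \<le> fact ?n * (real ?n * (v * v ^ ?n))"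
    proof -
      have "cmod (\<Sum>p | p permutes (UNIV::'n set). of_int (sign p) * (\<Sum>i\<in>UNIV. dD i (p i) x * (\<Prod>k\<in>UNIV - {i}. dP t k (p k) x)))
         \<le> (\<Sum>p | p permutes (UNIV::'n set). real ?n * (v * v ^ ?n))"
      proof (rule sum_norm_le)
        fix p
        have "cmod (\<Sum>i\<in>UNIV. dD i (p i) x * (\<Prod>k\<in>UNIV - {i}. dP t k (p k) x)) \<le> real ?n * (v * v ^ ?n)"
          by (rule sum_norm_bound) (intro mult3 bD(2)[of _ _ x, folded v_def] prod_norm_le_power bP v1)
        then show "cmod (of_int (sign p) * (\<Sum>i\<in>UNIV. dD i (p i) x * (\<Prod>k\<in>UNIV - {i}. dP t k (p k) x))) \<le> real ?n * (v * v ^ ?n)"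
          by (simp add: norm_mult sign_def)
      qed
      then show ?thesis by (simp add: card_permutations)
    qed
    let ?e = "B * exp (- c * (norm (x - z))\<^sup>2)"
    have e: "cmod (g x * exp (\<Sum>i\<in>UNIV. P t i x * (z $ i - x $ i))) \<le> ?e"
      using ph[OF t] by (auto simp: phase_def norm_mult)
    have "cmod (?Z t x) \<le> ?e * (real ?n * (v * v) * (fact ?n * v ^ ?n) + fact ?n * (real ?n * (v * v ^ ?n)))"
      unfolding phase_div_def
      by (intro mult3 e order_trans[OF norm_triangle_ineq] add_mono 1 2 3)
    also have "\<dots> = ?e * (fact ?n * real ?n) * (v ^ (?n + 2) + v ^ (?n + 1))"
      by (simp add: algebra_simps power2_eq_square)
    also have "\<dots> \<le> ?e * (fact ?n * real ?n) * (v ^ (?n + 2) + v ^ (?n + 2))"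
      using v1 B by (intro mult_left_mono add_mono power_increasing) auto
    also have "\<dots> \<le> ?e * (fact ?n * real ?n) * (3 * v ^ (?n + 2))"
      using v1 B by (intro mult_left_mono) auto
    also have "\<dots> = b x"
      by (simp only: b_def K_def v_def power_mult_distrib mult_ac)
    finally show ?thesis .
  qed
  have mZ: "(\<lambda>p. ?Z (fst p) (snd p)) \<in> borel_measurable (borel \<Otimes>\<^sub>M borel)"
    unfolding borel_prod by (rule borel_measurable_continuous_onI[OF cZ])
  have cZx: "continuous_on S (\<lambda>t. ?Z t x)" "continuous_on UNIV (?Z t)" for x t S
  proof -
    have "continuous_on S (\<lambda>t. (t, x))" "continuous_on UNIV (\<lambda>x::complex^'n. (t, x))"
      by (intro continuous_intros)+
    then show "continuous_on S (\<lambda>t. ?Z t x)" "continuous_on UNIV (?Z t)"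
      using continuous_on_compose2[OF cZ, of S "\<lambda>t. (t, x)"] continuous_on_compose2[OF cZ, of UNIV "\<lambda>x. (t, x)"]
      by simp_all
  qed
  have iZ: "integrable lborel (?Z t)" if "0 \<le> t" "t \<le> 1" for t
    by (rule Bochner_Integration.integrable_bound[OF ib])
       (use order_trans[OF bZ[OF that] abs_ge_self] borel_measurable_continuous_onI[OF cZx(2)] in simp_all)
  have hm: "?h \<in> borel_measurable (lborel \<Otimes>\<^sub>M lborel)"
    unfolding case_prod_beta using mZ by measurable
  have hint: "integrable (lborel \<Otimes>\<^sub>M lborel) ?h"
  proof (rule lborel_pair.Fubini_integrable[OF hm])
    have m: "(\<lambda>t. LINT x|lborel. norm (?h (t, x))) \<in> borel_measurable lborel"
      using hm by measurable
    show "integrable lborel (\<lambda>t. LINT x|lborel. norm (?h (t, x)))"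
    proof (rule Bochner_Integration.integrable_bound[OF _ m])
      show "integrable lborel (\<lambda>t. indicator {0..1::real} t *\<^sub>R (LINT x|lborel. b x))"
        by (simp add: integrable_mult_indicator)
      have "(LINT x|lborel. norm (?Z t x)) \<le> (LINT x|lborel. b x)" if "0 \<le> t" "t \<le> 1" for t
        by (rule integral_mono) (use iZ[OF that] ib bZ[OF that] in auto)
      then have *: "norm (LINT x|lborel. norm (?h (t, x))) \<le> indicator {0..1} t * (LINT x|lborel. b x)" for t
        by (cases "t \<in> {0..1}") auto
      show "AE t in lborel. norm (LINT x|lborel. norm (?h (t, x))) \<le> norm (indicator {0..1} t *\<^sub>R (LINT x|lborel. b x))"
        using * by (intro AE_I2) (auto intro: order_trans[OF _ abs_ge_self])
    qed
    show "AE t in lborel. integrable lborel (\<lambda>x. ?h (t, x))"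
      using iZ by (auto simp: indicator_def)
  qed
  have m0: "(LINT t|lborel. ?h (t, x)) = ?W 1 x - ?W 0 x" for x
  proof -
    have hi: "((\<lambda>t. ?Z t x) has_integral ?W 1 x - ?W 0 x) {0..1}"
      by (rule fundamental_theorem_of_calculus[OF _ has_vector_derivative_at_within[OF der]]) simp
    have "set_integrable lborel {0..1} (\<lambda>t. ?Z t x)"
      by (rule borel_integrable_atLeastAtMost'[OF cZx(1)])
    from set_borel_integral_eq_integral(2)[OF this] integral_unique[OF hi]
    show ?thesis unfolding set_lebesgue_integral_def prod.case by (rule trans)
  qed
  have "(LINT x|lborel. ?W 1 x - ?W 0 x) = (LINT x|lborel. LINT t|lborel. ?h (t, x))"
    unfolding m0 ..
  also have "\<dots> = (LINT t|lborel. LINT x|lborel. ?h (t, x))"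
    using lborel_pair.Fubini_integral[OF hint] by simp
  also have "\<dots> = (LINT t|(lborel::real measure). 0)"
  proof (rule Bochner_Integration.integral_cong)
    fix t :: real
    show "(LINT x|lborel. ?h (t, x)) = 0" using zero[of t] by (cases "t \<in> {0..1}") auto
  qed simp
  also have "\<dots> = 0" by simp
  finally have "(LINT x|lborel. ?W 1 x - ?W 0 x) = 0" .
  moreover have "?W 1 = phase_integrand g z F1 dF1" "?W 0 = phase_integrand g z F0 dF0"
    by (simp_all add: P_def dP_def)
  ultimately show ?thesis
    using phase_integrand_integrable[OF F0 g B c] phase_integrand_integrable[OF F1 g B c]
    by (simp add: Bochner_Integration.integral_diff)
qed

section \<open>A reproducing kernel with Gaussian decay\<close>

definition conv :: "('a::euclidean_space \<Rightarrow> real) \<Rightarrow> ('a \<Rightarrow> complex) \<Rightarrow> 'a \<Rightarrow> complex" where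
  "conv k L x = (LINT u|lborel. of_real (k (x - u)) * L u)"

lemma integral_cbox_of_support:
  fixes X :: "'a::euclidean_space \<Rightarrow> complex"
  assumes "continuous_on UNIV X" "\<And>x. x \<notin> cbox a b \<Longrightarrow> X x = 0"
  shows "(LINT x|lborel. X x) = integral (cbox a b) X"
proof -
  have "set_integrable lborel (cbox a b) X"
    unfolding set_integrable_def
    by (rule borel_integrable_compact) (auto intro: continuous_on_subset[OF assms(1)])
  from set_borel_integral_eq_integral(2)[OF this]
  have "(LINT x|lborel. indicator (cbox a b) x *\<^sub>R X x) = integral (cbox a b) X"
    by (simp add: set_lebesgue_integral_def)
  moreover have "indicator (cbox a b) x *\<^sub>R X x = X x" for x
    using assms(2)[of x] by (auto simp: indicator_def)
  ultimately show ?thesis by simp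
qed

lemma conv_reflect:
  "conv k L x = (LINT y|lborel. of_real (k y) * L (x - y))"
  unfolding conv_def
  using lborel_integral_reflect(2)[of "\<lambda>u. of_real (k (x - u)) * L u" x] by simp

lemma continuous_conv:
  fixes k :: "'a::euclidean_space \<Rightarrow> real"
  assumes k: "continuous_on UNIV k" and s: "\<And>x. 1 \<le> norm x \<Longrightarrow> k x = 0" and L: "continuous_on UNIV L"
  shows "continuous_on UNIV (conv k L)"
proof -
  obtain a where a: "cball (0::'a) 1 \<subseteq> cbox (- a) a"
    using bounded_subset_cbox_symmetric[OF bounded_cball] by blast
  have "conv k L x = integral (cbox (-a) a) (\<lambda>y. of_real (k y) * L (x - y))" for x
    unfolding conv_reflect
  proof (rule integral_cbox_of_support)
    show "continuous_on UNIV (\<lambda>y. of_real (k y) * L (x - y))"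
      by (intro continuous_intros k continuous_on_compose2[OF L]) auto
    fix y assume "y \<notin> cbox (- a) a"
    then have "1 \<le> norm y" using a by (force simp: subset_iff)
    then show "of_real (k y) * L (x - y) = 0" by (simp add: s)
  qed
  moreover have "continuous_on UNIV (\<lambda>x. integral (cbox (-a) a) (\<lambda>y. of_real (k y) * L (x - y)))"
    by (rule integral_continuous_on_param)
       (auto simp: case_prod_beta intro!: continuous_intros continuous_on_compose2[OF k] continuous_on_compose2[OF L])
  ultimately show ?thesis by simp
qed

text \<open>The derivative falls on the kernel. So convolution with \<open>bump\<close> makes a continuous function twice
  continuously differentiable.\<close>
lemma has_dd_conv:
  fixes k k' :: "'a::euclidean_space \<Rightarrow> real"
  assumes k: "continuous_on UNIV k" "\<And>x. 1 \<le> norm x \<Longrightarrow> k x = 0"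
    and k': "continuous_on UNIV k'" "\<And>x. 1 \<le> norm x \<Longrightarrow> k' x = 0"
    and d: "has_dd v (\<lambda>x. of_real (k x)) (\<lambda>x. of_real (k' x))" and L: "continuous_on UNIV L"
  shows "has_dd v (conv k L) (conv k' L)"
  unfolding has_dd_def
proof
  fix x :: 'a
  obtain a where a: "cball x (1 + norm v) \<subseteq> cbox (- a) a"
    using bounded_subset_cbox_symmetric[OF bounded_cball] by blast
  have rep: "conv h L (x + s *\<^sub>R v) = integral (cbox (-a) a) (\<lambda>u. of_real (h (x + s *\<^sub>R v - u)) * L u)"
    if s: "s \<in> {-1..1}" and h: "continuous_on UNIV h" "\<And>x. 1 \<le> norm x \<Longrightarrow> h x = 0" for s and h :: "'a \<Rightarrow> real"
    unfolding conv_def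
  proof (rule integral_cbox_of_support)
    show "continuous_on UNIV (\<lambda>u. of_real (h (x + s *\<^sub>R v - u)) * L u)"
      by (intro continuous_intros continuous_on_compose2[OF h(1)] L) auto
    fix u assume "u \<notin> cbox (- a) a"
    then have "1 + norm v < norm (x - u)" using a by (force simp: dist_norm)
    also have "x - u = (x + s *\<^sub>R v - u) - s *\<^sub>R v" by simp
    also have "norm \<dots> \<le> norm (x + s *\<^sub>R v - u) + norm (s *\<^sub>R v)" by (rule norm_triangle_ineq4)
    also have "norm (s *\<^sub>R v) \<le> norm v" using s by (auto intro!: mult_left_le_one_le)
    finally have "1 \<le> norm (x + s *\<^sub>R v - u)" by simp
    then show "of_real (h (x + s *\<^sub>R v - u)) * L u = 0" by (simp add: h(2))
  qed
  have "((\<lambda>s. integral (cbox (-a) a) (\<lambda>u. of_real (k (x + s *\<^sub>R v - u)) * L u)) has_vector_derivative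
      integral (cbox (-a) a) (\<lambda>u. of_real (k' (x + 0 *\<^sub>R v - u)) * L u)) (at 0 within {-1..1})"
  proof (rule leibniz_rule_vector_derivative)
    fix s u
    have "((\<lambda>s. of_real (k ((x - u) + s *\<^sub>R v))) has_vector_derivative (of_real (k' ((x - u) + s *\<^sub>R v)) :: complex)) (at s)"
      by (rule has_dd_along_line[OF d])
    from has_vector_derivative_mult_left[OF this, of "L u"]
    have "((\<lambda>s. of_real (k (x + s *\<^sub>R v - u)) * L u) has_vector_derivative of_real (k' (x + s *\<^sub>R v - u)) * L u) (at s)"
      by (simp only: add_diff_eq diff_add_eq)
    then show "((\<lambda>s. of_real (k (x + s *\<^sub>R v - u)) * L u) has_vector_derivative of_real (k' (x + s *\<^sub>R v - u)) * L u) (at s within {-1..1})"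
      by (rule has_vector_derivative_at_within)
  next
    fix s :: real
    show "(\<lambda>u. of_real (k (x + s *\<^sub>R v - u)) * L u) integrable_on cbox (-a) a"
      by (intro integrable_continuous continuous_intros continuous_on_compose2[OF k(1)] continuous_on_subset[OF L]) auto
    show "continuous_on ({-1..1} \<times> cbox (-a) a) (\<lambda>(s, u). of_real (k' (x + s *\<^sub>R v - u)) * L u)"
      by (auto simp: case_prod_beta intro!: continuous_intros continuous_on_compose2[OF k'(1)] continuous_on_compose2[OF L])
  qed auto
  moreover have "at (0::real) within {-1..1} = at 0" by (rule at_within_Icc_at) auto
  ultimately have D: "((\<lambda>s. integral (cbox (-a) a) (\<lambda>u. of_real (k (x + s *\<^sub>R v - u)) * L u)) has_vector_derivative
      integral (cbox (-a) a) (\<lambda>u. of_real (k' (x + 0 *\<^sub>R v - u)) * L u)) (at 0)" by simp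
  have "conv k' L x = integral (cbox (-a) a) (\<lambda>u. of_real (k' (x + 0 *\<^sub>R v - u)) * L u)"
    using rep[of 0 k'] k' by simp
  with D have "((\<lambda>s. integral (cbox (-a) a) (\<lambda>u. of_real (k (x + s *\<^sub>R v - u)) * L u)) has_vector_derivative conv k' L x) (at 0)"
    by simp
  then show "((\<lambda>s. conv k L (x + s *\<^sub>R v)) has_vector_derivative conv k' L x) (at 0)"
  proof (rule has_vector_derivative_transform_within[where d=1])
    fix s :: real assume "dist s 0 < 1"
    then have "s \<in> {-1..1}" by (auto simp: dist_real_def)
    from rep[OF this k] show "integral (cbox (-a) a) (\<lambda>u. of_real (k (x + s *\<^sub>R v - u)) * L u) = conv k L (x + s *\<^sub>R v)" by simp
  qed auto
qed

lemma conv_bound: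
  fixes k :: "'a::euclidean_space \<Rightarrow> real"
  assumes k: "continuous_on UNIV k" "\<And>x. 1 \<le> norm x \<Longrightarrow> k x = 0" "\<And>x. \<bar>k x\<bar> \<le> K"
    and L: "continuous_on UNIV L" "\<And>u. norm (u - x) \<le> 1 \<Longrightarrow> cmod (L u) \<le> A"
  shows "cmod (conv k L x) \<le> K * A * ball_volume TYPE('a)"
proof -
  have K0: "0 \<le> K" using k(3)[of 0] by linarith
  have "cmod (conv k L x) \<le> (LINT y|lborel. norm (of_real (k y) * L (x - y)))"
    unfolding conv_reflect by (rule integral_norm_bound)
  also have "\<dots> \<le> (LINT y|lborel. K * A * indicator (ball (0::'a) 1) y)"
  proof (rule integral_mono)
    have c: "continuous_on UNIV (\<lambda>y. norm (of_real (k y) * L (x - y)))"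
      by (intro continuous_intros k continuous_on_compose2[OF L(1)]) auto
    show "integrable lborel (\<lambda>y. norm (of_real (k y) * L (x - y)))"
      by (rule integrable_compact_support[OF c, where R=1 and a=0]) (simp add: k)
    show "integrable lborel (\<lambda>y. K * A * indicator (ball (0::'a) 1) y)"
      using emeasure_bounded_finite[of "ball (0::'a) 1"]
      by (intro integrable_mult_right integrable_real_indicator) auto
    fix y
    show "norm (of_real (k y) * L (x - y)) \<le> K * A * indicator (ball 0 1) y"
    proof (cases "norm y < 1")
      case True
      then have "cmod (L (x - y)) \<le> A" by (intro L(2)) simp
      then show ?thesis using True k(3)[of y] K0 by (auto simp: norm_mult intro!: mult_mono)
    qed (simp add: k)
  qed
  finally show ?thesis by (simp add: ball_volume_def)
qed

definition bump_mass :: "'a::euclidean_space itself \<Rightarrow> real" where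
  "bump_mass _ = (LINT x|lborel. bump (x::'a))"

lemma bump_integrable: "integrable lborel (\<lambda>x::'a::euclidean_space. bump x)"
  by (rule integrable_compact_support[where R=1 and a=0]) (auto intro!: continuous_intros simp: bump_support)

lemma bump_mass_pos: "0 < bump_mass TYPE('a::euclidean_space)"
proof -
  have "bump_mass TYPE('a) \<ge> 0" unfolding bump_mass_def by (intro integral_nonneg_AE) (auto simp: bump_range)
  moreover have "bump_mass TYPE('a) \<noteq> 0"
  proof
    assume "bump_mass TYPE('a) = 0"
    then have "AE x::'a in lborel. bump x = 0"
      unfolding bump_mass_def using integral_nonneg_eq_0_iff_AE[OF bump_integrable] by (auto simp: bump_range)
    moreover have "x \<notin> ball 0 1" if "bump x = 0" for x :: 'a
    proof
      assume "x \<in> ball 0 1"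
      then have "(norm x)\<^sup>2 < 1" by (simp add: abs_square_less_1)
      then have "x \<bullet> x < 1" by (simp add: dot_square_norm)
      then show False using that by (simp add: bump_def max_def split: if_splits)
    qed
    ultimately have "AE x::'a in lborel. x \<notin> ball 0 1" by (auto elim: AE_mp)
    then have "emeasure lborel (ball (0::'a) 1) = 0"
      by (subst (asm) AE_iff_measurable[OF _ refl]) (auto simp: ball_def)
    then show False using ball_volume_pos[where 'a='a] by (simp add: ball_volume_def measure_def)
  qed
  ultimately show ?thesis by simp
qed

lemma bump_mass_shift: "(LINT u|lborel. bump (x - u)) = bump_mass TYPE('a)" for x :: "'a::euclidean_space"
  unfolding bump_mass_def by (rule lborel_integral_reflect(2))

lemma conv_bump_Lipschitz:
  fixes L :: "'a::euclidean_space \<Rightarrow> complex"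
  assumes L: "continuous_on UNIV L" and lip: "\<And>x y. cmod (L x - L y) \<le> M * norm (x - y)"
  shows "cmod (conv bump L x - conv bump L y) \<le> bump_mass TYPE('a) * (M * norm (x - y))"
proof -
  have c: "continuous_on UNIV (\<lambda>t. of_real (bump t) * L (x - t))" for x
    by (intro continuous_intros continuous_on_compose2[OF L]) auto
  have i: "integrable lborel (\<lambda>t. of_real (bump t) * L (x - t))" for x
    by (rule integrable_compact_support[OF c, where R=1 and a=0]) (simp add: bump_support)
  have "conv bump L x - conv bump L y = (LINT t|lborel. of_real (bump t) * (L (x - t) - L (y - t)))"
    unfolding conv_reflect using i by (simp add: right_diff_distrib)
  also have "cmod \<dots> \<le> (LINT t|lborel. norm (of_real (bump t) * (L (x - t) - L (y - t))))"
    by (rule integral_norm_bound)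
  also have "\<dots> \<le> (LINT t|lborel. bump (t::'a) * (M * norm (x - y)))"
  proof (rule integral_mono)
    show "integrable lborel (\<lambda>t. norm (of_real (bump t) * (L (x - t) - L (y - t))))"
      using i[of x] i[of y] by (intro integrable_norm) (simp add: right_diff_distrib)
    show "integrable lborel (\<lambda>t::'a. bump t * (M * norm (x - y)))"
      by (intro integrable_mult_left bump_integrable)
    fix t
    show "norm (of_real (bump t) * (L (x - t) - L (y - t))) \<le> bump t * (M * norm (x - y))"
      using lip[of "x - t" "y - t"] by (auto simp: norm_mult abs_of_nonneg bump_range intro!: mult_left_mono)
  qed
  finally show ?thesis by (simp add: bump_mass_def)
qed

lemma has_dd_Lipschitz_bound:
  assumes d: "has_dd v X Y" and lip: "\<And>x y. cmod (X x - X y) \<le> K * norm (x - y)"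
  shows "cmod (Y x) \<le> K * norm v"
proof -
  let ?q = "\<lambda>h. norm (X (x + (0 + h) *\<^sub>R v) - X (x + 0 *\<^sub>R v) - h *\<^sub>R Y x) / norm h"
  have "((\<lambda>s. X (x + s *\<^sub>R v)) has_derivative (\<lambda>h. h *\<^sub>R Y x)) (at 0)"
    using d by (simp add: has_dd_def has_vector_derivative_def)
  then have "?q \<midarrow>0\<rightarrow> 0" by (simp add: has_derivative_at)
  then have lim: "(\<lambda>h. K * norm v + ?q h) \<midarrow>0\<rightarrow> K * norm v + 0" by (intro tendsto_intros)
  have ev: "\<forall>\<^sub>F h in at 0. cmod (Y x) \<le> K * norm v + ?q h"
    unfolding eventually_at_topological
  proof (intro exI[of _ UNIV] conjI ballI impI)
    fix h :: real assume h: "h \<noteq> 0"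
    have "cmod (h *\<^sub>R Y x) \<le> norm (X (x + h *\<^sub>R v) - X x) + norm (X (x + h *\<^sub>R v) - X x - h *\<^sub>R Y x)"
      using norm_triangle_ineq4[of "X (x + h *\<^sub>R v) - X x" "X (x + h *\<^sub>R v) - X x - h *\<^sub>R Y x"] by simp
    also have "norm (X (x + h *\<^sub>R v) - X x) \<le> K * (\<bar>h\<bar> * norm v)" using lip[of "x + h *\<^sub>R v" x] by simp
    finally show "cmod (Y x) \<le> K * norm v + ?q h" using h by (simp add: field_simps)
  qed auto
  show ?thesis using tendsto_lowerbound[OF lim ev] by simp
qed

lemma half_sum_bound:
  assumes "cmod a \<le> R" "cmod b \<le> R"
  shows "cmod ((a + \<i> * b) / 2) \<le> R"
  using assms norm_triangle_ineq[of a "\<i> * b"] by (simp add: norm_divide norm_mult)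

definition dconv :: "'n::finite \<Rightarrow> (complex ^ 'n \<Rightarrow> complex) \<Rightarrow> complex ^ 'n \<Rightarrow> complex" where
  "dconv l L x = (conv (bump_d (axis l 1)) L x + \<i> * conv (bump_d (axis l \<i>)) L x) / 2"

definition ddconv :: "'n::finite \<Rightarrow> 'n \<Rightarrow> (complex ^ 'n \<Rightarrow> complex) \<Rightarrow> complex ^ 'n \<Rightarrow> complex" where
  "ddconv l k L x = ((conv (bump_dd (axis l 1) (axis k 1)) L x + \<i> * conv (bump_dd (axis l 1) (axis k \<i>)) L x) / 2
     + \<i> * ((conv (bump_dd (axis l \<i>) (axis k 1)) L x + \<i> * conv (bump_dd (axis l \<i>) (axis k \<i>)) L x) / 2)) / 2"

lemma bump_continuous_on: "continuous_on UNIV bump" "continuous_on UNIV (bump_d v)" "continuous_on UNIV (bump_dd v w)"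
  using continuous_bump[OF continuous_on_id, of UNIV] by auto

lemma conv_bump_dd:
  assumes L: "continuous_on UNIV L"
  shows "continuous_on UNIV (conv bump L)" "continuous_on UNIV (conv (bump_d v) L)" "continuous_on UNIV (conv (bump_dd v w) L)"
    and "has_dd v (conv bump L) (conv (bump_d v) L)" "has_dd w (conv (bump_d v) L) (conv (bump_dd v w) L)"
proof -
  show "continuous_on UNIV (conv bump L)"
    by (rule continuous_conv[OF _ _ L]) (auto simp: bump_continuous_on bump_support)
  show "continuous_on UNIV (conv (bump_d v) L)"
    by (rule continuous_conv[OF _ _ L]) (auto simp: bump_continuous_on bump_support)
  show "continuous_on UNIV (conv (bump_dd v w) L)"
    by (rule continuous_conv[OF _ _ L]) (auto simp: bump_continuous_on bump_support)
  show "has_dd v (conv bump L) (conv (bump_d v) L)"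
    by (rule has_dd_conv[OF _ _ _ _ has_dd_bump L]) (simp_all add: bump_continuous_on bump_support)
  show "has_dd w (conv (bump_d v) L) (conv (bump_dd v w) L)"
    by (rule has_dd_conv[OF _ _ _ _ has_dd_bump_d L]) (simp_all add: bump_continuous_on bump_support)
qed

lemma has_dbar_conv:
  assumes L: "continuous_on UNIV L"
  shows "has_dbar l (conv bump L) (dconv l L)"
  by (rule has_dbarI[OF conv_bump_dd(1)[OF L] conv_bump_dd(4)[OF L] conv_bump_dd(4)[OF L] conv_bump_dd(2)[OF L] conv_bump_dd(2)[OF L]])
     (simp add: dconv_def)

lemma has_dbar_dconv:
  assumes L: "continuous_on UNIV L"
  shows "has_dbar k (dconv l L) (ddconv l k L)"
proof -
  have 1: "has_dbar k (conv (bump_d v) L) (\<lambda>x. (conv (bump_dd v (axis k 1)) L x + \<i> * conv (bump_dd v (axis k \<i>)) L x) / 2)" for v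
    by (rule has_dbarI[OF conv_bump_dd(2)[OF L] conv_bump_dd(5)[OF L] conv_bump_dd(5)[OF L] conv_bump_dd(3)[OF L] conv_bump_dd(3)[OF L]]) simp
  from has_dbar_cmult[OF has_dbar_add[OF 1[of "axis l 1"] has_dbar_cmult[OF 1[of "axis l \<i>"], where c=\<i>]], where c="1/2"]
  show ?thesis unfolding dconv_def[abs_def] ddconv_def[abs_def] by simp
qed

lemma ddconv_commute: "ddconv l k L = ddconv k l L"
proof -
  have "bump_dd v w = bump_dd w v" for v w :: "complex^'a"
    by (auto simp: bump_dd_def fun_eq_iff inner_commute)
  then have "conv (bump_dd v w) L = conv (bump_dd w v) L" for v w :: "complex^'a" by simp
  then show ?thesis
    unfolding ddconv_def fun_eq_iff
    by (auto simp: algebra_simps add_divide_distrib)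
qed

text \<open>The coordinates of the conjugate gradient, averaged over unit balls with the weight \<open>bump\<close>;
  \<open>dmoll\<close> and \<open>ddmoll\<close> are the first and second conjugate derivatives. The gradient itself is only
  Lipschitz, while the deformation of phases differentiates twice.\<close>
definition moll :: "(complex ^ 'n::finite \<Rightarrow> complex ^ 'n) \<Rightarrow> 'n \<Rightarrow> complex ^ 'n \<Rightarrow> complex" where
  "moll G i x = conv bump (\<lambda>u. vcnj (G u) $ i) x / of_real (bump_mass TYPE(complex ^ 'n))"

definition dmoll :: "(complex ^ 'n::finite \<Rightarrow> complex ^ 'n) \<Rightarrow> 'n \<Rightarrow> 'n \<Rightarrow> complex ^ 'n \<Rightarrow> complex" where
  "dmoll G i l x = dconv l (\<lambda>u. vcnj (G u) $ i) x / of_real (bump_mass TYPE(complex ^ 'n))"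

definition ddmoll :: "(complex ^ 'n::finite \<Rightarrow> complex ^ 'n) \<Rightarrow> 'n \<Rightarrow> 'n \<Rightarrow> 'n \<Rightarrow> complex ^ 'n \<Rightarrow> complex" where
  "ddmoll G i l k x = ddconv l k (\<lambda>u. vcnj (G u) $ i) x / of_real (bump_mass TYPE(complex ^ 'n))"

lemma norm_axis_complex: "norm (axis k (1::complex)) = 1" "norm (axis k \<i>) = 1"
  by (simp_all add: norm_eq_sqrt_inner inner_axis_axis)

context
  fixes m M :: real and \<phi> :: "complex ^ 'n::finite \<Rightarrow> real" and G
  assumes qw: "quadratic_weight m M \<phi> G"
begin

lemma m_pos: "0 < m" and M_pos: "0 < M" and mM: "m \<le> M"
  and G_cont: "continuous_on UNIV G"
  and phi_lower: "\<phi> z + G z \<bullet> (w - z) + m/2 * (norm (w - z))\<^sup>2 \<le> \<phi> w"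
  and phi_upper: "\<phi> w \<le> \<phi> z + G z \<bullet> (w - z) + M/2 * (norm (w - z))\<^sup>2"
  using qw unfolding quadratic_weight_def by auto

lemma G_coord_cont: "continuous_on UNIV (\<lambda>u. vcnj (G u) $ i)"
  by (intro continuous_intros G_cont)

lemma G_coord_Lipschitz: "cmod (vcnj (G x) $ i - vcnj (G y) $ i) \<le> M * norm (x - y)"
proof -
  have "cmod (vcnj (G x) $ i - vcnj (G y) $ i) = cmod ((G x - G y) $ i)"
    by (simp add: vcnj_def complex_cnj_diff[symmetric] del: complex_cnj_diff)
  also have "\<dots> \<le> norm (G x - G y)" by (rule Finite_Cartesian_Product.norm_nth_le)
  also have "\<dots> \<le> M * norm (x - y)" by (rule quadratic_weight_Lipschitz[OF qw])
  finally show ?thesis .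
qed

lemma G_coord_growth: "cmod (vcnj (G u) $ i) \<le> norm (G z) + M * norm (u - z)"
proof -
  have "cmod (vcnj (G u) $ i) \<le> norm (G u)"
    using Finite_Cartesian_Product.norm_nth_le[of "G u" i] by (simp add: vcnj_def)
  also have "\<dots> \<le> norm (G z) + norm (G u - G z)" by (metis add.commute diff_add_cancel norm_triangle_ineq)
  also have "norm (G u - G z) \<le> M * norm (u - z)" by (rule quadratic_weight_Lipschitz[OF qw])
  finally show ?thesis by simp
qed

lemma has_dbar_moll: "has_dbar l (moll G i) (dmoll G i l)"
  using has_dbar_cmult[OF has_dbar_conv[OF G_coord_cont], where c="1 / of_real (bump_mass TYPE(complex ^ 'n))"]
  unfolding moll_def[abs_def] dmoll_def[abs_def] by simp

lemma has_dbar_dmoll: "has_dbar k (dmoll G i l) (ddmoll G i l k)"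
  using has_dbar_cmult[OF has_dbar_dconv[OF G_coord_cont], where c="1 / of_real (bump_mass TYPE(complex ^ 'n))"]
  unfolding dmoll_def[abs_def] ddmoll_def[abs_def] by simp

text \<open>The bound does not grow with \<open>x\<close>, because it comes from the Lipschitz constant of \<open>G\<close> instead of
  its size. It makes the determinant in the reproducing kernel bounded.\<close>
lemma dmoll_bound: "cmod (dmoll G i l x) \<le> M"
proof -
  let ?c = "bump_mass TYPE(complex ^ 'n)"
  have c: "0 < ?c" by (rule bump_mass_pos)
  have 1: "cmod (conv (bump_d v) (\<lambda>u. vcnj (G u) $ i) x) \<le> ?c * M * norm v" for v
    by (rule has_dd_Lipschitz_bound[OF conv_bump_dd(4)[OF G_coord_cont]])
       (use conv_bump_Lipschitz[OF G_coord_cont G_coord_Lipschitz] in \<open>simp add: mult.assoc\<close>)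
  have "cmod (dconv l (\<lambda>u. vcnj (G u) $ i) x) \<le> ?c * M"
    unfolding dconv_def
    using 1[of "axis l 1"] 1[of "axis l \<i>"] by (intro half_sum_bound) (simp_all add: norm_axis_complex)
  then show ?thesis using c by (simp add: dmoll_def norm_divide field_simps)
qed

lemma moll_growth:
  "cmod (moll G i x) \<le> 30 * ball_volume TYPE(complex ^ 'n) * (norm (G z) + M) / bump_mass TYPE(complex ^ 'n) * (1 + norm (x - z))" (is ?A)
  "cmod (ddmoll G i l k x) \<le> 30 * ball_volume TYPE(complex ^ 'n) * (norm (G z) + M) / bump_mass TYPE(complex ^ 'n) * (1 + norm (x - z))" (is ?B)
proof -
  let ?c = "bump_mass TYPE(complex ^ 'n)" and ?V = "ball_volume TYPE(complex ^ 'n)"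
  have c: "0 < ?c" by (rule bump_mass_pos)
  have V: "0 < ?V" by (rule ball_volume_pos)
  define A where "A = (norm (G z) + M) * (1 + norm (x - z))"
  have A0: "0 \<le> A" using M_pos by (simp add: A_def)
  have LA: "cmod (vcnj (G u) $ i) \<le> A" if "norm (u - x) \<le> 1" for u
  proof -
    have "norm (u - z) \<le> norm (u - x) + norm (x - z)" by (rule norm_diff_triangle_ineq[of u x x z, simplified])
    then have "M * norm (u - z) \<le> M * (1 + norm (x - z))" using that M_pos by (intro mult_left_mono) auto
    moreover have "norm (G z) * 1 \<le> norm (G z) * (1 + norm (x - z))" by (intro mult_left_mono) auto
    ultimately show ?thesis using G_coord_growth[of u i z] by (simp add: A_def distrib_right)
  qed
  have 0: "cmod (conv bump (\<lambda>u. vcnj (G u) $ i) x) \<le> 1 * A * ?V"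
    by (rule conv_bound[OF _ _ _ G_coord_cont LA]) (auto simp: bump_continuous_on bump_support bump_range abs_of_nonneg)
  also have "\<dots> \<le> 30 * A * ?V" using A0 V by (intro mult_right_mono) auto
  finally have "cmod (conv bump (\<lambda>u. vcnj (G u) $ i) x) / ?c \<le> 30 * A * ?V / ?c"
    using c by (intro divide_right_mono) auto
  moreover have e: "30 * A * ?V / ?c = 30 * ?V * (norm (G z) + M) / ?c * (1 + norm (x - z))"
    by (simp only: A_def mult_ac times_divide_eq_left times_divide_eq_right)
  ultimately show ?A using c by (simp only: moll_def norm_divide norm_of_real abs_of_pos e)
  have 2: "cmod (conv (bump_dd v w) (\<lambda>u. vcnj (G u) $ i) x) \<le> 30 * A * ?V" if "norm v = 1" "norm w = 1" for v w
    by (rule conv_bound[OF _ _ _ G_coord_cont LA]) (use bump_dd_bound[of v w] that in \<open>auto simp: bump_continuous_on bump_support\<close>)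
  have "cmod (ddconv l k (\<lambda>u. vcnj (G u) $ i) x) \<le> 30 * A * ?V"
    unfolding ddconv_def by (intro half_sum_bound 2 norm_axis_complex)
  then have "cmod (ddconv l k (\<lambda>u. vcnj (G u) $ i) x) / ?c \<le> 30 * A * ?V / ?c"
    using c by (intro divide_right_mono) auto
  then show ?B using c by (simp only: ddmoll_def norm_divide norm_of_real abs_of_pos e)
qed

text \<open>For \<open>u\<close> within distance \<open>1\<close> of \<open>x\<close>, the lower quadratic bound from \<open>u\<close> to \<open>z\<close> and the upper one from \<open>u\<close>
  to \<open>x\<close> combine to an estimate for \<open>G u \<bullet> (z - x)\<close>, which survives averaging over \<open>u\<close>. The constant
  \<open>(M + m) / 2\<close> is the price of averaging at unit scale.\<close>
lemma moll_exponent: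
  "Re (\<Sum>i\<in>UNIV. moll G i x * (z $ i - x $ i)) \<le> \<phi> z - \<phi> x + (M + m) / 2 - m / 4 * (norm (x - z))\<^sup>2"
proof -
  let ?c = "bump_mass TYPE(complex ^ 'n)"
  have c: "0 < ?c" by (rule bump_mass_pos)
  define Q where "Q = \<phi> z - \<phi> x + (M + m) / 2 - m / 4 * (norm (x - z))\<^sup>2"
  have iG: "integrable lborel (\<lambda>u. of_real (bump (x - u)) * vcnj (G u) $ i)" for i
  proof -
    have "continuous_on UNIV (\<lambda>u. of_real (bump (x - u)) * vcnj (G u) $ i)"
      by (intro continuous_intros G_cont)
    then show ?thesis by (rule integrable_compact_support[where R=1 and a=x]) (simp add: bump_support norm_minus_commute)
  qed
  have ib: "integrable lborel (\<lambda>u. bump (x - u))"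
    using bump_integrable by (simp add: lborel_integral_reflect(1))
  have "(\<Sum>i\<in>UNIV. moll G i x * (z $ i - x $ i)) = (LINT u|lborel. of_real (bump (x - u)) * bil (vcnj (G u)) (z - x)) / of_real ?c"
    using iG by (simp add: moll_def conv_def bil_def sum_distrib_left sum_divide_distrib mult.assoc[symmetric])
  also have "\<dots> = (LINT u|lborel. of_real (bump (x - u)) * bil (vcnj (G u)) (z - x)) /\<^sub>R ?c"
    by (simp add: scaleR_conv_of_real divide_inverse mult.commute)
  finally have "Re (\<Sum>i\<in>UNIV. moll G i x * (z $ i - x $ i)) = Re (LINT u|lborel. of_real (bump (x - u)) * bil (vcnj (G u)) (z - x)) / ?c"
    by (simp add: divide_inverse mult.commute)
  also have "Re (LINT u|lborel. of_real (bump (x - u)) * bil (vcnj (G u)) (z - x)) = (LINT u|lborel. bump (x - u) * (G u \<bullet> (z - x)))"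
  proof -
    have "integrable lborel (\<lambda>u. of_real (bump (x - u)) * bil (vcnj (G u)) (z - x))"
      using iG by (simp add: bil_def sum_distrib_left mult.assoc[symmetric])
    from integral_Re[OF this] show ?thesis by (simp add: Re_bil_vcnj)
  qed
  also have "\<dots> \<le> (LINT u|lborel. bump (x - u) * Q)"
  proof (rule integral_mono)
    have "continuous_on UNIV (\<lambda>u. bump (x - u) * (G u \<bullet> (z - x)))" by (intro continuous_intros G_cont)
    then show "integrable lborel (\<lambda>u. bump (x - u) * (G u \<bullet> (z - x)))"
      by (rule integrable_compact_support[where R=1 and a=x]) (simp add: bump_support norm_minus_commute)
    show "integrable lborel (\<lambda>u. bump (x - u) * Q)" using ib by simp
    fix u
    show "bump (x - u) * (G u \<bullet> (z - x)) \<le> bump (x - u) * Q"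
    proof (cases "1 \<le> norm (x - u)")
      case True then show ?thesis by (simp add: bump_support)
    next
      case False
      then have s: "(norm (x - u))\<^sup>2 \<le> 1" by (simp add: power_le_one)
      have "G u \<bullet> (z - x) = G u \<bullet> (z - u) - G u \<bullet> (x - u)" by (simp add: inner_diff_right)
      also have "\<dots> \<le> (\<phi> z - \<phi> u - m/2 * (norm (z - u))\<^sup>2) + (\<phi> u - \<phi> x + M/2 * (norm (x - u))\<^sup>2)"
        using phi_lower[of u z] phi_upper[of x u] by linarith
      also have "M/2 * (norm (x - u))\<^sup>2 \<le> M/2" using s M_pos by (simp add: mult_left_le)
      finally have 1: "G u \<bullet> (z - x) \<le> \<phi> z - \<phi> x + M / 2 - m/2 * (norm (z - u))\<^sup>2" by linarith
      have "(norm (x - z))\<^sup>2 \<le> (norm (x - u) + norm (z - u))\<^sup>2"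
        using norm_triangle_ineq4[of "x - u" "z - u"] by (intro power_mono) auto
      also have "\<dots> \<le> 2 * (norm (x - u))\<^sup>2 + 2 * (norm (z - u))\<^sup>2" using sum_squares_bound[of "norm (x - u)" "norm (z - u)"] by (simp add: power2_sum)
      also have "\<dots> \<le> 2 + 2 * (norm (z - u))\<^sup>2" using s by simp
      finally have "m/4 * (norm (x - z))\<^sup>2 \<le> m/4 * (2 + 2 * (norm (z - u))\<^sup>2)" using m_pos by (intro mult_left_mono) auto
      then have "G u \<bullet> (z - x) \<le> Q" using 1 unfolding Q_def by (simp add: algebra_simps add_divide_distrib)
      then show ?thesis by (intro mult_left_mono bump_range)
    qed
  qed
  also have "\<dots> = ?c * Q" by (simp add: bump_mass_shift)
  finally show ?thesis using c by (simp add: Q_def divide_right_mono)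
qed

text \<open>The value of the phase integral at \<open>g = 1\<close> for the affine phase in \<open>reproducing_phase\<close>, whose
  determinant is \<open>M ^ CARD('n)\<close>.\<close>
definition gauss_mass :: real where
  "gauss_mass = M ^ CARD('n) * (LINT x|lborel. exp (- M * (norm (x :: complex ^ 'n))\<^sup>2))"

lemma gauss_mass_pos: "0 < gauss_mass"
  unfolding gauss_mass_def by (intro mult_pos_pos zero_less_power M_pos gaussian_integral_pos)

text \<open>The averaged gradient may be deformed to the affine phase with the same value at \<open>z\<close> and slope
  \<open>M\<close>. For that phase the integrand is an entire function times a Gaussian centred at \<open>z\<close>, so the
  mean value property evaluates it.\<close>
lemma reproducing_phase:
  assumes g: "entire g" and gb: "\<And>x. cmod (g x) \<le> B0 * exp (\<phi> x)"
  shows "(LINT x|lborel. phase_integrand g z (moll G) (dmoll G) x) = of_real gauss_mass * g z"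
proof -
  have B0: "0 \<le> B0" using gb[of 0] norm_ge_zero[of "g 0"] by (smt (verit) exp_gt_zero zero_le_mult_iff)
  define K where "K = 30 * ball_volume TYPE(complex ^ 'n) * (norm (G z) + M) / bump_mass TYPE(complex ^ 'n)"
  have K0: "0 \<le> K" using ball_volume_pos[where 'a="complex^'n"] bump_mass_pos[where 'a="complex^'n"] M_pos by (simp add: K_def)
  define B where "B = 1 + K + (norm (G z) + M) + B0 * exp (\<phi> z + (M + m) / 2)"
  have B: "1 \<le> B" "K \<le> B" "norm (G z) + M \<le> B" "B0 * exp (\<phi> z + (M + m) / 2) \<le> B" "M \<le> B" "norm (G z) \<le> B"
    using K0 B0 M_pos by (auto simp: B_def add_increasing2)
  have grow: "c \<le> B * (1 + norm (x - z))" if "c \<le> B" for c x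
  proof -
    have "B * 1 \<le> B * (1 + norm (x - z))" using B(1) by (intro mult_left_mono) auto
    with that show ?thesis by linarith
  qed
  have c: "0 < m / 4" using m_pos by simp
  have F1: "phase g z B (m/4) (moll G) (dmoll G) (ddmoll G)"
    unfolding phase_def
  proof (intro conjI allI)
    fix i l k x
    show "has_dbar l (moll G i) (dmoll G i l)" by (rule has_dbar_moll)
    show "has_dbar k (dmoll G i l) (ddmoll G i l k)" by (rule has_dbar_dmoll)
    show "ddmoll G i l k = ddmoll G i k l" by (simp add: ddmoll_def fun_eq_iff ddconv_commute)
    have "K * (1 + norm (x - z)) \<le> B * (1 + norm (x - z))" using B by (intro mult_right_mono) auto
    then show "cmod (moll G i x) \<le> B * (1 + norm (x - z))" "cmod (ddmoll G i l k x) \<le> B * (1 + norm (x - z))"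
      using moll_growth(1)[of i x z, folded K_def] moll_growth(2)[of i l k x z, folded K_def] by linarith+
    show "cmod (dmoll G i l x) \<le> B * (1 + norm (x - z))"
      using grow[OF B(5), of x] dmoll_bound[of i l x] by linarith
    have "cmod (g x) * exp (Re (\<Sum>i\<in>UNIV. moll G i x * (z $ i - x $ i))) \<le>
      (B0 * exp (\<phi> x)) * exp (\<phi> z - \<phi> x + (M + m) / 2 - m / 4 * (norm (x - z))\<^sup>2)"
      using moll_exponent[of x z] gb[of x] B0 by (intro mult_mono) auto
    also have "\<dots> = (B0 * exp (\<phi> z + (M + m) / 2)) * exp (- (m/4) * (norm (x - z))\<^sup>2)"
      by (simp add: mult.assoc exp_add[symmetric])
    also have "\<dots> \<le> B * exp (- (m/4) * (norm (x - z))\<^sup>2)" using B by (intro mult_right_mono) auto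
    finally show "cmod (g x) * exp (Re (\<Sum>i\<in>UNIV. moll G i x * (z $ i - x $ i))) \<le> B * exp (- (m/4) * (norm (x - z))\<^sup>2)" .
  qed
  \<comment> \<open>The slope \<open>M\<close> is large enough for the upper quadratic bound of \<open>\<phi>\<close> to give this phase the same
    decay as the averaged gradient has.\<close>
  define A where "A = (\<lambda>i x. vcnj (G z) $ i + of_real M * (cnj (x $ i) - cnj (z $ i)))"
  define dA where "dA = (\<lambda>(i::'n) l (x::complex^'n). if i = l then complex_of_real M else 0)"
  have Aexp: "(\<Sum>i\<in>UNIV. A i x * (z $ i - x $ i)) = - bil (vcnj (G z)) (x - z) - of_real (M * (norm (x - z))\<^sup>2)" for x
  proof -
    have "of_real ((norm (x - z))\<^sup>2) = (\<Sum>i\<in>UNIV. of_real ((cmod (x $ i - z $ i))\<^sup>2) :: complex)"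
      by (simp add: norm_vec_def L2_set_def sum_nonneg)
    also have "\<dots> = (\<Sum>i\<in>UNIV. (x $ i - z $ i) * (cnj (x $ i) - cnj (z $ i)))"
      by (simp only: complex_norm_square complex_cnj_diff)
    finally have "of_real M * of_real ((norm (x - z))\<^sup>2) = (\<Sum>i\<in>UNIV. of_real M * ((x $ i - z $ i) * (cnj (x $ i) - cnj (z $ i))))"
      by (simp only: sum_distrib_left)
    then show ?thesis
      by (simp add: A_def bil_def algebra_simps sum.distrib sum_subtractf)
  qed
  have ReA: "Re (\<Sum>i\<in>UNIV. A i x * (z $ i - x $ i)) = - (G z \<bullet> (x - z)) - M * (norm (x - z))\<^sup>2" for x
    unfolding Aexp by (simp add: Re_bil_vcnj)
  have F0: "phase g z B (m/4) A dA (\<lambda>i l k x. 0)"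
    unfolding phase_def
  proof (intro conjI allI)
    fix i l k x
    have "has_dbar l (A i) (\<lambda>x. 0 + of_real M * ((if i = l then 1 else 0) - 0))"
      unfolding A_def by (intro has_dbar_add has_dbar_const has_dbar_cmult has_dbar_diff has_dbar_cnj_coordinate)
    moreover have "(\<lambda>x::complex^'n. 0 + of_real M * ((if i = l then 1 else 0) - 0)) = dA i l" by (auto simp: dA_def fun_eq_iff)
    ultimately show "has_dbar l (A i) (dA i l)" by simp
    show "has_dbar k (dA i l) (\<lambda>x. 0)" unfolding dA_def by (rule has_dbar_const)
    have "cmod (A i x) \<le> norm (G z) + M * norm (x - z)"
    proof -
      have "cmod (vcnj (G z) $ i) \<le> norm (G z)"
        using Finite_Cartesian_Product.norm_nth_le[of "G z" i] by (simp add: vcnj_def)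
      moreover have "cmod (of_real M * (cnj (x $ i) - cnj (z $ i))) \<le> M * norm (x - z)"
        using Finite_Cartesian_Product.norm_nth_le[of "x - z" i] M_pos
        by (simp add: norm_mult complex_cnj_diff[symmetric] del: complex_cnj_diff)
      ultimately show ?thesis unfolding A_def by (rule norm_triangle_le[OF add_mono])
    qed
    also have "\<dots> \<le> B * 1 + B * norm (x - z)" using B by (intro add_mono mult_right_mono) auto
    finally show "cmod (A i x) \<le> B * (1 + norm (x - z))" by (simp add: algebra_simps)
    show "cmod (dA i l x) \<le> B * (1 + norm (x - z))" using grow[OF B(5), of x] M_pos grow[of 0 x] B(1) by (simp add: dA_def)
    show "cmod 0 \<le> B * (1 + norm (x - z))" using grow[of 0 x] B(1) by simp
    have "cmod (g x) * exp (Re (\<Sum>i\<in>UNIV. A i x * (z $ i - x $ i))) \<le> (B0 * exp (\<phi> x)) * exp (\<phi> z - \<phi> x + (M + m) / 2 - m / 4 * (norm (x - z))\<^sup>2)"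
    proof -
      have "m / 4 * (norm (x - z))\<^sup>2 \<le> M / 2 * (norm (x - z))\<^sup>2" using mM m_pos by (intro mult_right_mono) auto
      then have "Re (\<Sum>i\<in>UNIV. A i x * (z $ i - x $ i)) \<le> \<phi> z - \<phi> x + (M + m) / 2 - m / 4 * (norm (x - z))\<^sup>2"
        unfolding ReA using phi_upper[of x z] m_pos M_pos field_sum_of_halves[of "M * (norm (x - z))\<^sup>2"] by (simp add: field_simps)
      then show ?thesis using gb[of x] B0 by (intro mult_mono) auto
    qed
    also have "\<dots> = (B0 * exp (\<phi> z + (M + m) / 2)) * exp (- (m/4) * (norm (x - z))\<^sup>2)"
      by (simp add: mult.assoc exp_add[symmetric])
    also have "\<dots> \<le> B * exp (- (m/4) * (norm (x - z))\<^sup>2)" using B by (intro mult_right_mono) auto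
    finally show "cmod (g x) * exp (Re (\<Sum>i\<in>UNIV. A i x * (z $ i - x $ i))) \<le> B * exp (- (m/4) * (norm (x - z))\<^sup>2)" .
  qed auto
  have E: "exp (- b - of_real t) = exp (- b) * of_real (exp (- t))" for b :: complex and t
    by (simp only: diff_conv_add_uminus exp_add exp_of_real of_real_minus[symmetric])
  have bil_neg: "bil (- a) b = - bil a b" for a b :: "complex ^ 'n" by (simp add: bil_def sum_negf)
  have "(LINT x|lborel. phase_integrand g z (moll G) (dmoll G) x) = (LINT x|lborel. phase_integrand g z A dA x)"
    by (rule phase_homotopy[OF F0 F1 g B(1) c])
  also have "\<dots> = of_real (M ^ CARD('n)) * (LINT x|lborel. (g (z + x) * exp (0 + bil (- vcnj (G z)) (z + x - z))) * of_real (exp (- M * (norm x)\<^sup>2)))"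
  proof -
    have "det (\<chi> i l. dA i l x) = of_real (M ^ CARD('n))" for x
      by (subst det_diagonal) (auto simp: dA_def)
    then have e: "phase_integrand g z A dA (z + x) = of_real (M ^ CARD('n)) * ((g (z + x) * exp (0 + bil (- vcnj (G z)) (z + x - z))) * of_real (exp (- M * (norm x)\<^sup>2)))" for x
      unfolding phase_integrand_def Aexp E bil_neg by (simp add: mult_ac)
    show ?thesis
      by (subst lborel_integral_translate(2)[of "phase_integrand g z A dA" z, symmetric]) (simp only: e integral_mult_right_zero)
  qed
  also have "(LINT x|lborel. (g (z + x) * exp (0 + bil (- vcnj (G z)) (z + x - z))) * of_real (exp (- M * (norm x)\<^sup>2)))
     = g z * exp (0 + bil (- vcnj (G z)) (z - z)) * of_real (LINT x|lborel. exp (- M * (norm (x :: complex ^ 'n))\<^sup>2))"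
  proof (rule entire_mean_value[of "\<lambda>w. g w * exp (0 + bil (- vcnj (G z)) (w - z))"])
    show "entire (\<lambda>w. g w * exp (0 + bil (- vcnj (G z)) (w - z)))" by (intro entire_mult g entire_exp_bil)
    show "(\<lambda>x::complex^'n. exp (- M * (norm x)\<^sup>2)) \<in> borel_measurable borel" by measurable
    show "exp (- M * (norm (c *s x))\<^sup>2) = exp (- M * (norm x)\<^sup>2)" if "cmod c = 1" for c and x :: "complex^'n"
      using that by (simp add: norm_vector_scalar_mult_complex)
    have "integrable lborel (\<lambda>x. phase_integrand g z A dA (z + x))"
      using phase_integrand_integrable[OF F0 g B(1) c] by (simp add: lborel_integral_translate(1))
    moreover have "det (\<chi> i l. dA i l x) = of_real (M ^ CARD('n))" for x
      by (subst det_diagonal) (auto simp: dA_def)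
    then have e: "phase_integrand g z A dA (z + x) = of_real (M ^ CARD('n)) * ((g (z + x) * exp (0 + bil (- vcnj (G z)) (z + x - z))) * of_real (exp (- M * (norm x)\<^sup>2)))" for x
      unfolding phase_integrand_def Aexp E bil_neg by (simp add: mult_ac)
    ultimately have int: "integrable lborel (\<lambda>x. of_real (M ^ CARD('n)) * ((g (z + x) * exp (0 + bil (- vcnj (G z)) (z + x - z))) * of_real (exp (- M * (norm x)\<^sup>2))))"
      by simp
    show "integrable lborel (\<lambda>x. (g (z + x) * exp (0 + bil (- vcnj (G z)) (z + x - z))) * of_real (exp (- M * (norm x)\<^sup>2)))"
    proof -
      have "(\<lambda>x. inverse (of_real (M ^ CARD('n))) * (of_real (M ^ CARD('n)) * F x)) = F" for F :: "complex^'n \<Rightarrow> complex"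
        using M_pos by (auto simp: fun_eq_iff)
      then show ?thesis
        using integrable_mult_right[OF int, where c="inverse (of_real (M ^ CARD('n)))"]
        by metis
    qed
  qed
  finally show ?thesis by (simp add: gauss_mass_def bil_linear mult_ac)
qed

definition gauss_const :: real where
  "gauss_const = exp ((M + m) / 2) * (fact CARD('n) * (1 + M) ^ CARD('n)) / gauss_mass"

text \<open>In the phase integral the pole \<open>z\<close> enters only through the factors \<open>z\<^sub>i - u\<^sub>i\<close> in the exponent, so
  the kernel is entire in it, and \<open>moll_exponent\<close> is exactly Gaussian decay relative to
  \<open>exp (\<phi> w - \<phi> u)\<close>.\<close>
theorem gaussian_reproducing_kernel:
  obtains Q :: "complex ^ 'n \<Rightarrow> complex ^ 'n \<Rightarrow> complex" where
    "\<And>u. entire (\<lambda>w. Q w u)"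
    "continuous_on UNIV (\<lambda>p. Q (fst p) (snd p))"
    "\<And>w u. cmod (Q w u) * exp (\<phi> u - \<phi> w) \<le> gauss_const * exp (- (m/4) * (norm (w - u))\<^sup>2)"
    "\<And>g B0 z. entire g \<Longrightarrow> (\<And>x. cmod (g x) \<le> B0 * exp (\<phi> x)) \<Longrightarrow> g z = (LINT u|lborel. Q z u * g u)"
proof
  let ?Q = "\<lambda>w u. exp (\<Sum>i\<in>UNIV. moll G i u * (w $ i - u $ i)) * det (\<chi> i l. dmoll G i l u) / of_real gauss_mass"
  fix u
  have "exp (\<Sum>i\<in>UNIV. moll G i u * (w $ i - u $ i)) = exp (0 + bil (\<chi> i. moll G i u) (w - u))" for w
    by (simp add: bil_def)
  then show "entire (\<lambda>w. ?Q w u)"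
    using entire_const_mult[OF entire_exp_bil, of "det (\<chi> i l. dmoll G i l u) / of_real gauss_mass" 0 "\<chi> i. moll G i u" u]
    by (simp add: mult.commute)
next
  let ?Q = "\<lambda>w u. exp (\<Sum>i\<in>UNIV. moll G i u * (w $ i - u $ i)) * det (\<chi> i l. dmoll G i l u) / of_real gauss_mass"
  have "continuous_on UNIV (moll G i)" "continuous_on UNIV (dmoll G i l)" for i l
    using has_dbar_continuous[OF has_dbar_moll] by auto
  note c = continuous_on_compose2[OF this(1)] continuous_on_compose2[OF this(2)]
  show "continuous_on UNIV (\<lambda>p. ?Q (fst p) (snd p))"
    by (intro continuous_intros c) (use gauss_mass_pos in auto)
  fix w u
  have "cmod (?Q w u) * exp (\<phi> u - \<phi> w) = exp (Re (\<Sum>i\<in>UNIV. moll G i u * (w $ i - u $ i)) + (\<phi> u - \<phi> w)) * cmod (det (\<chi> i l. dmoll G i l u)) / gauss_mass"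
    using gauss_mass_pos by (simp add: norm_mult norm_divide exp_add)
  also have "\<dots> \<le> exp ((M + m) / 2 - m / 4 * (norm (w - u))\<^sup>2) * (fact CARD('n) * (1 + M) ^ CARD('n)) / gauss_mass"
  proof (intro divide_right_mono mult_mono det_bound)
    show "exp (Re (\<Sum>i\<in>UNIV. moll G i u * (w $ i - u $ i)) + (\<phi> u - \<phi> w)) \<le> exp ((M + m) / 2 - m / 4 * (norm (w - u))\<^sup>2)"
      using moll_exponent[of u w] by (simp add: norm_minus_commute)
    show "cmod (dmoll G i l u) \<le> 1 + M" for i l using dmoll_bound[of i l u] by simp
  qed (use M_pos gauss_mass_pos in auto)
  finally have b: "cmod (?Q w u) * exp (\<phi> u - \<phi> w) \<le> exp ((M + m) / 2 - m / 4 * (norm (w - u))\<^sup>2) * (fact CARD('n) * (1 + M) ^ CARD('n)) / gauss_mass" .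
  show "cmod (?Q w u) * exp (\<phi> u - \<phi> w) \<le> gauss_const * exp (- (m/4) * (norm (w - u))\<^sup>2)"
  proof -
    have "exp ((M + m) / 2 - m / 4 * (norm (w - u))\<^sup>2) = exp ((M + m) / 2) * exp (- (m/4) * (norm (w - u))\<^sup>2)"
      by (simp add: mult_exp_exp)
    then have "exp ((M + m) / 2 - m / 4 * (norm (w - u))\<^sup>2) * (fact CARD('n) * (1 + M) ^ CARD('n)) / gauss_mass
        = gauss_const * exp (- (m/4) * (norm (w - u))\<^sup>2)"
      by (simp only: gauss_const_def times_divide_eq_left times_divide_eq_right mult_ac)
    with b show ?thesis by simp
  qed
next
  let ?Q = "\<lambda>w u. exp (\<Sum>i\<in>UNIV. moll G i u * (w $ i - u $ i)) * det (\<chi> i l. dmoll G i l u) / of_real gauss_mass"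
  fix g B0 z assume g: "entire g" "\<And>x. cmod (g x) \<le> B0 * exp (\<phi> x)"
  have "(LINT u|lborel. ?Q z u * g u) = (LINT u|lborel. phase_integrand g z (moll G) (dmoll G) u / of_real gauss_mass)"
    unfolding phase_integrand_def by (simp add: mult_ac)
  also have "\<dots> = g z" using reproducing_phase[OF g] gauss_mass_pos by simp
  finally show "g z = (LINT u|lborel. ?Q z u * g u)" by simp
qed

end

section \<open>Decay of functions reproduced by a Gaussian kernel\<close>

lemma exp_abs_integrable_real:
  assumes "0 < a" shows "integrable lborel (\<lambda>t::real. exp (- a * \<bar>t\<bar>))"
proof (rule Bochner_Integration.integrable_bound)
  have 1: "integrable lborel (exponential_density a)"
  proof -
    interpret prob_space "density lborel (exponential_density a)"
      by (rule prob_space_exponential_density[OF assms])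
    have "(\<integral>\<^sup>+x. ennreal (exponential_density a x) \<partial>lborel) = 1"
      using emeasure_space_1 by (simp add: emeasure_density)
    then show ?thesis
      by (intro integrableI_nonneg) (auto simp: exponential_density_def assms intro!: AE_I2 less_imp_le)
  qed
  have 2: "integrable lborel (\<lambda>t. exponential_density a (0 - t))"
    using 1 by (simp only: lborel_integral_reflect(1))
  show "integrable lborel (\<lambda>t. (1/a) * (exponential_density a t + exponential_density a (0 - t)))"
    using 1 2 by (intro integrable_mult_right Bochner_Integration.integrable_add)
  show "AE t in lborel. norm (exp (- a * \<bar>t\<bar>)) \<le> norm ((1/a) * (exponential_density a t + exponential_density a (0 - t)))"
    using assms by (intro AE_I2) (auto simp: exponential_density_def abs_if mult.commute)
qed simp

lemma exp_norm_integrable: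
  assumes "0 < a"
  shows "integrable lborel (\<lambda>x::'a::euclidean_space. exp (- a * norm x))"
proof (rule integrableI_bounded)
  let ?N = "real (DIM('a))"
  define b where "b = a / ?N"
  have b: "0 < b" using assms by (simp add: b_def)
  have le: "exp (- a * norm x) \<le> (\<Prod>i\<in>Basis. exp (- b * \<bar>x \<bullet> i\<bar>))" for x :: 'a
  proof -
    have "(\<Sum>i\<in>Basis. \<bar>x \<bullet> i\<bar>) \<le> ?N * norm x"
      using sum_bounded_above[of Basis "\<lambda>i. \<bar>x \<bullet> i\<bar>" "norm x"] by (simp add: Basis_le_norm)
    then have "b * (\<Sum>i\<in>Basis. \<bar>x \<bullet> i\<bar>) \<le> b * (?N * norm x)" using b by (intro mult_left_mono) auto
    then have "- a * norm x \<le> (\<Sum>i\<in>Basis. - b * \<bar>x \<bullet> i\<bar>)"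
      by (simp add: b_def sum_negf sum_distrib_left)
    then show ?thesis by (simp add: exp_sum[symmetric])
  qed
  have fin: "(\<integral>\<^sup>+t. ennreal (exp (- b * \<bar>t\<bar>)) \<partial>lborel) < \<infinity>"
    using exp_abs_integrable_real[OF b] by (simp add: integrable_iff_bounded)
  have "nn_integral lborel (\<lambda>x::'a. ennreal (norm (exp (- a * norm x))))
      \<le> nn_integral lborel (\<lambda>x::'a. (\<Prod>i\<in>Basis. ennreal (exp (- b * \<bar>x \<bullet> i\<bar>))))"
    using le by (intro nn_integral_mono) (auto simp: prod_ennreal intro!: ennreal_leI)
  also have "\<dots> = (\<Prod>i\<in>(Basis::'a set). (\<integral>\<^sup>+t. ennreal (exp (- b * \<bar>t\<bar>)) \<partial>lborel))"
    by (rule nn_integral_lborel_prod) auto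
  also have "\<dots> < \<infinity>" using fin by (simp add: ennreal_prod_eq_top less_top power_less_top_ennreal)
  finally show "nn_integral lborel (\<lambda>x::'a. ennreal (norm (exp (- a * norm x)))) < \<infinity>" .
qed auto

lemma radial_kernel_integrable:
  fixes f :: "'a::euclidean_space \<Rightarrow> real" and k :: "real \<Rightarrow> real"
  assumes k: "integrable lborel (\<lambda>x::'a. k (norm x))" and f: "integrable lborel f"
  shows "integrable (lborel \<Otimes>\<^sub>M lborel) (\<lambda>(w, u). k (norm (w - u)) * f w)"
    and "integrable (lborel \<Otimes>\<^sub>M lborel) (\<lambda>(w, u). k (norm (w - u)) * f u)"
    and "(LINT p|(lborel \<Otimes>\<^sub>M lborel). (case p of (w, u) \<Rightarrow> k (norm (w - u)) * f w)) = (LINT x|lborel. k (norm (x::'a))) * (LINT x|lborel. f x)"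
    and "(LINT p|(lborel \<Otimes>\<^sub>M lborel). (case p of (w, u) \<Rightarrow> k (norm (w - u)) * f u)) = (LINT x|lborel. k (norm (x::'a))) * (LINT x|lborel. f x)"
proof -
  have [measurable]: "f \<in> borel_measurable borel" "(\<lambda>x::'a. k (norm x)) \<in> borel_measurable borel"
    using f k by auto
  have [measurable]: "(\<lambda>p. k (norm (fst p - snd p))) \<in> borel_measurable (borel \<Otimes>\<^sub>M (borel :: 'a measure))"
    by (rule measurable_compose[of "\<lambda>p. fst p - snd p" _ borel "\<lambda>x. k (norm x)"]) measurable
  have inner: "integrable lborel (\<lambda>u. k (norm (w - u)))" "(LINT u|lborel. k (norm (w - u))) = (LINT x|lborel. k (norm (x::'a)))" for w :: 'a
    using k lborel_integral_reflect[of "\<lambda>x. k (norm x)" w] by auto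
  have inner': "(LINT u|lborel. \<bar>k (norm (w - u))\<bar>) = (LINT x|lborel. \<bar>k (norm (x::'a))\<bar>)" for w :: 'a
    using lborel_integral_reflect(2)[of "\<lambda>x. \<bar>k (norm x)\<bar>" w] by auto
  show 1: "integrable (lborel \<Otimes>\<^sub>M lborel) (\<lambda>(w, u). k (norm (w - u)) * f w)"
  proof (rule lborel_pair.Fubini_integrable)
    show "(\<lambda>(w, u). k (norm (w - u)) * f w) \<in> borel_measurable (lborel \<Otimes>\<^sub>M lborel)"
      unfolding case_prod_beta by measurable
    show "integrable lborel (\<lambda>w. LINT u|lborel. norm (case (w, u) of (w, u) \<Rightarrow> k (norm (w - u)) * f w))"
      using f by (simp add: abs_mult inner')
    show "AE w in lborel. integrable lborel (\<lambda>u. case (w, u) of (w, u) \<Rightarrow> k (norm (w - u)) * f w)"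
      using inner by auto
  qed
  show 3: "(LINT p|(lborel \<Otimes>\<^sub>M lborel). (case p of (w, u) \<Rightarrow> k (norm (w - u)) * f w)) = (LINT x|lborel. k (norm (x::'a))) * (LINT x|lborel. f x)"
    using lborel_pair.integral_fst[OF 1] by (simp add: inner)
  have sw: "(\<lambda>(x, y). (case (y, x) of (w, u) \<Rightarrow> k (norm (w - u)) * f w)) = (\<lambda>(w, u). k (norm (w - u)) * f u)"
    by (auto simp: fun_eq_iff norm_minus_commute)
  show 2: "integrable (lborel \<Otimes>\<^sub>M lborel) (\<lambda>(w, u). k (norm (w - u)) * f u)"
    using lborel_pair.integrable_product_swap[OF 1] unfolding sw by simp
  show "(LINT p|(lborel \<Otimes>\<^sub>M lborel). (case p of (w, u) \<Rightarrow> k (norm (w - u)) * f u)) = (LINT x|lborel. k (norm (x::'a))) * (LINT x|lborel. f x)"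
  proof -
    have "(LINT w|lborel. k (norm (w - u))) = (LINT x|lborel. k (norm (x::'a)))" for u :: 'a
      using inner(2)[of u] by (simp add: norm_minus_commute)
    then show ?thesis using lborel_pair.integral_snd[OF 2] by simp
  qed
qed

text \<open>Let \<open>E\<close> be the left-hand side. Inserting \<open>rep\<close> for one factor \<open>\<kappa>\<close> writes \<open>E\<close> as a double integral with
  the weight \<open>W(w)\<^sup>2\<close>. Replacing this weight by \<open>W(u)\<^sup>2\<close> changes the integral by at most \<open>E/4\<close>: the
  difference is bounded by \<open>W(w) W(u)\<close> times \<open>O(e |w - u| exp |w - u|)\<close>, which the Gaussian in \<open>q\<close>
  absorbs, and \<open>e\<close> is small. After the replacement \<open>dual\<close> evaluates the integral over \<open>w\<close>, and the
  result is at most \<open>E/4\<close> plus half of the right-hand side. Since \<open>W\<close> is bounded, \<open>E\<close> is finite and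
  can be absorbed; the bound of \<open>W\<close> does not enter the conclusion, which allows truncated
  exponentials with arbitrarily distant truncation.\<close>
lemma agmon_estimate:
  fixes q :: "'a::euclidean_space \<Rightarrow> 'a \<Rightarrow> complex" and \<kappa> :: "'a \<Rightarrow> complex" and W :: "'a \<Rightarrow> real"
  assumes qm: "(\<lambda>p. q (fst p) (snd p)) \<in> borel_measurable (borel \<Otimes>\<^sub>M borel)"
    and qb: "\<And>w u. cmod (q w u) \<le> C * exp (- c * (norm (w - u))\<^sup>2)" and C: "0 < C" and c: "0 < c"
    and \<kappa>m: "\<kappa> \<in> borel_measurable borel" and \<kappa>i: "integrable lborel (\<lambda>x. (cmod (\<kappa> x))\<^sup>2)"
    and rep: "\<And>w. \<kappa> w = (LINT u|lborel. q w u * \<kappa> u)"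
    and dual: "\<And>u. of_real A * q z u = (LINT w|lborel. q w u * cnj (\<kappa> w))"
    and Wm: "W \<in> borel_measurable borel" and W0: "\<And>x. 0 < W x" and Wb: "\<And>x. W x \<le> Wmax"
    and Wl: "\<And>x y. W x \<le> exp (e * norm (x - y)) * W y" and Wz: "W z = 1" and e: "0 < e" "e \<le> 1"
    and small: "e * (LINT x|lborel. 2 * C * (norm (x::'a) * exp (norm x - c * (norm x)\<^sup>2))) \<le> 1/4"
  shows "(LINT x|lborel. (W x * cmod (\<kappa> x))\<^sup>2) \<le> 2 * (A\<^sup>2 * (LINT x|lborel. C\<^sup>2 * exp (2 * norm (x::'a) - 2 * c * (norm x)\<^sup>2)))"
proof -
  note [measurable] = \<kappa>m Wm
  have [measurable]: "cnj \<in> borel_measurable borel"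
    by (intro borel_measurable_continuous_onI continuous_intros)
  have qm'[measurable]: "(\<lambda>p. q (fst p) (snd p)) \<in> borel_measurable (lborel \<Otimes>\<^sub>M lborel)"
    using qm by measurable
  define a where "a = (\<lambda>x. W x * cmod (\<kappa> x))"
  define E where "E = (LINT x|lborel. (a x)\<^sup>2)"
  have Wmax: "0 < Wmax" using W0[of z] Wb[of z] by linarith
  have WW: "(W x)\<^sup>2 \<le> Wmax\<^sup>2" for x using W0[of x] Wb[of x] by (intro power_mono) (auto simp: less_imp_le)
  have ai: "integrable lborel (\<lambda>x. (a x)\<^sup>2)"
  proof (rule Bochner_Integration.integrable_bound)
    show "integrable lborel (\<lambda>x. Wmax\<^sup>2 * (cmod (\<kappa> x))\<^sup>2)" using \<kappa>i by simp
    show "AE x in lborel. norm ((a x)\<^sup>2) \<le> norm (Wmax\<^sup>2 * (cmod (\<kappa> x))\<^sup>2)"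
      using WW by (intro AE_I2) (auto simp: a_def power_mult_distrib intro!: mult_right_mono)
  qed (simp add: a_def)
  define T where "T = (\<lambda>w u. q w u * \<kappa> u * cnj (\<kappa> w))"
  have Tm[measurable]: "(\<lambda>p. T (fst p) (snd p)) \<in> borel_measurable (lborel \<Otimes>\<^sub>M lborel)"
    unfolding T_def by measurable
  have ki: "integrable lborel (\<lambda>x::'a. C * exp (- c * (norm x)\<^sup>2))"
    by (intro integrable_mult_right gaussian_integrable c)
  have nT: "cmod (T w u) \<le> C * exp (- c * (norm (w - u))\<^sup>2) * (cmod (\<kappa> w))\<^sup>2 + C * exp (- c * (norm (w - u))\<^sup>2) * (cmod (\<kappa> u))\<^sup>2" for w u
  proof -
    have "cmod (T w u) = cmod (q w u) * (cmod (\<kappa> u) * cmod (\<kappa> w))" by (simp add: T_def norm_mult mult_ac)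
    also have "\<dots> \<le> (C * exp (- c * (norm (w - u))\<^sup>2)) * ((cmod (\<kappa> w))\<^sup>2 + (cmod (\<kappa> u))\<^sup>2)"
      using qb[of w u] C sum_squares_bound[of "cmod (\<kappa> w)" "cmod (\<kappa> u)"]
      by (intro mult_mono) (auto simp: mult_ac intro: order_trans[rotated] mult_nonneg_nonneg)
    finally show ?thesis by (simp add: distrib_left)
  qed
  have domi: "integrable (lborel \<Otimes>\<^sub>M lborel) (\<lambda>p. Wmax\<^sup>2 * ((case p of (w, u) \<Rightarrow> C * exp (- c * (norm (w - u))\<^sup>2) * (cmod (\<kappa> w))\<^sup>2)
      + (case p of (w, u) \<Rightarrow> C * exp (- c * (norm (w - u))\<^sup>2) * (cmod (\<kappa> u))\<^sup>2)))"
    by (intro integrable_mult_right Bochner_Integration.integrable_add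
        radial_kernel_integrable(1,2)[of "\<lambda>r. C * exp (- c * r\<^sup>2)"] ki \<kappa>i)
  have Ti: "integrable (lborel \<Otimes>\<^sub>M lborel) (\<lambda>p. of_real (V (fst p) (snd p)) * T (fst p) (snd p))"
    if [measurable]: "(\<lambda>p. V (fst p) (snd p)) \<in> borel_measurable (lborel \<Otimes>\<^sub>M (lborel :: 'a measure))"
      and V: "\<And>w u. \<bar>V w u\<bar> \<le> Wmax\<^sup>2" for V :: "'a \<Rightarrow> 'a \<Rightarrow> real"
  proof (rule Bochner_Integration.integrable_bound[OF domi])
    show "(\<lambda>p. of_real (V (fst p) (snd p)) * T (fst p) (snd p)) \<in> borel_measurable (lborel \<Otimes>\<^sub>M lborel)" by measurable
    have *: "cmod (of_real (V w u) * T w u) \<le> Wmax\<^sup>2 * (C * exp (- c * (norm (w - u))\<^sup>2) * (cmod (\<kappa> w))\<^sup>2 + C * exp (- c * (norm (w - u))\<^sup>2) * (cmod (\<kappa> u))\<^sup>2)" for w u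
      unfolding norm_mult using nT[of w u] V[of w u] by (intro mult_mono) auto
    show "AE p in lborel \<Otimes>\<^sub>M lborel. cmod (of_real (V (fst p) (snd p)) * T (fst p) (snd p)) \<le> norm (Wmax\<^sup>2 * ((case p of (w, u) \<Rightarrow> C * exp (- c * (norm (w - u))\<^sup>2) * (cmod (\<kappa> w))\<^sup>2)
      + (case p of (w, u) \<Rightarrow> C * exp (- c * (norm (w - u))\<^sup>2) * (cmod (\<kappa> u))\<^sup>2)))"
      using order_trans[OF * abs_ge_self] by (intro AE_I2) (simp only: case_prod_beta real_norm_def)
  qed
  define T1 where "T1 = (\<lambda>w u. of_real ((W w)\<^sup>2) * T w u)"
  define T2 where "T2 = (\<lambda>w u. of_real ((W u)\<^sup>2) * T w u)"
  have i1: "integrable (lborel \<Otimes>\<^sub>M lborel) (\<lambda>(w, u). T1 w u)"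
    unfolding T1_def case_prod_beta by (rule Ti[of "\<lambda>w u. (W w)\<^sup>2"]) (use WW in \<open>simp_all\<close>)
  have i2: "integrable (lborel \<Otimes>\<^sub>M lborel) (\<lambda>(w, u). T2 w u)"
    unfolding T2_def case_prod_beta by (rule Ti[of "\<lambda>w u. (W u)\<^sup>2"]) (use WW in \<open>simp_all\<close>)
  have E1: "of_real E = (LINT p|(lborel \<Otimes>\<^sub>M lborel). (case p of (w, u) \<Rightarrow> T1 w u))"
  proof -
    have "(LINT u|lborel. T1 w u) = of_real ((a w)\<^sup>2)" for w
    proof -
      have "(LINT u|lborel. T1 w u) = (LINT u|lborel. (of_real ((W w)\<^sup>2) * cnj (\<kappa> w)) * (q w u * \<kappa> u))"
        unfolding T1_def T_def by (simp add: mult_ac)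
      also have "\<dots> = of_real ((W w)\<^sup>2) * cnj (\<kappa> w) * \<kappa> w" by (simp add: rep[symmetric])
      also have "\<dots> = of_real ((W w)\<^sup>2) * (\<kappa> w * cnj (\<kappa> w))" by (simp add: mult_ac)
      also have "\<dots> = of_real ((a w)\<^sup>2)"
        unfolding complex_norm_square[symmetric] a_def by (simp add: power_mult_distrib)
      finally show ?thesis .
    qed
    then have "(LINT w|lborel. LINT u|lborel. T1 w u) = (LINT w|lborel. of_real ((a w)\<^sup>2))" by simp
    also have "\<dots> = of_real E" unfolding E_def by (rule integral_complex_of_real)
    finally show ?thesis using lborel_pair.integral_fst[OF i1] by simp
  qed
  define R where "R = (LINT u|lborel. of_real ((W u)\<^sup>2) * \<kappa> u * (of_real A * q z u))"
  have R2: "R = (LINT p|(lborel \<Otimes>\<^sub>M lborel). (case p of (w, u) \<Rightarrow> T2 w u))"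
  proof -
    have "(LINT w|lborel. T2 w u) = of_real ((W u)\<^sup>2) * \<kappa> u * (of_real A * q z u)" for u
    proof -
      have "(LINT w|lborel. T2 w u) = (LINT w|lborel. (of_real ((W u)\<^sup>2) * \<kappa> u) * (q w u * cnj (\<kappa> w)))"
        unfolding T2_def T_def by (simp add: mult_ac)
      also have "\<dots> = of_real ((W u)\<^sup>2) * \<kappa> u * (of_real A * q z u)" by (simp add: dual[symmetric])
      finally show ?thesis .
    qed
    then have "R = (LINT u|lborel. LINT w|lborel. T2 w u)" unfolding R_def by simp
    also have "\<dots> = (LINT p|(lborel \<Otimes>\<^sub>M lborel). (case p of (w, u) \<Rightarrow> T2 w u))"
      by (rule lborel_pair.integral_snd[OF i2])
    finally show ?thesis .
  qed
  define h where "h = (\<lambda>r::real. 2 * C * (r * exp (r - c * r\<^sup>2)))"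
  have hi: "integrable lborel (\<lambda>x::'a. h (norm x))"
  proof (rule Bochner_Integration.integrable_bound)
    show "integrable lborel (\<lambda>x::'a. 2 * C * exp (2 * norm x - c * (norm x)\<^sup>2))"
      by (intro integrable_mult_right exp_gaussian_integrable c)
    have "norm x * exp (norm x - c * (norm x)\<^sup>2) \<le> exp (2 * norm x - c * (norm x)\<^sup>2)" for x :: 'a
    proof -
      have "norm x * exp (norm x - c * (norm x)\<^sup>2) \<le> exp (norm x) * exp (norm x - c * (norm x)\<^sup>2)"
        using exp_ge_add_one_self[of "norm x"] by (intro mult_right_mono) (linarith, simp)
      then show ?thesis by (simp add: mult_exp_exp)
    qed
    then show "AE x::'a in lborel. norm (h (norm x)) \<le> norm (2 * C * exp (2 * norm x - c * (norm x)\<^sup>2))"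
      using C by (intro AE_I2) (simp add: h_def abs_mult)
  qed (simp add: h_def)
  have diff: "cmod (T1 w u - T2 w u) \<le> e/2 * (h (norm (w - u)) * (a w)\<^sup>2 + h (norm (w - u)) * (a u)\<^sup>2)" for w u
  proof -
    let ?r = "norm (w - u)"
    \<comment> \<open>Both \<open>W(w) / W(u)\<close> and its inverse are at most \<open>exp (e |w - u|)\<close>.\<close>
    have w1: "(W w)\<^sup>2 - (W u)\<^sup>2 \<le> W w * W u * (2 * e * norm (w - u) * exp (norm (w - u)))" for w u
    proof -
      let ?r = "norm (w - u)"
      have "W u \<le> exp (e * ?r) * W w" using Wl[of u w] by (simp add: norm_minus_commute)
      then have 2: "exp (- (e * ?r)) * W u \<le> W w"
        by (simp add: exp_minus field_simps)
      have "(W w)\<^sup>2 - (W u)\<^sup>2 \<le> W w * (exp (e * ?r) * W u) - W u * (exp (- (e * ?r)) * W w)"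
      proof -
        have "W w * W w \<le> W w * (exp (e * ?r) * W u)" using Wl[of w u] W0[of w] by (intro mult_left_mono) auto
        moreover have "exp (- (e * ?r)) * W w \<le> W u"
          using Wl[of w u] by (simp add: exp_minus field_simps)
        then have "W u * (exp (- (e * ?r)) * W w) \<le> W u * W u" using W0[of u] by (intro mult_left_mono) auto
        ultimately show ?thesis by (simp add: power2_eq_square)
      qed
      also have "\<dots> = W w * W u * (exp (e * ?r) - exp (- (e * ?r)))" by (simp add: algebra_simps)
      also have "\<dots> \<le> W w * W u * (2 * e * ?r * exp ?r)"
      proof (intro mult_left_mono)
        have "1 - 2 * (e * ?r) \<le> exp (- (2 * (e * ?r)))" using exp_ge_add_one_self[of "- (2 * (e * ?r))"] by simp
        then have "exp (e * ?r) * (1 - 2 * (e * ?r)) \<le> exp (e * ?r) * exp (- (2 * (e * ?r)))" by (intro mult_left_mono) auto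
        then have "exp (e * ?r) - exp (- (e * ?r)) \<le> 2 * (e * ?r) * exp (e * ?r)"
          by (simp add: mult_exp_exp algebra_simps)
        also have "\<dots> \<le> 2 * (e * ?r) * exp ?r" using e by (intro mult_left_mono) (auto intro: mult_left_le_one_le)
        finally show "exp (e * ?r) - exp (- (e * ?r)) \<le> 2 * e * ?r * exp ?r" by (simp add: mult_ac)
      qed (use W0 in \<open>auto intro: less_imp_le\<close>)
      finally show ?thesis .
    qed
    have "\<bar>(W w)\<^sup>2 - (W u)\<^sup>2\<bar> \<le> W w * W u * (2 * e * ?r * exp ?r)"
      using w1[of w u] w1[of u w] by (simp add: norm_minus_commute mult.commute abs_le_iff)
    then have "cmod (T1 w u - T2 w u) \<le> (W w * W u * (2 * e * ?r * exp ?r)) * ((C * exp (- c * ?r\<^sup>2)) * (cmod (\<kappa> u) * cmod (\<kappa> w)))"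
    proof -
      assume b: "\<bar>(W w)\<^sup>2 - (W u)\<^sup>2\<bar> \<le> W w * W u * (2 * e * ?r * exp ?r)"
      have "T1 w u - T2 w u = of_real ((W w)\<^sup>2 - (W u)\<^sup>2) * (q w u * (\<kappa> u * cnj (\<kappa> w)))"
        by (simp add: T1_def T2_def T_def algebra_simps)
      then have "cmod (T1 w u - T2 w u) = \<bar>(W w)\<^sup>2 - (W u)\<^sup>2\<bar> * (cmod (q w u) * (cmod (\<kappa> u) * cmod (\<kappa> w)))"
        by (simp only: norm_mult norm_of_real complex_mod_cnj)
      also have "\<dots> \<le> (W w * W u * (2 * e * ?r * exp ?r)) * ((C * exp (- c * ?r\<^sup>2)) * (cmod (\<kappa> u) * cmod (\<kappa> w)))"
        using b qb[of w u] C W0[of w] W0[of u] e by (intro mult_mono b) auto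
      finally show ?thesis .
    qed
    also have "\<dots> = e * h ?r * (a w * a u)"
      by (simp add: h_def a_def exp_diff exp_minus divide_inverse)
    also have "\<dots> \<le> e * h ?r * (((a w)\<^sup>2 + (a u)\<^sup>2) / 2)"
      using e C sum_squares_bound[of "a w" "a u"] by (intro mult_left_mono) (auto simp: h_def)
    finally show ?thesis by (simp add: algebra_simps add_divide_distrib)
  qed
  have ER: "cmod (of_real E - R) \<le> E / 4"
  proof -
    have "of_real E - R = (LINT p|(lborel \<Otimes>\<^sub>M lborel). (case p of (w, u) \<Rightarrow> T1 w u) - (case p of (w, u) \<Rightarrow> T2 w u))"
      unfolding E1 R2 by (rule Bochner_Integration.integral_diff[OF i1 i2, symmetric])
    also have "cmod \<dots> \<le> (LINT p|(lborel \<Otimes>\<^sub>M lborel). norm ((case p of (w, u) \<Rightarrow> T1 w u) - (case p of (w, u) \<Rightarrow> T2 w u)))"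
      by (rule integral_norm_bound)
    also have "\<dots> \<le> (LINT p|(lborel \<Otimes>\<^sub>M lborel). e/2 * ((case p of (w, u) \<Rightarrow> h (norm (w - u)) * (a w)\<^sup>2) + (case p of (w, u) \<Rightarrow> h (norm (w - u)) * (a u)\<^sup>2)))"
    proof (rule integral_mono)
      show "integrable (lborel \<Otimes>\<^sub>M lborel) (\<lambda>p. norm ((case p of (w, u) \<Rightarrow> T1 w u) - (case p of (w, u) \<Rightarrow> T2 w u)))"
        by (intro integrable_norm Bochner_Integration.integrable_diff i1 i2)
      show "integrable (lborel \<Otimes>\<^sub>M lborel) (\<lambda>p. e/2 * ((case p of (w, u) \<Rightarrow> h (norm (w - u)) * (a w)\<^sup>2) + (case p of (w, u) \<Rightarrow> h (norm (w - u)) * (a u)\<^sup>2)))"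
        by (intro integrable_mult_right Bochner_Integration.integrable_add radial_kernel_integrable(1,2)[OF hi ai])
      fix p :: "'a \<times> 'a"
      show "norm ((case p of (w, u) \<Rightarrow> T1 w u) - (case p of (w, u) \<Rightarrow> T2 w u))
        \<le> e/2 * ((case p of (w, u) \<Rightarrow> h (norm (w - u)) * (a w)\<^sup>2) + (case p of (w, u) \<Rightarrow> h (norm (w - u)) * (a u)\<^sup>2))"
        using diff[of "fst p" "snd p"] by (simp only: case_prod_beta)
    qed
    also have "\<dots> = e/2 * ((LINT x|lborel. h (norm (x::'a))) * E + (LINT x|lborel. h (norm (x::'a))) * E)"
      using radial_kernel_integrable[OF hi ai] by (simp add: E_def)
    also have "\<dots> = (e * (LINT x|lborel. h (norm (x::'a)))) * E" by simp
    also have "\<dots> \<le> 1/4 * E"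
      using small by (intro mult_right_mono) (auto simp: h_def E_def)
    finally show ?thesis by simp
  qed
  define D where "D = (LINT x|lborel. C\<^sup>2 * exp (2 * norm (x::'a) - 2 * c * (norm x)\<^sup>2))"
  have Rb: "cmod R \<le> E / 4 + A\<^sup>2 * D"
  proof -
    have iD: "integrable lborel (\<lambda>x::'a. C\<^sup>2 * exp (2 * norm x - 2 * c * (norm x)\<^sup>2))"
      using c by (intro integrable_mult_right exp_gaussian_integrable) simp
    have iDz: "integrable lborel (\<lambda>u. A\<^sup>2 * (C\<^sup>2 * exp (2 * norm (z - u) - 2 * c * (norm (z - u))\<^sup>2)))"
      by (rule integrable_mult_right[OF iffD2[OF lborel_integral_reflect(1)[of "\<lambda>x. C\<^sup>2 * exp (2 * norm x - 2 * c * (norm x)\<^sup>2)" z] iD]])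
    have Dz: "(LINT u|lborel. C\<^sup>2 * exp (2 * norm (z - u) - 2 * c * (norm (z - u))\<^sup>2)) = D"
      unfolding D_def by (rule lborel_integral_reflect(2))
    have p: "norm (of_real ((W u)\<^sup>2) * \<kappa> u * (of_real A * q z u)) \<le> (a u)\<^sup>2 / 4 + A\<^sup>2 * (C\<^sup>2 * exp (2 * norm (z - u) - 2 * c * (norm (z - u))\<^sup>2))" for u
    proof -
      let ?r = "norm (z - u)"
      let ?y = "\<bar>A\<bar> * (W u * cmod (q z u))"
      have "norm (of_real ((W u)\<^sup>2) * \<kappa> u * (of_real A * q z u)) = a u * ?y"
        using W0[of u] by (simp add: norm_mult a_def power2_eq_square)
      also have "\<dots> \<le> (a u)\<^sup>2 / 4 + ?y\<^sup>2"
        using zero_le_power2[of "a u / 2 - ?y"] by (simp add: power2_diff power_divide)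
      also have "?y\<^sup>2 \<le> (\<bar>A\<bar> * (exp ?r * (C * exp (- c * ?r\<^sup>2))))\<^sup>2"
      proof (intro power_mono mult_left_mono mult_mono qb)
        have "W u \<le> exp (e * ?r)" using Wl[of u z] Wz by (simp add: norm_minus_commute)
        also have "\<dots> \<le> exp ?r" using e by (auto intro: mult_left_le_one_le)
        finally show "W u \<le> exp ?r" .
      qed (use W0[of u] in auto)
      also have "\<dots> = A\<^sup>2 * (C\<^sup>2 * (exp ?r * exp (- c * ?r\<^sup>2))\<^sup>2)" by (simp add: power_mult_distrib)
      also have "(exp ?r * exp (- c * ?r\<^sup>2))\<^sup>2 = exp (2 * ?r - 2 * c * ?r\<^sup>2)"
        by (simp add: mult_exp_exp power2_eq_square)
      finally show ?thesis by simp
    qed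
    have "cmod R \<le> (LINT u|lborel. norm (of_real ((W u)\<^sup>2) * \<kappa> u * (of_real A * q z u)))"
      unfolding R_def by (rule integral_norm_bound)
    also have "\<dots> \<le> (LINT u|lborel. (a u)\<^sup>2 / 4 + A\<^sup>2 * (C\<^sup>2 * exp (2 * norm (z - u) - 2 * c * (norm (z - u))\<^sup>2)))"
    proof (rule integral_mono)
      have dom: "integrable lborel (\<lambda>u. (a u)\<^sup>2 / 4 + A\<^sup>2 * (C\<^sup>2 * exp (2 * norm (z - u) - 2 * c * (norm (z - u))\<^sup>2)))"
        using ai iDz by (intro Bochner_Integration.integrable_add) auto
      then show "integrable lborel (\<lambda>u. (a u)\<^sup>2 / 4 + A\<^sup>2 * (C\<^sup>2 * exp (2 * norm (z - u) - 2 * c * (norm (z - u))\<^sup>2)))" .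
      have [measurable]: "q z \<in> borel_measurable borel"
        using measurable_compose[OF measurable_Pair1'[of z borel borel] qm] by simp
      show "integrable lborel (\<lambda>u. norm (of_real ((W u)\<^sup>2) * \<kappa> u * (of_real A * q z u)))"
        by (rule Bochner_Integration.integrable_bound[OF dom])
           (use order_trans[OF p abs_ge_self] in \<open>simp_all\<close>)
    qed (rule p)
    also have "\<dots> = E / 4 + A\<^sup>2 * D"
      using ai iDz Dz by (simp add: E_def)
    finally show ?thesis .
  qed
  have "E = cmod (of_real E)" by (simp add: E_def)
  also have "\<dots> \<le> cmod R + cmod (of_real E - R)" by (metis add.commute diff_add_cancel norm_triangle_ineq)
  also have "\<dots> \<le> E / 4 + A\<^sup>2 * D + E / 4" using Rb ER by simp
  finally show ?thesis by (simp add: E_def D_def a_def)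
qed

section \<open>Estimates for the reproducing kernel\<close>

lemma integrable_lebesgue_iff:
  fixes f :: "'a::euclidean_space \<Rightarrow> 'b::{banach, second_countable_topology}"
  assumes "f \<in> borel_measurable borel"
  shows "integrable lebesgue f \<longleftrightarrow> integrable lborel f" "integral\<^sup>L lebesgue f = integral\<^sup>L lborel f"
  using assms by (auto simp: integrable_completion integral_completion)

lemma Fock_iff:
  assumes cont: "continuous_on UNIV \<phi>"
  shows "g \<in> Fock \<phi> s \<longleftrightarrow> entire g \<and> integrable lborel (\<lambda>z. (cmod (g z) * exp (- \<phi> z)) powr s)"
proof -
  have "g \<in> borel_measurable lebesgue \<and> (integrable lebesgue (\<lambda>z. (cmod (g z) * exp (- \<phi> z)) powr s) \<longleftrightarrow>
      integrable lborel (\<lambda>z. (cmod (g z) * exp (- \<phi> z)) powr s))" if g: "entire g"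
  proof -
    have [measurable]: "g \<in> borel_measurable borel" "\<phi> \<in> borel_measurable borel"
      using entire_measurable[OF g] cont by (auto intro: borel_measurable_continuous_onI)
    have "g \<in> borel_measurable lborel" by simp
    then have "g \<in> borel_measurable lebesgue" by (rule measurable_completion)
    moreover have "(\<lambda>z. (cmod (g z) * exp (- \<phi> z)) powr s) \<in> borel_measurable borel" by measurable
    ultimately show ?thesis by (simp add: integrable_lebesgue_iff)
  qed
  then show ?thesis unfolding Fock_def Lphi_def by auto
qed

lemma Fock_norm:
  assumes cont: "continuous_on UNIV \<phi>" and g: "entire g"
  shows "Lphi_norm \<phi> s g = (LINT z|lborel. (cmod (g z) * exp (- \<phi> z)) powr s) powr (1 / s)"
proof -
  have [measurable]: "g \<in> borel_measurable borel" "\<phi> \<in> borel_measurable borel"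
    using entire_measurable[OF g] cont by (auto intro: borel_measurable_continuous_onI)
  have "(\<lambda>z. (cmod (g z) * exp (- \<phi> z)) powr s) \<in> borel_measurable borel" by measurable
  then show ?thesis unfolding Lphi_norm_def by (simp add: integrable_lebesgue_iff)
qed

text \<open>Small enough for the smallness condition of \<open>agmon_estimate\<close> with the decay \<open>m/4\<close> of the Gaussian
  kernel; the summand \<open>4\<close> keeps the rate at most \<open>1\<close>.\<close>
definition decay_rate :: "'n::finite itself \<Rightarrow> real \<Rightarrow> real \<Rightarrow> real" where
  "decay_rate T m M = 1 / (4 * (LINT x|lborel. 2 * gauss_const T m M * (norm (x :: complex ^ 'n) * exp (norm x - m/4 * (norm x)\<^sup>2))) + 4)"

text \<open>The first term comes from \<open>agmon_estimate\<close>, the second from the inverse of the exponential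
  weight in \<open>kernel_L1\<close>.\<close>
definition kernel_const :: "'n::finite itself \<Rightarrow> real \<Rightarrow> real \<Rightarrow> real" where
  "kernel_const T m M = (LINT x|lborel. (gauss_const T m M)\<^sup>2 * exp (2 * norm (x :: complex ^ 'n) - 2 * (m/4) * (norm x)\<^sup>2))
     + (LINT x|lborel. exp (- (2 * decay_rate T m M) * norm (x :: complex ^ 'n))) / 2"

definition peak_const :: "'n::finite itself \<Rightarrow> real \<Rightarrow> real" where
  "peak_const T m = (LINT x|lborel. exp (- m * (norm (x :: complex ^ 'n))\<^sup>2))"

context
  fixes m M :: real and \<phi> :: "complex ^ 'n::finite \<Rightarrow> real" and G and K :: "complex ^ 'n \<Rightarrow> complex ^ 'n \<Rightarrow> complex"
  assumes qw: "quadratic_weight m M \<phi> G" and rk: "reproducing_kernel \<phi> K"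
begin

lemma weight_continuous: "continuous_on UNIV \<phi>" and lower_pos: "0 < m" and upper_pos: "0 < M"
  using qw by (auto simp: quadratic_weight_def)

lemma phi_measurable [measurable]: "\<phi> \<in> borel_measurable borel"
  using weight_continuous by (rule borel_measurable_continuous_onI)

lemma gauss_const_pos: "0 < gauss_const TYPE('n) m M"
  using gauss_mass_pos[OF qw] upper_pos by (simp add: gauss_const_def[OF qw])

lemma decay_rate: "0 < decay_rate TYPE('n) m M" "decay_rate TYPE('n) m M \<le> 1"
  "decay_rate TYPE('n) m M * (LINT x|lborel. 2 * gauss_const TYPE('n) m M * (norm (x :: complex ^ 'n) * exp (norm x - m/4 * (norm x)\<^sup>2))) \<le> 1/4"
proof -
  let ?S = "LINT x|lborel. 2 * gauss_const TYPE('n) m M * (norm (x :: complex ^ 'n) * exp (norm x - m/4 * (norm x)\<^sup>2))"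
  have "0 \<le> ?S" using gauss_const_pos by (intro integral_nonneg_AE AE_I2) auto
  then show "0 < decay_rate TYPE('n) m M" "decay_rate TYPE('n) m M \<le> 1" "decay_rate TYPE('n) m M * ?S \<le> 1/4"
    unfolding decay_rate_def by (auto simp: field_simps)
qed

lemma kernel_const_nonneg: "0 \<le> kernel_const TYPE('n) m M"
  unfolding kernel_const_def by (intro add_nonneg_nonneg divide_nonneg_nonneg integral_nonneg_AE AE_I2) auto

lemma peak_const_pos: "0 < peak_const TYPE('n) m"
  unfolding peak_const_def by (rule gaussian_integral_pos[OF lower_pos])

lemma kernel_entire: "entire (\<lambda>w. K w z)"
  using rk unfolding reproducing_kernel_def Fock_def by auto

lemma kernel_measurable [measurable]: "(\<lambda>w. K w z) \<in> borel_measurable borel"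
  by (rule entire_measurable[OF kernel_entire])

lemma kernel_square_integrable: "integrable lborel (\<lambda>w. (cmod (K w z) * exp (- \<phi> w))\<^sup>2)"
proof -
  have "(\<lambda>w. K w z) \<in> Fock \<phi> 2" using rk by (simp add: reproducing_kernel_def)
  then have "integrable lborel (\<lambda>w. (cmod (K w z) * exp (- \<phi> w)) powr 2)" by (simp add: Fock_iff[OF weight_continuous])
  then show ?thesis by (simp add: powr_numeral)
qed

lemma kernel_reproducing:
  assumes g: "entire g" and i: "integrable lborel (\<lambda>w. (cmod (g w) * exp (- \<phi> w))\<^sup>2)"
  shows "g z = (LINT w|lborel. g w * cnj (K w z) * of_real (exp (- 2 * \<phi> w)))"
proof -
  have [measurable]: "cnj \<in> borel_measurable borel"
    by (intro borel_measurable_continuous_onI continuous_intros)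
  have [measurable]: "g \<in> borel_measurable borel" by (rule entire_measurable[OF g])
  have "g \<in> Fock \<phi> 2" using g i by (simp add: Fock_iff[OF weight_continuous] powr_numeral)
  then have "g z = (LINT w|lebesgue. g w * cnj (K w z) * of_real (exp (- 2 * \<phi> w)))"
    using rk unfolding reproducing_kernel_def by blast
  also have "\<dots> = (LINT w|lborel. g w * cnj (K w z) * of_real (exp (- 2 * \<phi> w)))"
    by (rule integrable_lebesgue_iff(2)) measurable
  finally show ?thesis .
qed

lemma kernel_hermitian: "K w z = cnj (K z w)"
proof -
  have "K z w = (LINT u|lborel. K u w * cnj (K u z) * of_real (exp (- 2 * \<phi> u)))"
    by (rule kernel_reproducing[OF kernel_entire kernel_square_integrable])
  from arg_cong[OF this, of cnj]
  have "cnj (K z w) = (LINT u|lborel. cnj (K u w * cnj (K u z) * of_real (exp (- 2 * \<phi> u))))"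
    unfolding Bochner_Integration.integral_cnj .
  also have "\<dots> = (LINT u|lborel. K u z * cnj (K u w) * of_real (exp (- 2 * \<phi> u)))"
    by (simp add: mult_ac)
  also have "\<dots> = K w z"
    by (rule kernel_reproducing[OF kernel_entire kernel_square_integrable, symmetric])
  finally show ?thesis by simp
qed

text \<open>The squared norm of the kernel function, which is \<open>K z z\<close> as a real number.\<close>
definition kernel_diag :: "complex ^ 'n \<Rightarrow> real" where
  "kernel_diag z = (LINT w|lborel. (cmod (K w z) * exp (- \<phi> w))\<^sup>2)"

lemma kernel_diag: "K z z = of_real (kernel_diag z)"
proof -
  have "K z z = (LINT w|lborel. K w z * cnj (K w z) * of_real (exp (- 2 * \<phi> w)))"
    by (rule kernel_reproducing[OF kernel_entire kernel_square_integrable])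
  also have "\<dots> = (LINT w|lborel. of_real ((cmod (K w z) * exp (- \<phi> w))\<^sup>2))"
    by (rule Bochner_Integration.integral_cong)
       (simp_all only: complex_norm_square[symmetric] power_mult_distrib of_real_mult of_real_power exp_double[symmetric] mult_minus_right mult_minus_left)
  also have "\<dots> = of_real (kernel_diag z)" unfolding kernel_diag_def by (rule integral_complex_of_real)
  finally show ?thesis .
qed

lemma kernel_diag_nonneg: "0 \<le> kernel_diag z"
  unfolding kernel_diag_def by (intro integral_nonneg_AE AE_I2) auto

text \<open>The entire function \<open>h\<close>, whose modulus is the exponential of the tangent of \<open>\<phi>\<close> at \<open>z\<close>, satisfies
  \<open>|h| exp (- \<phi>) \<le> exp (- m/2 |w - z|\<^sup>2)\<close> by strict convexity and \<open>|h z| = exp (\<phi> z)\<close>. The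
  reproducing formula and the Cauchy-Schwarz inequality compare this value with the norm of the
  kernel function.\<close>
lemma kernel_diag_lower: "exp (2 * \<phi> z) / peak_const TYPE('n) m \<le> kernel_diag z"
proof -
  let ?c = "peak_const TYPE('n) m"
  let ?k = "kernel_diag z"
  have c: "0 < ?c" by (rule peak_const_pos)
  define h where "h = (\<lambda>w. exp (of_real (\<phi> z) + bil (vcnj (G z)) (w - z)))"
  have h: "entire h" unfolding h_def by (rule entire_exp_bil)
  have [measurable]: "h \<in> borel_measurable borel" by (rule entire_measurable[OF h])
  define b where "b = (\<lambda>w. cmod (h w) * exp (- \<phi> w))"
  have hb: "(b w)\<^sup>2 \<le> exp (- m * (norm (- z + w))\<^sup>2)" for w
  proof -
    have "b w = exp (\<phi> z + G z \<bullet> (w - z) - \<phi> w)"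
      by (simp add: b_def h_def Re_bil_vcnj exp_add[symmetric] add_diff_eq mult_exp_exp)
    also have "\<dots> \<le> exp (- (m/2) * (norm (w - z))\<^sup>2)"
      using qw unfolding quadratic_weight_def by (smt (verit) exp_le_cancel_iff mult_minus_left)
    finally have "(b w)\<^sup>2 \<le> (exp (- (m/2) * (norm (w - z))\<^sup>2))\<^sup>2"
      by (intro power_mono) (auto simp: b_def)
    then show ?thesis by (simp add: exp_double[symmetric])
  qed
  have gi: "integrable lborel (\<lambda>w. exp (- m * (norm (- z + w))\<^sup>2))"
    by (rule iffD2[OF lborel_integral_translate(1) gaussian_integrable[OF lower_pos]])
  have bi: "integrable lborel (\<lambda>w. (b w)\<^sup>2)"
  proof (rule Bochner_Integration.integrable_bound[OF gi])
    show "AE w in lborel. norm ((b w)\<^sup>2) \<le> norm (exp (- m * (norm (- z + w))\<^sup>2))"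
      using hb by (intro AE_I2) simp
  qed (simp add: b_def)
  have bI: "(LINT w|lborel. (b w)\<^sup>2) \<le> ?c"
  proof -
    have "(LINT w|lborel. (b w)\<^sup>2) \<le> (LINT w|lborel. exp (- m * (norm (- z + w))\<^sup>2))"
      by (rule integral_mono[OF bi gi hb])
    also have "\<dots> = ?c" unfolding peak_const_def by (rule lborel_integral_translate(2))
    finally show ?thesis .
  qed
  define a where "a = (\<lambda>w. cmod (K w z) * exp (- \<phi> w))"
  have ai: "integrable lborel (\<lambda>w. (a w)\<^sup>2)" unfolding a_def by (rule kernel_square_integrable)
  \<comment> \<open>With this weight in \<open>2 a b \<le> l b\<^sup>2 + a\<^sup>2 / l\<close> the first term contributes half of \<open>exp (\<phi> z)\<close>.\<close>
  define l where "l = exp (\<phi> z) / ?c"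
  have l: "0 < l" using c by (simp add: l_def)
  have "h z = (LINT w|lborel. h w * cnj (K w z) * of_real (exp (- 2 * \<phi> w)))"
    by (rule kernel_reproducing[OF h bi[unfolded b_def]])
  moreover have "cmod (h z) = exp (\<phi> z)" by (simp add: h_def bil_linear)
  ultimately have "exp (\<phi> z) = norm (LINT w|lborel. h w * cnj (K w z) * of_real (exp (- 2 * \<phi> w)))"
    by (simp only:)
  also have "\<dots> \<le> (LINT w|lborel. norm (h w * cnj (K w z) * of_real (exp (- 2 * \<phi> w))))"
    by (rule integral_norm_bound)
  also have "\<dots> = (LINT w|lborel. b w * a w)"
  proof (rule Bochner_Integration.integral_cong)
    fix w
    have "exp (- 2 * \<phi> w) = exp (- \<phi> w) * exp (- \<phi> w)" by (simp add: mult_exp_exp)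
    then show "norm (h w * cnj (K w z) * of_real (exp (- 2 * \<phi> w))) = b w * a w"
      by (simp add: a_def b_def norm_mult)
  qed simp
  also have "\<dots> \<le> (LINT w|lborel. (l * (b w)\<^sup>2 + (1/l) * (a w)\<^sup>2) / 2)"
  proof (rule integral_mono')
    show "integrable lborel (\<lambda>w. (l * (b w)\<^sup>2 + (1/l) * (a w)\<^sup>2) / 2)" using ai bi by simp
    fix w
    have "0 \<le> (l * b w - a w)\<^sup>2 / l" using l by simp
    then show "b w * a w \<le> (l * (b w)\<^sup>2 + (1/l) * (a w)\<^sup>2) / 2"
      using l by (simp add: power2_eq_square field_simps)
    show "0 \<le> (l * (b w)\<^sup>2 + (1/l) * (a w)\<^sup>2) / 2" using l by simp
  qed
  also have "\<dots> = (l * (LINT w|lborel. (b w)\<^sup>2) + (1/l) * ?k) / 2"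
    using ai bi by (simp add: kernel_diag_def a_def)
  also have "\<dots> \<le> (l * ?c + (1/l) * ?k) / 2"
    using bI l by (intro divide_right_mono add_right_mono mult_left_mono) auto
  also have "l * ?c = exp (\<phi> z)" using c by (simp add: l_def)
  finally have "exp (\<phi> z) \<le> (1/l) * ?k" by simp
  then have "exp (\<phi> z) * l \<le> ?k" using l by (simp add: field_simps)
  then show ?thesis by (simp add: l_def exp_double power2_eq_square)
qed

lemma kernel_diag_pos: "0 < kernel_diag z"
  using kernel_diag_lower[of z] peak_const_pos by (smt (verit) divide_pos_pos exp_gt_zero)

lemma Fock_pointwise_bound:
  assumes g: "entire g" and s: "1 \<le> s" and i: "integrable lborel (\<lambda>w. (cmod (g w) * exp (- \<phi> w)) powr s)"
  shows "(cmod (g z) * exp (- \<phi> z)) powr s \<le> mean_const M s TYPE(complex^'n) * (LINT w|lborel. (cmod (g w) * exp (- \<phi> w)) powr s)"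
proof -
  have "(cmod (g z) * exp (- \<phi> z)) powr s
    \<le> mean_const M s TYPE(complex^'n) *
      (LINT x|lborel. indicator (ball z 1) x * (cmod (g x) * exp (- \<phi> x)) powr s)"
    by (rule flat_mean_value_powr[OF qw g s])
  also have "\<dots> \<le> mean_const M s TYPE(complex^'n) * (LINT w|lborel. (cmod (g w) * exp (- \<phi> w)) powr s)"
  proof (rule mult_left_mono)
    show "(LINT x|lborel. indicator (ball z 1) x * (cmod (g x) * exp (- \<phi> x)) powr s) \<le> (LINT w|lborel. (cmod (g w) * exp (- \<phi> w)) powr s)"
      by (rule integral_mono') (use i in \<open>auto simp: indicator_def\<close>)
    show "0 \<le> mean_const M s TYPE(complex^'n)"
      using ball_volume_pos[where 'a="complex^'n"] by (simp add: mean_const_def)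
  qed
  finally show ?thesis .
qed

lemma kernel_pointwise_bound: "\<exists>B. \<forall>w. cmod (K w z) \<le> B * exp (\<phi> w)"
proof -
  define N where "N = mean_const M 2 TYPE(complex^'n) * (LINT w|lborel. (cmod (K w z) * exp (- \<phi> w)) powr 2)"
  have i: "integrable lborel (\<lambda>w. (cmod (K w z) * exp (- \<phi> w)) powr 2)"
    using kernel_square_integrable[of z] by (simp add: powr_numeral)
  have "cmod (K w z) \<le> sqrt N * exp (\<phi> w)" for w
  proof -
    have "(cmod (K w z) * exp (- \<phi> w)) powr 2 \<le> N"
      unfolding N_def by (rule Fock_pointwise_bound[OF kernel_entire _ i]) simp
    then have "cmod (K w z) * exp (- \<phi> w) \<le> sqrt N"
      by (intro real_le_rsqrt) (simp add: powr_numeral)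
    then show ?thesis by (simp add: exp_minus field_simps)
  qed
  then show ?thesis by blast
qed

text \<open>Applies \<open>agmon_estimate\<close> to \<open>K(w,z) exp (- \<phi> w)\<close> and to the Gaussian kernel conjugated by \<open>exp \<phi>\<close>;
  the hypothesis \<open>dual\<close> is the reproducing property of \<open>K\<close> for the entire functions \<open>Q(_,u)\<close>. The
  truncation at \<open>R\<close> makes the weight bounded, and the estimate is uniform in \<open>R\<close>.\<close>
lemma kernel_weighted_square:
  fixes R :: real and z :: "complex ^ 'n"
  assumes R: "0 \<le> R"
  defines "W \<equiv> \<lambda>x. exp (decay_rate TYPE('n) m M * min (norm (x - z)) R)"
  shows "(LINT w|lborel. (W w * (cmod (K w z) * exp (- \<phi> w)))\<^sup>2)
    \<le> 2 * ((exp (\<phi> z))\<^sup>2 * (LINT x|lborel. (gauss_const TYPE('n) m M)\<^sup>2 * exp (2 * norm (x :: complex ^ 'n) - 2 * (m/4) * (norm x)\<^sup>2)))"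
proof -
  obtain Q where Qe: "\<And>u. entire (\<lambda>w. Q w u)" and Qc: "continuous_on UNIV (\<lambda>p. Q (fst p) (snd p))"
    and Qb: "\<And>w u. cmod (Q w u) * exp (\<phi> u - \<phi> w) \<le> gauss_const TYPE('n) m M * exp (- (m/4) * (norm (w - u))\<^sup>2)"
    and Qr: "\<And>g B0 z. entire g \<Longrightarrow> (\<And>x. cmod (g x) \<le> B0 * exp (\<phi> x)) \<Longrightarrow> g z = (LINT u|lborel. Q z u * g u)"
    using gaussian_reproducing_kernel[OF qw] by blast
  define q where "q = (\<lambda>w u. Q w u * of_real (exp (\<phi> u - \<phi> w)))"
  define \<kappa> where "\<kappa> = (\<lambda>w. K w z * of_real (exp (- \<phi> w)))"
  have nk: "cmod (\<kappa> w) = cmod (K w z) * exp (- \<phi> w)" for w by (simp add: \<kappa>_def norm_mult)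
  have nq: "cmod (q w u) \<le> gauss_const TYPE('n) m M * exp (- (m/4) * (norm (w - u))\<^sup>2)" for w u
    using Qb[of w u] by (simp add: q_def norm_mult)
  have "(LINT x|lborel. (W x * cmod (\<kappa> x))\<^sup>2) \<le> 2 * ((exp (\<phi> z))\<^sup>2 * (LINT x|lborel. (gauss_const TYPE('n) m M)\<^sup>2 * exp (2 * norm (x :: complex ^ 'n) - 2 * (m/4) * (norm x)\<^sup>2)))"
  proof (rule agmon_estimate[where q=q and z=z and Wmax="exp (decay_rate TYPE('n) m M * R)" and e="decay_rate TYPE('n) m M"])
    have [measurable]: "(\<lambda>p. Q (fst p) (snd p)) \<in> borel_measurable (borel \<Otimes>\<^sub>M borel)"
      unfolding borel_prod by (rule borel_measurable_continuous_onI[OF Qc])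
    show "(\<lambda>p. q (fst p) (snd p)) \<in> borel_measurable (borel \<Otimes>\<^sub>M borel)"
      unfolding q_def by measurable
    show "cmod (q w u) \<le> gauss_const TYPE('n) m M * exp (- (m/4) * (norm (w - u))\<^sup>2)" for w u by (rule nq)
    show "\<kappa> \<in> borel_measurable borel" unfolding \<kappa>_def by measurable
    show "integrable lborel (\<lambda>x. (cmod (\<kappa> x))\<^sup>2)" unfolding nk by (rule kernel_square_integrable)
    show "\<kappa> w = (LINT u|lborel. q w u * \<kappa> u)" for w
    proof -
      obtain B where B: "\<And>w. cmod (K w z) \<le> B * exp (\<phi> w)" using kernel_pointwise_bound by blast
      have "K w z = (LINT u|lborel. Q w u * K u z)" by (rule Qr[OF kernel_entire B])
      then have "\<kappa> w = (LINT u|lborel. Q w u * K u z * of_real (exp (- \<phi> w)))" by (simp add: \<kappa>_def)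
      also have "\<dots> = (LINT u|lborel. q w u * \<kappa> u)"
      proof (rule Bochner_Integration.integral_cong)
        fix u
        have "exp (- \<phi> w) = exp (\<phi> u - \<phi> w) * exp (- \<phi> u)" by (simp add: mult_exp_exp)
        then show "Q w u * K u z * of_real (exp (- \<phi> w)) = q w u * \<kappa> u" by (simp add: q_def \<kappa>_def mult_ac)
      qed simp
      finally show ?thesis .
    qed
    show "of_real (exp (\<phi> z)) * q z u = (LINT w|lborel. q w u * cnj (\<kappa> w))" for u
    proof -
      have [measurable]: "(\<lambda>w. Q w u) \<in> borel_measurable borel" by (rule entire_measurable[OF Qe])
      have b: "cmod (Q w u) * exp (- \<phi> w) \<le> exp (- \<phi> u) * (gauss_const TYPE('n) m M * exp (- (m/4) * (norm (w - u))\<^sup>2))" for w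
      proof -
        have "cmod (Q w u) * exp (- \<phi> w) = exp (- \<phi> u) * (cmod (Q w u) * exp (\<phi> u - \<phi> w))"
          by (simp add: exp_diff exp_minus field_simps)
        also have "\<dots> \<le> exp (- \<phi> u) * (gauss_const TYPE('n) m M * exp (- (m/4) * (norm (w - u))\<^sup>2))"
          by (intro mult_left_mono Qb) simp
        finally show ?thesis .
      qed
      have "integrable lborel (\<lambda>w. (cmod (Q w u) * exp (- \<phi> w))\<^sup>2)"
      proof (rule Bochner_Integration.integrable_bound)
        have "integrable lborel (\<lambda>w. exp (- (m/2) * (norm (- u + w))\<^sup>2))"
          by (rule iffD2[OF lborel_integral_translate(1) gaussian_integrable]) (use lower_pos in simp)
        then show "integrable lborel (\<lambda>w. (exp (- \<phi> u) * gauss_const TYPE('n) m M)\<^sup>2 * exp (- (m/2) * (norm (- u + w))\<^sup>2))"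
          by (rule integrable_mult_right)
        have "(cmod (Q w u) * exp (- \<phi> w))\<^sup>2 \<le> (exp (- \<phi> u) * gauss_const TYPE('n) m M)\<^sup>2 * exp (- (m/2) * (norm (- u + w))\<^sup>2)" for w
        proof -
          have "(cmod (Q w u) * exp (- \<phi> w))\<^sup>2 \<le> (exp (- \<phi> u) * (gauss_const TYPE('n) m M * exp (- (m/4) * (norm (w - u))\<^sup>2)))\<^sup>2"
            by (intro power_mono b) simp
          also have "\<dots> = (exp (- \<phi> u) * gauss_const TYPE('n) m M)\<^sup>2 * (exp (- (m/4) * (norm (w - u))\<^sup>2))\<^sup>2"
            by (simp only: power_mult_distrib mult.assoc)
          also have "(exp (- (m/4) * (norm (w - u))\<^sup>2))\<^sup>2 = exp (- (m/2) * (norm (- u + w))\<^sup>2)"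
            by (simp add: exp_double[symmetric])
          finally show ?thesis .
        qed
        then show "AE w in lborel. norm ((cmod (Q w u) * exp (- \<phi> w))\<^sup>2) \<le> norm ((exp (- \<phi> u) * gauss_const TYPE('n) m M)\<^sup>2 * exp (- (m/2) * (norm (- u + w))\<^sup>2))"
          by (intro AE_I2) simp
      qed simp
      from kernel_reproducing[OF Qe this, of z]
      have "of_real (exp (\<phi> z)) * q z u = (LINT w|lborel. Q w u * cnj (K w z) * of_real (exp (- 2 * \<phi> w))) * of_real (exp (\<phi> z) * exp (\<phi> u - \<phi> z))"
        by (simp add: q_def)
      also have "exp (\<phi> z) * exp (\<phi> u - \<phi> z) = exp (\<phi> u)" by (simp add: mult_exp_exp)
      also have "(LINT w|lborel. Q w u * cnj (K w z) * of_real (exp (- 2 * \<phi> w))) * of_real (exp (\<phi> u))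
         = (LINT w|lborel. Q w u * cnj (K w z) * of_real (exp (- 2 * \<phi> w)) * of_real (exp (\<phi> u)))" by simp
      also have "\<dots> = (LINT w|lborel. q w u * cnj (\<kappa> w))"
      proof (rule Bochner_Integration.integral_cong)
        fix w
        have "exp (- 2 * \<phi> w) * exp (\<phi> u) = exp (\<phi> u - \<phi> w) * exp (- \<phi> w)" by (simp add: mult_exp_exp)
        then have "(of_real (exp (- 2 * \<phi> w)) * of_real (exp (\<phi> u)) :: complex) = of_real (exp (\<phi> u - \<phi> w)) * of_real (exp (- \<phi> w))"
          by (simp only: of_real_mult[symmetric])
        then show "Q w u * cnj (K w z) * of_real (exp (- 2 * \<phi> w)) * of_real (exp (\<phi> u)) = q w u * cnj (\<kappa> w)"
          by (simp add: q_def \<kappa>_def mult_ac)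
      qed simp
      finally show ?thesis .
    qed
    show "W \<in> borel_measurable borel" unfolding W_def by measurable
    show "0 < W x" for x by (simp add: W_def)
    show "W x \<le> exp (decay_rate TYPE('n) m M * R)" for x using decay_rate(1) by (simp add: W_def)
    show "W x \<le> exp (decay_rate TYPE('n) m M * norm (x - y)) * W y" for x y
    proof -
      have "norm (x - z) \<le> norm (x - y) + norm (y - z)" using norm_triangle_ineq[of "x - y" "y - z"] by simp
      then have "min (norm (x - z)) R \<le> norm (x - y) + min (norm (y - z)) R"
        using norm_ge_zero[of "x - y"] unfolding min_def by (smt (verit))
      then have "decay_rate TYPE('n) m M * min (norm (x - z)) R \<le> decay_rate TYPE('n) m M * (norm (x - y) + min (norm (y - z)) R)"
        using decay_rate(1) by (intro mult_left_mono) auto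
      then show ?thesis by (simp add: W_def mult_exp_exp distrib_left)
    qed
    show "W z = 1" using R by (simp add: W_def)
  qed (use decay_rate gauss_const_pos lower_pos in auto)
  then show ?thesis unfolding nk .
qed

text \<open>On the ball of radius \<open>j\<close> the weight truncated at \<open>j\<close> is the full exponential. There the integrand
  is at most a weighted square, controlled by \<open>kernel_weighted_square\<close>, plus an integrable
  exponential; then \<open>j\<close> tends to infinity.\<close>
theorem kernel_L1:
  shows "integrable lborel (\<lambda>w. cmod (K w z) * exp (- \<phi> w))"
    and "(LINT w|lborel. cmod (K w z) * exp (- \<phi> w)) \<le> kernel_const TYPE('n) m M * exp (\<phi> z)"
proof -
  let ?e = "decay_rate TYPE('n) m M"
  let ?D = "LINT x|lborel. (gauss_const TYPE('n) m M)\<^sup>2 * exp (2 * norm (x :: complex ^ 'n) - 2 * (m/4) * (norm x)\<^sup>2)"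
  let ?I = "LINT x|lborel. exp (- (2 * ?e) * norm (x :: complex ^ 'n))"
  let ?A = "exp (\<phi> z)"
  define a where "a = (\<lambda>w. cmod (K w z) * exp (- \<phi> w))"
  have [measurable]: "a \<in> borel_measurable borel" unfolding a_def by measurable
  have a0: "0 \<le> a w" for w by (simp add: a_def)
  define f where "f = (\<lambda>(j::nat) w. indicator (ball z (real j)) w * a w)"
  have ei: "integrable lborel (\<lambda>w. exp (- (2 * ?e) * norm (- z + w)))"
    by (rule iffD2[OF lborel_integral_translate(1) exp_norm_integrable]) (use decay_rate(1) in simp)
  have eI: "(LINT w|lborel. exp (- (2 * ?e) * norm (- z + w))) = ?I" by (rule lborel_integral_translate(2))
  have fj: "integrable lborel (f j) \<and> (LINT w|lborel. f j w) \<le> kernel_const TYPE('n) m M * ?A" for j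
  proof -
    \<comment> \<open>Up to distance \<open>j\<close> from \<open>z\<close> this is the untruncated exponential.\<close>
    define W where "W = (\<lambda>x. exp (?e * min (norm (x - z)) (real j)))"
    have [measurable]: "W \<in> borel_measurable borel" unfolding W_def by measurable
    have WE: "(LINT w|lborel. (W w * a w)\<^sup>2) \<le> 2 * (?A\<^sup>2 * ?D)"
      unfolding W_def a_def by (rule kernel_weighted_square) simp
    have Wi: "integrable lborel (\<lambda>w. (W w * a w)\<^sup>2)"
    proof (rule Bochner_Integration.integrable_bound)
      show "integrable lborel (\<lambda>w. (exp (?e * real j))\<^sup>2 * (a w)\<^sup>2)"
        using kernel_square_integrable[of z] by (simp add: a_def)
      have "W w \<le> exp (?e * real j)" for w using decay_rate(1) by (simp add: W_def)
      then have "(W w)\<^sup>2 \<le> (exp (?e * real j))\<^sup>2" for w by (intro power_mono) (auto simp: W_def)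
      then show "AE w in lborel. norm ((W w * a w)\<^sup>2) \<le> norm ((exp (?e * real j))\<^sup>2 * (a w)\<^sup>2)"
        by (intro AE_I2) (auto simp: power_mult_distrib intro!: mult_right_mono)
    qed simp
    define d where "d = (\<lambda>w. ((1 / ?A) * (W w * a w)\<^sup>2 + ?A * exp (- (2 * ?e) * norm (- z + w))) / 2)"
    have di: "integrable lborel d" unfolding d_def using Wi ei by (intro integrable_divide Bochner_Integration.integrable_add integrable_mult_right)
    have fd: "f j w \<le> d w" for w
    proof (cases "w \<in> ball z (real j)")
      case True
      then have Ww: "W w = exp (?e * norm (- z + w))" by (simp add: W_def dist_norm norm_minus_commute min_def)
      then have e2: "exp (- (2 * ?e) * norm (- z + w)) = 1 / (W w)\<^sup>2"
        by (simp add: exp_double[symmetric] exp_minus divide_inverse mult.assoc)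
      have "0 \<le> (W w * a w - ?A / W w)\<^sup>2 / ?A" by simp
      then have "a w \<le> ((1 / ?A) * (W w * a w)\<^sup>2 + ?A * (1 / (W w)\<^sup>2)) / 2"
        by (simp add: W_def power2_eq_square field_simps)
      then show ?thesis unfolding d_def e2 using True by (simp add: f_def)
    qed (simp add: f_def d_def)
    have f0: "0 \<le> f j w" for w using a0 by (simp add: f_def)
    have d0: "0 \<le> d w" for w using fd[of w] f0[of w] by linarith
    have "f j \<in> borel_measurable borel"
      unfolding f_def by (intro borel_measurable_times borel_measurable_indicator) auto
    then have fi: "integrable lborel (f j)"
      by (intro Bochner_Integration.integrable_bound[OF di]) (use fd f0 d0 in auto)
    have "(LINT w|lborel. f j w) \<le> (LINT w|lborel. d w)" by (rule integral_mono[OF fi di fd])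
    also have "\<dots> = ((1 / ?A) * (LINT w|lborel. (W w * a w)\<^sup>2) + ?A * ?I) / 2"
    proof -
      have "(LINT w|lborel. d w) = (LINT w|lborel. (1 / ?A) * (W w * a w)\<^sup>2 + ?A * exp (- (2 * ?e) * norm (- z + w))) / 2"
        unfolding d_def by simp
      also have "(LINT w|lborel. (1 / ?A) * (W w * a w)\<^sup>2 + ?A * exp (- (2 * ?e) * norm (- z + w)))
         = (LINT w|lborel. (1 / ?A) * (W w * a w)\<^sup>2) + (LINT w|lborel. ?A * exp (- (2 * ?e) * norm (- z + w)))"
        by (rule Bochner_Integration.integral_add) (intro integrable_mult_right Wi ei)+
      finally show ?thesis by (simp only: integral_mult_right_zero eI)
    qed
    also have "\<dots> \<le> ((1 / ?A) * (2 * (?A\<^sup>2 * ?D)) + ?A * ?I) / 2"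
      using WE by (intro divide_right_mono add_right_mono mult_left_mono) auto
    also have "\<dots> = kernel_const TYPE('n) m M * ?A"
      by (simp add: kernel_const_def power2_eq_square distrib_right add_divide_distrib)
    finally show ?thesis using fi by simp
  qed
  have mono: "mono (\<lambda>j. f j w)" for w
    by (rule monoI) (auto simp: f_def indicator_def a0)
  have lim: "(\<lambda>j. f j w) \<longlonglongrightarrow> a w" for w
  proof (rule tendsto_eventually)
    obtain N where "dist z w < real N" using reals_Archimedean2 by blast
    then have "\<forall>j\<ge>N. f j w = a w" by (auto simp: f_def indicator_def)
    then show "\<forall>\<^sub>F j in sequentially. f j w = a w" by (auto simp: eventually_sequentially)
  qed
  have imono: "incseq (\<lambda>j. LINT w|lborel. f j w)"
    using fj mono by (auto intro!: incseq_SucI integral_mono simp: mono_iff_le_Suc)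
  have bd: "\<And>j. (LINT w|lborel. f j w) \<le> kernel_const TYPE('n) m M * ?A" using fj by blast
  obtain L where L: "(\<lambda>j. LINT w|lborel. f j w) \<longlonglongrightarrow> L"
    by (rule incseq_convergent[OF imono, of "kernel_const TYPE('n) m M * ?A"]) (use bd in blast)+
  have Lb: "L \<le> kernel_const TYPE('n) m M * ?A" by (rule LIMSEQ_le_const2[OF L]) (use bd in auto)
  have "integrable lborel a" "integral\<^sup>L lborel a = L"
    by (rule integrable_monotone_convergence[where f=f and x=L] integral_monotone_convergence[where f=f and x=L];
        use fj mono lim L in auto)+
  then show "integrable lborel (\<lambda>w. cmod (K w z) * exp (- \<phi> w))"
    "(LINT w|lborel. cmod (K w z) * exp (- \<phi> w)) \<le> kernel_const TYPE('n) m M * exp (\<phi> z)"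
    using Lb by (auto simp: a_def)
qed

end

section \<open>Sampling and synthesis along a lattice\<close>

text \<open>Jensen's inequality for weights of total mass at most \<open>A\<close>. Terms with \<open>t i = 0\<close> are removed first,
  because \<open>powr_convex\<close> is about the open half-line.\<close>
lemma jensen_powr:
  fixes a t :: "'i \<Rightarrow> real"
  assumes fin: "finite S" and a: "\<And>i. i \<in> S \<Longrightarrow> 0 \<le> a i" and t: "\<And>i. i \<in> S \<Longrightarrow> 0 \<le> t i"
    and p: "1 \<le> p" and A: "(\<Sum>i\<in>S. a i) \<le> A"
  shows "(\<Sum>i\<in>S. a i * t i) powr p \<le> A powr (p - 1) * (\<Sum>i\<in>S. a i * t i powr p)"
proof -
  define S' where "S' = {i\<in>S. 0 < t i}"
  define s where "s = (\<Sum>i\<in>S'. a i)"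
  have fin': "finite S'" and sub: "S' \<subseteq> S" using fin by (auto simp: S'_def)
  have s0: "0 \<le> s" unfolding s_def using a sub by (intro sum_nonneg) auto
  have sA: "s \<le> A"
  proof -
    have "s \<le> (\<Sum>i\<in>S. a i)" unfolding s_def by (rule sum_mono2[OF fin sub]) (use a in auto)
    with A show ?thesis by simp
  qed
  have e1: "(\<Sum>i\<in>S. a i * t i) = (\<Sum>i\<in>S'. a i * t i)"
    by (rule sum.mono_neutral_right[OF fin sub]) (use t in \<open>force simp: S'_def\<close>)
  have e2: "(\<Sum>i\<in>S. a i * t i powr p) = (\<Sum>i\<in>S'. a i * t i powr p)"
    by (rule sum.mono_neutral_right[OF fin sub]) (use t in \<open>force simp: S'_def\<close>)
  have R0: "0 \<le> (\<Sum>i\<in>S'. a i * t i powr p)" using a sub by (intro sum_nonneg) auto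
  show ?thesis
  proof (cases "s = 0")
    case True
    then have "\<forall>i\<in>S'. a i = 0" unfolding s_def using sum_nonneg_eq_0_iff[OF fin'] a sub by auto
    then show ?thesis unfolding e1 e2 by simp
  next
    case False
    with s0 have s: "0 < s" by simp
    have "(\<lambda>x. x powr p) (\<Sum>i\<in>S'. (a i / s) *\<^sub>R t i) \<le> (\<Sum>i\<in>S'. a i / s * t i powr p)"
    proof (rule convex_on_sum[OF fin' _ powr_convex[OF p]])
      show "S' \<noteq> {}" using False by (auto simp: s_def)
      show "(\<Sum>i\<in>S'. a i / s) = 1" using False by (simp add: sum_divide_distrib[symmetric] s_def)
      show "0 \<le> a i / s" if "i \<in> S'" for i using a sub that s by auto
      show "t i \<in> {0<..}" if "i \<in> S'" for i using that by (auto simp: S'_def)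
    qed
    then have *: "((\<Sum>i\<in>S'. a i * t i) / s) powr p \<le> (\<Sum>i\<in>S'. a i * t i powr p) / s"
      by (simp add: sum_divide_distrib)
    have Q0: "0 \<le> (\<Sum>i\<in>S'. a i * t i)" using a t sub by (intro sum_nonneg) auto
    have "(\<Sum>i\<in>S'. a i * t i) powr p = s powr p * ((\<Sum>i\<in>S'. a i * t i) / s) powr p"
      using s Q0 by (simp add: powr_mult[symmetric])
    also have "\<dots> \<le> s powr p * ((\<Sum>i\<in>S'. a i * t i powr p) / s)"
      by (rule mult_left_mono[OF *]) simp
    also have "\<dots> = s powr (p - 1) * (\<Sum>i\<in>S'. a i * t i powr p)"
      using s by (simp add: powr_diff)
    also have "\<dots> \<le> A powr (p - 1) * (\<Sum>i\<in>S'. a i * t i powr p)"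
      using sA s p R0 by (intro mult_right_mono powr_mono2) auto
    finally show ?thesis unfolding e1 e2 .
  qed
qed

definition cell_center :: "'n::finite lattice \<Rightarrow> complex ^ 'n" where
  "cell_center j = (\<chi> i. Complex (of_int (fst (j $ i))) (of_int (snd (j $ i))))"

lemma cells_disjoint:
  assumes "z \<in> cell j" "z \<in> cell k" shows "j = k"
proof -
  have "a = b" if "x \<in> {real_of_int a - 1/2 ..< real_of_int a + 1/2}" "x \<in> {real_of_int b - 1/2 ..< real_of_int b + 1/2}" for x a b
    using that by auto
  then have "fst (j $ i) = fst (k $ i)" "snd (j $ i) = snd (k $ i)" for i
    using assms unfolding cell_def mem_Collect_eq by blast+
  then show ?thesis by (simp add: vec_eq_iff prod_eq_iff)
qed

lemma cell_center_ball: "ball (cell_center j) (1/2) \<subseteq> cell j"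
proof
  fix z assume "z \<in> ball (cell_center j) (1/2)"
  then have d: "norm (z - cell_center j) < 1/2" by (simp add: dist_norm norm_minus_commute)
  have c: "cmod ((z - cell_center j) $ i) < 1/2" for i
    using le_less_trans[OF Finite_Cartesian_Product.norm_nth_le d] .
  have "Re (z $ i) \<in> {real_of_int (fst (j $ i)) - 1/2 ..< real_of_int (fst (j $ i)) + 1/2} \<and>
     Im (z $ i) \<in> {real_of_int (snd (j $ i)) - 1/2 ..< real_of_int (snd (j $ i)) + 1/2}" for i
  proof -
    have "\<bar>Re ((z - cell_center j) $ i)\<bar> < 1/2" "\<bar>Im ((z - cell_center j) $ i)\<bar> < 1/2"
      by (rule le_less_trans[OF abs_Re_le_cmod c] le_less_trans[OF abs_Im_le_cmod c])+
    then have "\<bar>Re (z $ i) - of_int (fst (j $ i))\<bar> < 1/2" "\<bar>Im (z $ i) - of_int (snd (j $ i))\<bar> < 1/2"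
      by (simp_all add: cell_center_def)
    then show ?thesis unfolding atLeastLessThan_iff by linarith
  qed
  then show "z \<in> cell j" unfolding cell_def by blast
qed

lemma cell_diameter:
  fixes z :: "complex ^ 'n::finite"
  assumes "z \<in> cell j" shows "norm (z - cell_center j) \<le> real CARD('n)"
proof -
  have "norm (z - cell_center j) \<le> (\<Sum>i\<in>UNIV. cmod ((z - cell_center j) $ i))"
    unfolding norm_vec_def by (rule L2_set_le_sum) simp
  also have "\<dots> \<le> (\<Sum>i\<in>(UNIV::'n set). 1)"
  proof (rule sum_mono)
    fix i
    have "\<bar>Re (z $ i) - of_int (fst (j $ i))\<bar> \<le> 1/2" "\<bar>Im (z $ i) - of_int (snd (j $ i))\<bar> \<le> 1/2"
    proof -
      have "Re (z $ i) \<in> {real_of_int (fst (j $ i)) - 1/2 ..< real_of_int (fst (j $ i)) + 1/2} \<and>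
        Im (z $ i) \<in> {real_of_int (snd (j $ i)) - 1/2 ..< real_of_int (snd (j $ i)) + 1/2}"
        using assms unfolding cell_def by blast
      then show "\<bar>Re (z $ i) - of_int (fst (j $ i))\<bar> \<le> 1/2" "\<bar>Im (z $ i) - of_int (snd (j $ i))\<bar> \<le> 1/2"
        unfolding atLeastLessThan_iff by linarith+
    qed
    moreover have "cmod ((z - cell_center j) $ i) \<le> \<bar>Re (z $ i) - of_int (fst (j $ i))\<bar> + \<bar>Im (z $ i) - of_int (snd (j $ i))\<bar>"
      using cmod_le[of "(z - cell_center j) $ i"] by (simp add: cell_center_def)
    ultimately show "cmod ((z - cell_center j) $ i) \<le> 1" by linarith
  qed
  finally show ?thesis by simp
qed

definition overlap :: "'n::finite itself \<Rightarrow> real" where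
  "overlap _ = (2 * real (CARD('n) + 2)) ^ DIM(complex ^ 'n)"

text \<open>The balls of radius \<open>1/2\<close> around the centres of the cells are disjoint and lie in a fixed ball
  around \<open>w\<close>, so their number is at most the ratio of volumes.\<close>
lemma overlap_bound:
  fixes zs :: "'i \<Rightarrow> complex ^ 'n::finite"
  assumes fin: "finite J" and inj: "inj_on l J" and z: "\<And>j. j \<in> J \<Longrightarrow> zs j \<in> cell (l j)"
    and w: "\<And>j. j \<in> J \<Longrightarrow> dist (zs j) w < 1"
  shows "real (card J) \<le> overlap TYPE('n)"
proof -
  let ?B = "\<lambda>j. ball (cell_center (l j)) (1/2)"
  let ?R = "real (CARD('n) + 2)"
  let ?v = "ball_volume TYPE(complex ^ 'n)"
  have v: "0 < ?v" by (rule ball_volume_pos)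
  have "disjoint_family_on ?B J"
    unfolding disjoint_family_on_def
    using cell_center_ball cells_disjoint inj_onD[OF inj] by blast
  then have "measure lborel (\<Union>j\<in>J. ?B j) = (\<Sum>j\<in>J. measure lborel (?B j))"
    by (intro measure_finite_Union fin) (use emeasure_lborel_ball_finite in \<open>auto simp: less_top\<close>)
  also have "\<dots> = real (card J) * ((1/2) ^ DIM(complex ^ 'n) * ?v)"
    by (simp add: content_ball_conv_unit_ball[of "1/2"] ball_volume_def)
  finally have 1: "measure lborel (\<Union>j\<in>J. ?B j) = real (card J) * ((1/2) ^ DIM(complex ^ 'n) * ?v)" .
  have "(\<Union>j\<in>J. ?B j) \<subseteq> ball w ?R"
  proof (intro UN_least subsetI)
    fix j x assume j: "j \<in> J" and x: "x \<in> ?B j"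
    have "dist w x \<le> dist w (zs j) + dist (zs j) (cell_center (l j)) + dist (cell_center (l j)) x"
      using dist_triangle[of w "cell_center (l j)" "zs j"] dist_triangle[of w x "cell_center (l j)"] by linarith
    moreover have "dist (zs j) (cell_center (l j)) \<le> real CARD('n)"
      using cell_diameter[OF z[OF j]] by (simp add: dist_norm)
    ultimately show "x \<in> ball w ?R" using w[OF j] x by (simp add: dist_commute)
  qed
  then have "measure lborel (\<Union>j\<in>J. ?B j) \<le> measure lborel (ball w ?R)"
    using fin by (intro measure_mono_fmeasurable) (use emeasure_lborel_ball_finite in \<open>auto simp: fmeasurable_def\<close>)
  also have "\<dots> = ?R ^ DIM(complex ^ 'n) * ?v"
    by (subst content_ball_conv_unit_ball) (auto simp: ball_volume_def)
  finally have "real (card J) * (1/2) ^ DIM(complex ^ 'n) * ?v \<le> ?R ^ DIM(complex ^ 'n) * ?v"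
    unfolding 1 by (simp add: mult.assoc)
  then have "real (card J) * (1/2) ^ DIM(complex ^ 'n) \<le> ?R ^ DIM(complex ^ 'n)" using v by simp
  then show ?thesis unfolding overlap_def power_mult_distrib by (simp add: field_simps)
qed

text \<open>Cauchy's inequality bounds the derivative along the complex line through the two points.\<close>
lemma entire_line_Lipschitz:
  fixes g :: "complex ^ 'n::finite \<Rightarrow> complex"
  assumes g: "entire g" and b: "\<And>x. norm (x - w0) \<le> 2 \<Longrightarrow> cmod (g x) \<le> B" and w: "norm (w - w0) \<le> 1"
  shows "cmod (g w - g w0) \<le> B * norm (w - w0)"
proof (cases "w = w0")
  case True then show ?thesis by simp
next
  case False
  let ?r = "norm (w - w0)"
  have r: "0 < ?r" using False by simp
  define v where "v = of_real (1 / ?r) *s (w - w0)"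
  have nv: "norm v = 1" unfolding v_def norm_vector_scalar_mult_complex using False by (simp add: norm_divide)
  have wv: "w = w0 + of_real ?r *s v" using False by (simp add: v_def vec_eq_iff)
  let ?f = "\<lambda>t. g (w0 + t *s v)"
  have hol: "?f holomorphic_on S" for S by (rule entire_line_holomorphic[OF g])
  have d: "(?f has_field_derivative deriv ?f t) (at t)" for t
    using hol[of UNIV] by (simp add: holomorphic_derivI)
  have db: "cmod (deriv ?f t) \<le> B" if "t \<in> cball 0 1" for t
  proof -
    have "norm ((deriv ^^ 1) ?f t) \<le> fact 1 * B / 1 ^ 1"
    proof (rule Cauchy_inequality)
      fix x assume "norm (t - x) = 1"
      then have "norm x \<le> 2" using that norm_triangle_ineq4[of t "t - x"] by simp
      then show "norm (?f x) \<le> B" by (intro b) (simp add: norm_vector_scalar_mult_complex nv)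
    qed (use hol holomorphic_on_imp_continuous_on[OF hol] in auto)
    then show ?thesis by simp
  qed
  have "norm (?f (of_real ?r) - ?f 0) \<le> B * norm (of_real ?r - (0::complex))"
    by (rule field_differentiable_bound[of "cball 0 1" ?f "deriv ?f"])
       (use db d w in \<open>auto intro: has_field_derivative_at_within\<close>)
  then show ?thesis by (simp add: wv[symmetric])
qed

context
  fixes m M :: real and \<phi> :: "complex ^ 'n::finite \<Rightarrow> real" and G and K :: "complex ^ 'n \<Rightarrow> complex ^ 'n \<Rightarrow> complex"
  assumes qw: "quadratic_weight m M \<phi> G" and rk: "reproducing_kernel \<phi> K"
begin

lemmas weight_cont = weight_continuous[OF qw rk]
lemmas K_entire = kernel_entire[OF qw rk]

definition kroot :: "complex ^ 'n \<Rightarrow> real" where "kroot z = sqrt (kernel_diag \<phi> K z)"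

lemma kroot_pos: "0 < kroot z"
  using kernel_diag_pos[OF qw rk] by (simp add: kroot_def)

lemma kroot_lower: "exp (\<phi> z) \<le> sqrt (peak_const TYPE('n) m) * kroot z"
proof -
  have "exp (2 * \<phi> z) \<le> peak_const TYPE('n) m * kernel_diag \<phi> K z"
    using kernel_diag_lower[OF qw rk, of z] peak_const_pos[OF qw rk] by (simp add: field_simps)
  then have "(exp (\<phi> z))\<^sup>2 \<le> peak_const TYPE('n) m * kernel_diag \<phi> K z" by (simp add: exp_double)
  then show ?thesis unfolding kroot_def real_sqrt_mult[symmetric] by (rule real_le_rsqrt)
qed

lemma kroot_inverse: "1 / kroot z \<le> sqrt (peak_const TYPE('n) m) * exp (- \<phi> z)"
  using kroot_lower[of z] kroot_pos[of z] by (simp add: exp_minus field_simps)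

lemma normalized_kernel_eq: "normalized_kernel K z w = K w z / of_real (kroot z)"
  using kernel_diag_nonneg[OF qw rk, of z]
  by (simp add: normalized_kernel_def kernel_diag[OF qw rk] kroot_def csqrt_of_real_nonneg)

lemma mean_const_nonneg: "0 \<le> mean_const M s TYPE(complex ^ 'n)"
  using ball_volume_pos[where 'a="complex^'n"] by (simp add: mean_const_def)

text \<open>The sub-mean-value inequality at each \<open>zs j\<close>, together with the fact that the unit balls around
  these points overlap at most \<open>overlap\<close> times.\<close>
theorem sampling:
  fixes zs :: "nat \<Rightarrow> complex ^ 'n"
  assumes zs: "\<And>j. zs j \<in> cell (lattice_enum j)"
    and g: "entire g" and s: "1 \<le> s" and i: "integrable lborel (\<lambda>w. (cmod (g w) * exp (- \<phi> w)) powr s)"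
  shows "(\<Sum>j<N. (cmod (g (zs j)) * exp (- \<phi> (zs j))) powr s)
    \<le> mean_const M s TYPE(complex ^ 'n) * overlap TYPE('n) * (LINT w|lborel. (cmod (g w) * exp (- \<phi> w)) powr s)"
proof -
  let ?F = "\<lambda>w. (cmod (g w) * exp (- \<phi> w)) powr s"
  let ?m = "mean_const M s TYPE(complex ^ 'n)"
  have ii: "integrable lborel (\<lambda>w. indicator (ball (zs j) 1) w * ?F w)" for j
    by (rule Bochner_Integration.integrable_bound[OF i])
       (use i in \<open>auto simp: indicator_def intro!: borel_measurable_times\<close>)
  have ov: "(\<Sum>j<N. indicator (ball (zs j) 1) w) \<le> overlap TYPE('n)" for w
  proof -
    have "(\<Sum>j<N. indicator (ball (zs j) 1) w :: real) = real (card {j\<in>{..<N}. dist (zs j) w < 1})"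
      by (simp add: indicator_def sum.If_cases Int_def)
    also have "\<dots> \<le> overlap TYPE('n)"
      by (rule overlap_bound[where zs=zs and l="lattice_enum"])
         (use zs bij_lattice_enum in \<open>auto intro: inj_on_subset simp: bij_def\<close>)
    finally show ?thesis .
  qed
  have "(\<Sum>j<N. ?F (zs j)) \<le> (\<Sum>j<N. ?m * (LINT w|lborel. indicator (ball (zs j) 1) w * ?F w))"
    by (intro sum_mono flat_mean_value_powr[OF qw g s])
  also have "\<dots> = ?m * (LINT w|lborel. (\<Sum>j<N. indicator (ball (zs j) 1) w * ?F w))"
    by (subst Bochner_Integration.integral_sum[OF ii]) (simp add: sum_distrib_left)
  also have "\<dots> \<le> ?m * (LINT w|lborel. overlap TYPE('n) * ?F w)"
  proof (intro mult_left_mono mean_const_nonneg integral_mono)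
    show "integrable lborel (\<lambda>w. \<Sum>j<N. indicator (ball (zs j) 1) w * ?F w)"
      by (rule Bochner_Integration.integrable_sum) (rule ii)
    show "integrable lborel (\<lambda>w. overlap TYPE('n) * ?F w)" using i by simp
    fix w
    show "(\<Sum>j<N. indicator (ball (zs j) 1) w * ?F w) \<le> overlap TYPE('n) * ?F w"
      unfolding sum_distrib_right[symmetric] by (rule mult_right_mono[OF ov]) simp
  qed
  finally show ?thesis by simp
qed

text \<open>The two constants of Schur's test: bounds for the sums over the lattice and for the integrals of the
  moduli of normalized kernels.\<close>
definition kernel_sum_const :: real where
  "kernel_sum_const = sqrt (peak_const TYPE('n) m) * (mean_const M 1 TYPE(complex ^ 'n) * overlap TYPE('n) * kernel_const TYPE('n) m M)"

definition kernel_norm_const :: real where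
  "kernel_norm_const = sqrt (peak_const TYPE('n) m) * kernel_const TYPE('n) m M"

lemma normalized_kernel_L1:
  shows "integrable lborel (\<lambda>w. cmod (normalized_kernel K z w) * exp (- \<phi> w))"
    and "(LINT w|lborel. cmod (normalized_kernel K z w) * exp (- \<phi> w)) \<le> kernel_norm_const"
proof -
  have e: "cmod (normalized_kernel K z w) * exp (- \<phi> w) = (1 / kroot z) * (cmod (K w z) * exp (- \<phi> w))" for w
    using kroot_pos[of z] by (simp add: normalized_kernel_eq norm_divide)
  show "integrable lborel (\<lambda>w. cmod (normalized_kernel K z w) * exp (- \<phi> w))"
    unfolding e by (intro integrable_mult_right kernel_L1(1)[OF qw rk])
  have "(LINT w|lborel. cmod (normalized_kernel K z w) * exp (- \<phi> w)) = (1 / kroot z) * (LINT w|lborel. cmod (K w z) * exp (- \<phi> w))"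
    unfolding e by (rule integral_mult_right_zero)
  also have "\<dots> \<le> (sqrt (peak_const TYPE('n) m) * exp (- \<phi> z)) * (kernel_const TYPE('n) m M * exp (\<phi> z))"
    using kroot_inverse kernel_L1(2)[OF qw rk] kroot_pos[of z] peak_const_pos[OF qw rk]
    by (intro mult_mono) (auto intro!: integral_nonneg_AE mult_nonneg_nonneg)
  also have "\<dots> = kernel_norm_const" by (simp add: kernel_norm_const_def exp_minus)
  finally show "(LINT w|lborel. cmod (normalized_kernel K z w) * exp (- \<phi> w)) \<le> kernel_norm_const" .
qed

text \<open>By Hermitian symmetry the sum over the points \<open>zs j\<close> samples the single entire function \<open>K(_,w)\<close>,
  whose norm with exponent \<open>1\<close> is known.\<close>
lemma normalized_kernel_lattice_sum:
  fixes zs :: "nat \<Rightarrow> complex ^ 'n"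
  assumes zs: "\<And>j. zs j \<in> cell (lattice_enum j)"
  shows "(\<Sum>j<N. cmod (normalized_kernel K (zs j) w) * exp (- \<phi> w)) \<le> kernel_sum_const"
proof -
  let ?q = "sqrt (peak_const TYPE('n) m)" and ?m = "mean_const M 1 TYPE(complex ^ 'n)" and ?o = "overlap TYPE('n)"
  have q0: "0 \<le> ?q" using peak_const_pos[OF qw rk] by simp
  have o0: "0 \<le> ?o" by (simp add: overlap_def)
  have "(\<Sum>j<N. cmod (normalized_kernel K (zs j) w) * exp (- \<phi> w))
    \<le> (\<Sum>j<N. (?q * exp (- \<phi> w)) * (cmod (K (zs j) w) * exp (- \<phi> (zs j))))"
  proof (rule sum_mono)
    fix j
    have "cmod (normalized_kernel K (zs j) w) = (1 / kroot (zs j)) * cmod (K (zs j) w)"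
      using kroot_pos[of "zs j"] by (simp add: normalized_kernel_eq norm_divide kernel_hermitian[OF qw rk, of w "zs j"])
    also have "\<dots> \<le> (?q * exp (- \<phi> (zs j))) * cmod (K (zs j) w)"
      by (intro mult_right_mono kroot_inverse) simp
    finally have "cmod (normalized_kernel K (zs j) w) * exp (- \<phi> w) \<le> (?q * exp (- \<phi> (zs j))) * cmod (K (zs j) w) * exp (- \<phi> w)"
      by (rule mult_right_mono) simp
    then show "cmod (normalized_kernel K (zs j) w) * exp (- \<phi> w) \<le> (?q * exp (- \<phi> w)) * (cmod (K (zs j) w) * exp (- \<phi> (zs j)))"
      by (simp add: mult_ac)
  qed
  also have "\<dots> = (?q * exp (- \<phi> w)) * (\<Sum>j<N. (cmod (K (zs j) w) * exp (- \<phi> (zs j))) powr 1)"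
    by (simp add: sum_distrib_left)
  also have "\<dots> \<le> (?q * exp (- \<phi> w)) * (?m * ?o * (LINT u|lborel. (cmod (K u w) * exp (- \<phi> u)) powr 1))"
    using kernel_L1(1)[OF qw rk, of w] q0
    by (intro mult_left_mono sampling zs K_entire) auto
  also have "\<dots> \<le> (?q * exp (- \<phi> w)) * (?m * ?o * (kernel_const TYPE('n) m M * exp (\<phi> w)))"
    using kernel_L1(2)[OF qw rk, of w] q0 mean_const_nonneg o0
    by (intro mult_left_mono) auto
  also have "\<dots> = ?q * (?m * ?o * kernel_const TYPE('n) m M)" by (simp add: exp_minus)
  also have "\<dots> \<le> kernel_sum_const" by (simp add: kernel_sum_const_def)
  finally show ?thesis .
qed

lemma normalized_kernel_entire: "entire (normalized_kernel K z)"
proof -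
  have "normalized_kernel K z = (\<lambda>w. (1 / of_real (kroot z)) * K w z)"
    by (simp add: fun_eq_iff normalized_kernel_eq)
  then show ?thesis by (simp only: entire_const_mult[OF K_entire])
qed

text \<open>Schur's test: Jensen's inequality for the weights \<open>|k\<^sub>z\<^sub>j(w)| exp (- \<phi> w)\<close> uses the bound for
  their sum over \<open>j\<close>, and integration over \<open>w\<close> uses the bound for their integrals.\<close>
theorem synthesis:
  fixes zs :: "nat \<Rightarrow> complex ^ 'n"
  assumes zs: "\<And>j. zs j \<in> cell (lattice_enum j)" and p: "1 \<le> p"
  shows "(\<lambda>w. \<Sum>j<N. c j * normalized_kernel K (zs j) w) \<in> Fock \<phi> p"
    and "Lphi_norm \<phi> p (\<lambda>w. \<Sum>j<N. c j * normalized_kernel K (zs j) w)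
      \<le> (kernel_sum_const powr (p - 1) * kernel_norm_const) powr (1 / p) * (\<Sum>j<N. cmod (c j) powr p) powr (1 / p)"
proof -
  let ?S = "\<lambda>w. \<Sum>j<N. c j * normalized_kernel K (zs j) w"
  define a where "a = (\<lambda>j w. cmod (normalized_kernel K (zs j) w) * exp (- \<phi> w))"
  have ent: "entire ?S" by (intro entire_sum entire_const_mult normalized_kernel_entire)
  have [measurable]: "?S \<in> borel_measurable borel" by (rule entire_measurable[OF ent])
  note [measurable] = phi_measurable[OF qw rk]
  have ai: "integrable lborel (a j)" "(LINT w|lborel. a j w) \<le> kernel_norm_const" for j
    unfolding a_def by (rule normalized_kernel_L1)+
  have le: "(cmod (?S w) * exp (- \<phi> w)) powr p \<le> kernel_sum_const powr (p - 1) * (\<Sum>j<N. a j w * cmod (c j) powr p)" for w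
  proof -
    have "cmod (?S w) * exp (- \<phi> w) \<le> (\<Sum>j<N. cmod (c j * normalized_kernel K (zs j) w)) * exp (- \<phi> w)"
      by (intro mult_right_mono norm_sum) simp
    also have "\<dots> = (\<Sum>j<N. a j w * cmod (c j))"
      unfolding sum_distrib_right by (rule sum.cong) (simp_all add: a_def norm_mult mult_ac)
    finally have "(cmod (?S w) * exp (- \<phi> w)) powr p \<le> (\<Sum>j<N. a j w * cmod (c j)) powr p"
      using p by (intro powr_mono2) auto
    also have "\<dots> \<le> kernel_sum_const powr (p - 1) * (\<Sum>j<N. a j w * cmod (c j) powr p)"
      by (rule jensen_powr) (use p normalized_kernel_lattice_sum[OF zs] in \<open>auto simp: a_def\<close>)
    finally show ?thesis .
  qed
  have di: "integrable lborel (\<lambda>w. kernel_sum_const powr (p - 1) * (\<Sum>j<N. a j w * cmod (c j) powr p))"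
    using ai by simp
  have i: "integrable lborel (\<lambda>w. (cmod (?S w) * exp (- \<phi> w)) powr p)"
    by (rule Bochner_Integration.integrable_bound[OF di]) (use order_trans[OF le abs_ge_self] in simp_all)
  show "?S \<in> Fock \<phi> p" using ent i by (simp add: Fock_iff[OF weight_cont])
  have "(LINT w|lborel. (cmod (?S w) * exp (- \<phi> w)) powr p) \<le> (LINT w|lborel. kernel_sum_const powr (p - 1) * (\<Sum>j<N. a j w * cmod (c j) powr p))"
    by (rule integral_mono[OF i di le])
  also have "\<dots> = kernel_sum_const powr (p - 1) * (\<Sum>j<N. (LINT w|lborel. a j w) * cmod (c j) powr p)"
    using ai by simp
  also have "\<dots> \<le> kernel_sum_const powr (p - 1) * (\<Sum>j<N. kernel_norm_const * cmod (c j) powr p)"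
    using ai by (intro mult_left_mono sum_mono mult_right_mono) auto
  also have "\<dots> = (kernel_sum_const powr (p - 1) * kernel_norm_const) * (\<Sum>j<N. cmod (c j) powr p)"
    by (simp add: sum_distrib_left mult_ac)
  finally have "(LINT w|lborel. (cmod (?S w) * exp (- \<phi> w)) powr p) powr (1/p)
     \<le> ((kernel_sum_const powr (p - 1) * kernel_norm_const) * (\<Sum>j<N. cmod (c j) powr p)) powr (1/p)"
    using p by (intro powr_mono2 integral_nonneg_AE) auto
  also have "\<dots> = (kernel_sum_const powr (p - 1) * kernel_norm_const) powr (1 / p) * (\<Sum>j<N. cmod (c j) powr p) powr (1 / p)"
    by (rule powr_mult)
  finally show "Lphi_norm \<phi> p ?S \<le> (kernel_sum_const powr (p - 1) * kernel_norm_const) powr (1 / p) * (\<Sum>j<N. cmod (c j) powr p) powr (1 / p)"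
    by (simp add: Fock_norm[OF weight_cont ent])
qed

section \<open>The Berezin transform\<close>

text \<open>The kernel of the projection at \<open>z\<close> is the conjugate of \<open>K(_,z)\<close>, which is \<open>K(z,z)\<^sup>1\<^sup>/\<^sup>2\<close> times the
  conjugate of the normalized kernel.\<close>
lemma toeplitz_at_kernel:
  "toeplitz \<phi> K f (normalized_kernel K z) z = of_real (kroot z) * berezin \<phi> K f z"
proof -
  have k: "of_real (kroot z) \<noteq> (0::complex)" using kroot_pos[of z] by simp
  have eq: "f w * normalized_kernel K z w * K z w * of_real (exp (- 2 * \<phi> w))
      = of_real (kroot z) * (f w * of_real ((cmod (normalized_kernel K z w))\<^sup>2 * exp (- 2 * \<phi> w)))" for w
  proof -
    have "of_real ((cmod (normalized_kernel K z w))\<^sup>2) = normalized_kernel K z w * (K z w / of_real (kroot z))"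
      unfolding complex_norm_square
      by (simp add: normalized_kernel_eq kernel_hermitian[OF qw rk, of w z])
    then have "of_real (kroot z) * of_real ((cmod (normalized_kernel K z w))\<^sup>2) = normalized_kernel K z w * K z w"
      using k by simp
    then have "f w * normalized_kernel K z w * K z w * of_real (exp (- 2 * \<phi> w))
      = f w * (of_real (kroot z) * of_real ((cmod (normalized_kernel K z w))\<^sup>2)) * of_real (exp (- 2 * \<phi> w))"
      by (simp only: mult.assoc)
    also have "\<dots> = of_real (kroot z) * (f w * of_real ((cmod (normalized_kernel K z w))\<^sup>2 * exp (- 2 * \<phi> w)))"
      by (simp only: of_real_mult mult_ac)
    finally show ?thesis .
  qed
  then show ?thesis
    unfolding toeplitz_def bergman_proj_def berezin_def
    by (subst integral_mult_right_zero[symmetric], intro Bochner_Integration.integral_cong refl eq)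
qed

lemma kernel_local_bound: "cmod (K w z) \<le> (mean_const M 1 TYPE(complex ^ 'n) * kernel_const TYPE('n) m M) * exp (\<phi> w + \<phi> z)"
proof -
  have "(cmod (K w z) * exp (- \<phi> w)) powr 1 \<le> mean_const M 1 TYPE(complex ^ 'n) * (LINT u|lborel. (cmod (K u z) * exp (- \<phi> u)) powr 1)"
    by (rule Fock_pointwise_bound[OF qw rk K_entire]) (use kernel_L1(1)[OF qw rk, of z] in auto)
  also have "\<dots> \<le> mean_const M 1 TYPE(complex ^ 'n) * (kernel_const TYPE('n) m M * exp (\<phi> z))"
    using kernel_L1(2)[OF qw rk, of z] by (intro mult_left_mono mean_const_nonneg) simp
  finally show ?thesis by (simp add: exp_minus exp_add field_simps)
qed

text \<open>\<open>K\<close> is Lipschitz in the first variable, locally uniformly in the second, and continuous in the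
  second variable by Hermitian symmetry.\<close>
lemma kernel_continuous: "continuous_on UNIV (\<lambda>p. K (fst p) (snd p))"
proof -
  let ?P = "mean_const M 1 TYPE(complex ^ 'n) * kernel_const TYPE('n) m M"
  have P0: "0 \<le> ?P" using mean_const_nonneg kernel_const_nonneg[OF qw rk] by simp
  have "isCont (\<lambda>p. K (fst p) (snd p)) (w0, z0)" for w0 z0
  proof -
    obtain b1 where b1: "\<And>x. x \<in> cball w0 2 \<Longrightarrow> norm (\<phi> x) \<le> b1"
      using compact_imp_bounded[OF compact_continuous_image[OF continuous_on_subset[OF weight_cont] compact_cball]] unfolding bounded_iff by fast
    obtain b2 where b2: "\<And>x. x \<in> cball z0 2 \<Longrightarrow> norm (\<phi> x) \<le> b2"
      using compact_imp_bounded[OF compact_continuous_image[OF continuous_on_subset[OF weight_cont] compact_cball]] unfolding bounded_iff by fast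
    define B where "B = ?P * exp (b1 + b2)"
    have lip: "cmod (K w z - K w0 z) \<le> B * norm (w - w0)" if w: "norm (w - w0) \<le> 1" and z: "norm (z - z0) \<le> 1" for w z
    proof (rule entire_line_Lipschitz[OF K_entire _ w])
      fix x assume "norm (x - w0) \<le> 2"
      then have "\<phi> x \<le> b1" using b1[of x] by (simp add: dist_norm norm_minus_commute)
      moreover have "\<phi> z \<le> b2" using b2[of z] z by (simp add: dist_norm norm_minus_commute)
      ultimately have "?P * exp (\<phi> x + \<phi> z) \<le> B" unfolding B_def using P0 by (intro mult_left_mono) auto
      then show "cmod (K x z) \<le> B" using kernel_local_bound[of x z] by linarith
    qed
    have c2: "((\<lambda>p. K w0 (snd p)) \<longlongrightarrow> K w0 z0) (at (w0, z0))"
    proof -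
      have e: "(\<lambda>z. K w0 z) = (\<lambda>z. cnj (K z w0))" by (rule ext, rule kernel_hermitian[OF qw rk])
      have "isCont (\<lambda>z. K w0 z) z0"
        unfolding e using entire_continuous[OF K_entire] by (auto intro!: continuous_intros simp: continuous_on_eq_continuous_at)
      moreover have "((\<lambda>p. snd p) \<longlongrightarrow> z0) (at (w0, z0))" using tendsto_snd[OF tendsto_ident_at, of "(w0, z0)" UNIV] by simp
      ultimately show ?thesis using isCont_tendsto_compose by fastforce
    qed
    have c1: "((\<lambda>p. K (fst p) (snd p) - K w0 (snd p)) \<longlongrightarrow> 0) (at (w0, z0))"
    proof (rule Lim_null_comparison)
      show "\<forall>\<^sub>F p in at (w0, z0). norm (K (fst p) (snd p) - K w0 (snd p)) \<le> B * norm (fst p - w0)"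
        unfolding eventually_at
      proof (intro exI[of _ 1] conjI ballI impI)
        fix p :: "(complex ^ 'n) \<times> (complex ^ 'n)" assume "p \<noteq> (w0, z0) \<and> dist p (w0, z0) < 1"
        then have "dist (fst p) w0 < 1" "dist (snd p) z0 < 1"
          using dist_fst_le[of p "(w0, z0)"] dist_snd_le[of p "(w0, z0)"] by auto
        then show "norm (K (fst p) (snd p) - K w0 (snd p)) \<le> B * norm (fst p - w0)"
          by (intro lip) (auto simp: dist_norm)
      qed simp
      have "((\<lambda>p. B * norm (fst p - w0)) \<longlongrightarrow> B * norm (fst (w0, z0) - w0)) (at (w0, z0))"
        by (intro tendsto_intros)
      then show "((\<lambda>p. B * norm (fst p - w0)) \<longlongrightarrow> 0) (at (w0, z0))" by simp
    qed
    from tendsto_add[OF c1 c2] show ?thesis by (simp add: isCont_def)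
  qed
  then show ?thesis by (simp add: continuous_on_eq_continuous_at split_paired_all)
qed

text \<open>The transform is an integral depending on a parameter with a jointly measurable integrand. The
  symbol is replaced by a Borel function that agrees with it almost everywhere, so that products
  of Borel \<open>\<sigma>\<close>-algebras can be used.\<close>
lemma berezin_measurable:
  assumes f: "f \<in> borel_measurable lebesgue"
  shows "berezin \<phi> K f \<in> borel_measurable borel"
proof -
  note [measurable] = phi_measurable[OF qw rk]
  have "(\<lambda>x. Re (f x)) \<in> borel_measurable lebesgue" using f by measurable
  then obtain f1 where f1[measurable]: "f1 \<in> borel_measurable lborel" and f1e: "AE x in lborel. Re (f x) = f1 x"
    using completion_ex_borel_measurable_real[of "\<lambda>x. Re (f x)" lborel] by blast
  have "(\<lambda>x. Im (f x)) \<in> borel_measurable lebesgue" using f by measurable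
  then obtain f2 where f2[measurable]: "f2 \<in> borel_measurable lborel" and f2e: "AE x in lborel. Im (f x) = f2 x"
    using completion_ex_borel_measurable_real[of "\<lambda>x. Im (f x)" lborel] by blast
  define f' where "f' = (\<lambda>x. Complex (f1 x) (f2 x))"
  have f'e: "f' = (\<lambda>x. of_real (f1 x) + \<i> * of_real (f2 x))" by (simp add: f'_def fun_eq_iff complex_eq_iff)
  have f'm[measurable]: "f' \<in> borel_measurable borel" unfolding f'e using f1 f2 by measurable
  have AEf: "AE x in lborel. f x = f' x"
    using f1e f2e by eventually_elim (simp add: f'_def complex_eq_iff)
  have Km[measurable]: "(\<lambda>p. K (fst p) (snd p)) \<in> borel_measurable (borel \<Otimes>\<^sub>M borel)"
    unfolding borel_prod by (rule borel_measurable_continuous_onI[OF kernel_continuous])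
  have Km'[measurable]: "(\<lambda>p. K (snd p) (fst p)) \<in> borel_measurable (borel \<Otimes>\<^sub>M borel)"
  proof -
    have "(\<lambda>p. (snd p, fst p)) \<in> (borel \<Otimes>\<^sub>M (borel :: (complex^'n) measure)) \<rightarrow>\<^sub>M (borel \<Otimes>\<^sub>M (borel :: (complex^'n) measure))" by measurable
    from measurable_compose[OF this Km] show ?thesis by simp
  qed
  have [measurable]: "kroot \<in> borel_measurable borel"
  proof -
    have "(\<lambda>z. (z, z)) \<in> (borel :: (complex^'n) measure) \<rightarrow>\<^sub>M (borel \<Otimes>\<^sub>M borel)" by measurable
    from measurable_compose[OF this Km] have [measurable]: "(\<lambda>z. K z z) \<in> borel_measurable borel" by simp
    have "kroot = (\<lambda>z. sqrt (Re (K z z)))" by (simp add: fun_eq_iff kroot_def kernel_diag[OF qw rk])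
    then show ?thesis by simp
  qed
  have e: "berezin \<phi> K f z = (LINT w|lborel. f' w * of_real ((cmod (K w z) / kroot z)\<^sup>2 * exp (- 2 * \<phi> w)))" for z
  proof -
    have k: "cmod (normalized_kernel K z w) = cmod (K w z) / kroot z" for w
      using kroot_pos[of z] by (simp add: normalized_kernel_eq norm_divide)
    have [measurable]: "(\<lambda>w. K w z) \<in> borel_measurable borel" by (rule entire_measurable[OF K_entire])
    have b: "(\<lambda>w. of_real ((cmod (K w z) / kroot z)\<^sup>2 * exp (- 2 * \<phi> w)) :: complex) \<in> borel_measurable borel" by measurable
    have bl: "h \<in> borel_measurable lebesgue" if "h \<in> borel_measurable borel" for h :: "complex^'n \<Rightarrow> complex"
      by (rule measurable_completion) (use that in simp)
    have "berezin \<phi> K f z = (LINT w|lebesgue. f w * of_real ((cmod (K w z) / kroot z)\<^sup>2 * exp (- 2 * \<phi> w)))"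
      by (simp add: berezin_def k)
    also have "\<dots> = (LINT w|lebesgue. f' w * of_real ((cmod (K w z) / kroot z)\<^sup>2 * exp (- 2 * \<phi> w)))"
    proof (rule integral_cong_AE)
      show "AE w in lebesgue. f w * of_real ((cmod (K w z) / kroot z)\<^sup>2 * exp (- 2 * \<phi> w)) = f' w * of_real ((cmod (K w z) / kroot z)\<^sup>2 * exp (- 2 * \<phi> w))"
        using AE_completion[OF AEf] by eventually_elim simp
    qed (intro borel_measurable_times f bl b f'm)+
    also have "\<dots> = (LINT w|lborel. f' w * of_real ((cmod (K w z) / kroot z)\<^sup>2 * exp (- 2 * \<phi> w)))"
      by (rule integrable_lebesgue_iff(2)) (intro borel_measurable_times b f'm)
    finally show ?thesis .
  qed
  have "(\<lambda>z. LINT w|lborel. f' w * of_real ((cmod (K w z) / kroot z)\<^sup>2 * exp (- 2 * \<phi> w))) \<in> borel_measurable borel"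
  proof (rule lborel.borel_measurable_lebesgue_integral)
    show "(\<lambda>(z, w). f' w * of_real ((cmod (K w z) / kroot z)\<^sup>2 * exp (- 2 * \<phi> w))) \<in> borel_measurable (borel \<Otimes>\<^sub>M lborel)"
      unfolding case_prod_beta by measurable
  qed
  then show ?thesis unfolding e[abs_def] by (simp add: e)
qed

end

section \<open>Extracting the diagonal of a summing operator\<close>

text \<open>Jensen's inequality for the weights \<open>n t\<close>, applied to the terms \<open>a t j / n t\<close>, whose \<open>s\<close>-th powers
  sum to at most \<open>1\<close> over \<open>j\<close>.\<close>
lemma minkowski_sum:
  fixes a :: "'t \<Rightarrow> 'j \<Rightarrow> real"
  assumes T: "finite T" and J: "finite J" and a: "\<And>t j. 0 \<le> a t j" and s: "1 \<le> s"
  shows "(\<Sum>j\<in>J. (\<Sum>t\<in>T. a t j) powr s) powr (1/s) \<le> (\<Sum>t\<in>T. (\<Sum>j\<in>J. a t j powr s) powr (1/s))"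
proof -
  define n where "n = (\<lambda>t. (\<Sum>j\<in>J. a t j powr s) powr (1/s))"
  define S where "S = (\<Sum>t\<in>T. n t)"
  have n0: "0 \<le> n t" for t by (simp add: n_def)
  have S0: "0 \<le> S" unfolding S_def by (intro sum_nonneg n0)
  have np: "n t powr s = (\<Sum>j\<in>J. a t j powr s)" for t
    using s by (simp add: n_def powr_powr sum_nonneg)
  have z: "a t j = 0" if "n t = 0" "j \<in> J" for t j
  proof -
    have "(\<Sum>j\<in>J. a t j powr s) = 0" using np[of t] that(1) s by simp
    then have "a t j powr s = 0" using sum_nonneg_eq_0_iff[OF J, of "\<lambda>j. a t j powr s"] that(2) by simp
    then show ?thesis by simp
  qed
  have 1: "(\<Sum>t\<in>T. a t j) powr s \<le> S powr (s - 1) * (\<Sum>t\<in>T. n t * (a t j / n t) powr s)" if j: "j \<in> J" for j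
  proof -
    have "(\<Sum>t\<in>T. a t j) = (\<Sum>t\<in>T. n t * (a t j / n t))"
    proof (rule sum.cong)
      fix t show "a t j = n t * (a t j / n t)" using z[OF _ j, of t] by (cases "n t = 0") auto
    qed simp
    then show ?thesis
      using jensen_powr[OF T, of n "\<lambda>t. a t j / n t" s S] n0 a s by (simp add: S_def)
  qed
  have "(\<Sum>j\<in>J. (\<Sum>t\<in>T. a t j) powr s) \<le> (\<Sum>j\<in>J. S powr (s - 1) * (\<Sum>t\<in>T. n t * (a t j / n t) powr s))"
    by (rule sum_mono) (rule 1)
  also have "\<dots> = S powr (s - 1) * (\<Sum>t\<in>T. n t * (\<Sum>j\<in>J. (a t j / n t) powr s))"
    unfolding sum_distrib_left by (subst sum.swap) simp
  also have "\<dots> \<le> S powr (s - 1) * (\<Sum>t\<in>T. n t * 1)"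
  proof (intro mult_left_mono sum_mono n0)
    fix t
    show "(\<Sum>j\<in>J. (a t j / n t) powr s) \<le> 1"
    proof (cases "n t = 0")
      case False
      have "(\<Sum>j\<in>J. (a t j / n t) powr s) = (\<Sum>j\<in>J. a t j powr s) / n t powr s"
        using a n0 by (simp add: powr_divide sum_divide_distrib)
      also have "\<dots> \<le> 1" unfolding np[symmetric] using False by simp
      finally show ?thesis .
    qed simp
  qed simp
  also have "\<dots> = S powr s"
    using S0 by (cases "S = 0") (auto simp: S_def[symmetric] powr_diff)
  finally have "(\<Sum>j\<in>J. (\<Sum>t\<in>T. a t j) powr s) powr (1/s) \<le> (S powr s) powr (1/s)"
    using s by (intro powr_mono2) (auto intro: sum_nonneg)
  also have "\<dots> = S" using s S0 by (simp add: powr_powr)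
  finally show ?thesis by (simp add: S_def n_def)
qed

definition root_char :: "nat \<Rightarrow> nat \<Rightarrow> nat \<Rightarrow> complex" where
  "root_char N t j = cis (2 * pi * real t * real j / real N)"

lemma norm_root_char [simp]: "cmod (root_char N t j) = 1"
  by (simp add: root_char_def)

lemma root_char_orthogonal:
  assumes "j < N" "l < N"
  shows "(\<Sum>t<N. cnj (root_char N t j) * root_char N t l) = (if j = l then of_nat N else 0)"
proof -
  define \<theta> where "\<theta> = 2 * pi * (real l - real j) / real N"
  have N: "0 < N" using assms by simp
  have e: "cnj (root_char N t j) * root_char N t l = cis \<theta> ^ t" for t
    unfolding root_char_def cis_cnj cis_mult Complex.DeMoivre
    by (rule arg_cong[of _ _ cis]) (use N in \<open>simp add: \<theta>_def field_simps\<close>)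
  show ?thesis
  proof (cases "j = l")
    case True then show ?thesis unfolding e by (simp add: \<theta>_def)
  next
    case False
    have ne: "cis \<theta> \<noteq> 1"
    proof
      assume "cis \<theta> = 1"
      then have "exp (\<i> * of_real \<theta>) = 1" by (simp add: cis_conv_exp)
      then obtain k :: int where k: "\<theta> = 2 * pi * of_int k"
        by (auto simp: exp_eq_1 mult_ac)
      then have "2 * pi * (real l - real j) = 2 * pi * (real_of_int k * real N)"
        using N unfolding \<theta>_def by (simp add: divide_eq_eq mult.assoc)
      then have "real l - real j = real_of_int k * real N"
        by (subst (asm) mult_left_cancel) auto
      then have kk: "int l - int j = k * int N" by (metis of_int_diff of_int_eq_iff of_int_mult of_int_of_nat_eq)
      moreover have "\<bar>int l - int j\<bar> < int N" using assms by auto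
      ultimately have "\<bar>k\<bar> * int N < 1 * int N" by (simp add: abs_mult)
      then have "\<bar>k\<bar> < 1" by (rule mult_right_less_imp_less) simp
      then have "k = 0" by simp
      with kk False show False by simp
    qed
    have "cis \<theta> ^ N = cis (real N * \<theta>)" by (rule Complex.DeMoivre)
    also have "real N * \<theta> = 2 * pi * of_int (int l - int j)" using N by (simp add: \<theta>_def)
    also have "cis \<dots> = 1" by (rule cis_multiple_2pi) simp
    finally show ?thesis unfolding e using ne False by (simp add: sum_gp_strict)
  qed
qed

lemma linear_between_sum:
  fixes c :: "nat \<Rightarrow> complex" and e :: "nat \<Rightarrow> 'a \<Rightarrow> complex"
  assumes lin: "linear_between X Y A" and syn: "\<And>c N. (\<lambda>w. \<Sum>j<N. c j * e j w) \<in> X"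
  shows "A (\<lambda>w. \<Sum>j<N. c j * e j w) = (\<lambda>t. \<Sum>j<N. c j * A (e j) t)"
proof -
  have eX: "e j \<in> X" for j
  proof -
    have "(\<lambda>w. \<Sum>i<Suc j. (if i = j then 1 else 0) * e i w) \<in> X" by (rule syn)
    moreover have "(\<Sum>i<Suc j. (if i = j then 1 else 0) * e i w) = e j w" for w by (simp add: sum.neutral)
    ultimately show ?thesis by simp
  qed
  have ceX: "(\<lambda>w. c j * e j w) \<in> X" for c j
  proof -
    have "(\<lambda>w. \<Sum>i<Suc j. (if i = j then c j else 0) * e i w) \<in> X" by (rule syn)
    moreover have "(\<Sum>i<Suc j. (if i = j then c j else 0) * e i w) = c j * e j w" for w by (simp add: sum.neutral)
    ultimately show ?thesis by simp
  qed
  have hom: "A (\<lambda>t. a * x t) = (\<lambda>t. a * A x t)" if "x \<in> X" for a x using lin that unfolding linear_between_def by blast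
  have add: "A (\<lambda>t. u t + v t) = (\<lambda>t. A u t + A v t)" if "u \<in> X" "v \<in> X" for u v using lin that unfolding linear_between_def by blast
  show ?thesis
  proof (induction N)
    case 0
    have "A (\<lambda>w. 0 * e 0 w) = (\<lambda>t. 0 * A (e 0) t)" by (rule hom[OF eX])
    then show ?case by simp
  next
    case (Suc N)
    have "A (\<lambda>w. (\<Sum>j<N. c j * e j w) + c N * e N w) = (\<lambda>t. A (\<lambda>w. \<Sum>j<N. c j * e j w) t + A (\<lambda>w. c N * e N w) t)"
      by (rule add[OF syn ceX])
    then show ?case by (simp add: Suc hom[OF eX])
  qed
qed

lemma dual_ball_sup_bounded:
  assumes "\<And>i. i < k \<Longrightarrow> x i \<in> X" and r: "0 < r"
  shows "bdd_above ((\<lambda>l. (\<Sum>i<k. cmod (l (x i)) powr r) powr (1/r)) ` dual_ball X N)"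
proof (rule bdd_aboveI2)
  fix l assume "l \<in> dual_ball X N"
  then have "cmod (l (x i)) \<le> N (x i)" if "i < k" for i using assms that unfolding dual_ball_def by blast
  then show "(\<Sum>i<k. cmod (l (x i)) powr r) powr (1/r) \<le> (\<Sum>i<k. N (x i) powr r) powr (1/r)"
    using r by (intro powr_mono2 sum_mono sum_nonneg) auto
qed

lemma zero_in_dual_ball: "(\<And>x. x \<in> X \<Longrightarrow> 0 \<le> N x) \<Longrightarrow> (\<lambda>x. 0) \<in> dual_ball X N"
  by (simp add: dual_ball_def)

lemma lseq_norm_finite:
  assumes "\<And>j. N \<le> j \<Longrightarrow> c j = 0"
  shows "lseq_norm p c = (\<Sum>j<N. cmod (c j) powr p) powr (1/p)"
proof -
  have "(\<Sum>j. cmod (c j) powr p) = (\<Sum>j<N. cmod (c j) powr p)"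
    by (rule suminf_finite) (use assms in auto)
  then show ?thesis by (simp add: lseq_norm_def)
qed

lemma lseq_norm_partial:
  assumes "c \<in> lseq p" "0 < p"
  shows "(\<Sum>j<N. cmod (c j) powr p) powr (1/p) \<le> lseq_norm p c"
  unfolding lseq_norm_def using assms
  by (intro powr_mono2 sum_le_suminf) (auto simp: lseq_def intro: sum_nonneg)

definition truncate :: "nat \<Rightarrow> (nat \<Rightarrow> complex) \<Rightarrow> nat \<Rightarrow> complex" where
  "truncate N b j = (if j < N then b j else 0)"

text \<open>Let \<open>S\<close> be the synthesis operator of the \<open>e j\<close>, \<open>R y = (wt j * y (pt j))\<^sub>j\<close>, and \<open>D\<^sub>t\<close> the diagonal
  matrix with entries \<open>root_char N t j\<close>. By orthogonality of the characters of the cyclic group of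
  order \<open>N\<close>, the mean of \<open>D\<^sub>t\<^sup>* R A S D\<^sub>t\<close> over \<open>t\<close> is the diagonal part of \<open>R A S\<close>. Each summand has the
  summing constant \<open>C * c1 * c2\<close> because \<open>D\<^sub>t\<close> is isometric, and so has the mean by Minkowski's
  inequality.\<close>
theorem diagonal_summing:
  fixes e :: "nat \<Rightarrow> 'a \<Rightarrow> complex" and wt :: "nat \<Rightarrow> complex" and pt :: "nat \<Rightarrow> 'b"
  assumes lin: "linear_between X Y A" and sb: "summing_bound r X NX NY A C"
    and p: "1 \<le> p" and q: "1 \<le> q" and r: "1 \<le> r"
    and syn: "\<And>c N. (\<lambda>w. \<Sum>j<N. c j * e j w) \<in> X"
    and synb: "\<And>c N. NX (\<lambda>w. \<Sum>j<N. c j * e j w) \<le> c1 * (\<Sum>j<N. cmod (c j) powr p) powr (1/p)"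
    and samp: "\<And>y N. y \<in> Y \<Longrightarrow> (\<Sum>j<N. cmod (wt j * y (pt j)) powr q) powr (1/q) \<le> c2 * NY y"
    and c1: "0 < c1" and c2: "0 \<le> c2" and NX: "\<And>x. x \<in> X \<Longrightarrow> 0 \<le> NX x" and NY: "\<And>y. y \<in> Y \<Longrightarrow> 0 \<le> NY y"
  shows "summing_bound r (lseq p) (lseq_norm p) (lseq_norm q) (diag_op (truncate N (\<lambda>j. wt j * A (e j) (pt j)))) (C * c1 * c2)"
proof (cases "N = 0")
  case True
  have C0: "0 \<le> C" using sb by (simp add: summing_bound_def)
  have "0 \<le> C * c1 * c2 * (SUP l\<in>dual_ball (lseq p) (lseq_norm p). (\<Sum>j<k. cmod (l (x j)) powr r) powr (1/r))"
    if "\<forall>j<k. x j \<in> lseq p" for k x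
  proof (intro mult_nonneg_nonneg)
    have "(\<lambda>x. 0) \<in> dual_ball (lseq p) (lseq_norm p)" by (rule zero_in_dual_ball) (simp add: lseq_norm_def)
    from cSUP_upper[OF this dual_ball_sup_bounded[of k x "lseq p" r "lseq_norm p"]]
    show "0 \<le> (SUP l\<in>dual_ball (lseq p) (lseq_norm p). (\<Sum>j<k. cmod (l (x j)) powr r) powr (1/r))"
      using that r by (auto intro: order_trans[OF powr_ge_zero])
  qed (use C0 c1 c2 in auto)
  then show ?thesis using True C0 c1 c2
    by (simp add: summing_bound_def diag_op_def truncate_def lseq_norm_finite[of 0]) blast
next
  case False
  then have N: "0 < N" by simp
  define b where "b = (\<lambda>j. wt j * A (e j) (pt j))"
  have C0: "0 \<le> C" using sb by (simp add: summing_bound_def)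
  have AY: "A x \<in> Y" if "x \<in> X" for x using lin that by (simp add: linear_between_def)
  show ?thesis
    unfolding summing_bound_def b_def[symmetric]
  proof (intro conjI allI impI)
    show "0 \<le> C * c1 * c2" using C0 c1 c2 by simp
    fix k :: nat and x :: "nat \<Rightarrow> nat \<Rightarrow> complex"
    assume x: "\<forall>i<k. x i \<in> lseq p"
    define W where "W = (SUP l\<in>dual_ball (lseq p) (lseq_norm p). (\<Sum>i<k. cmod (l (x i)) powr r) powr (1/r))"
    define S where "S = (\<lambda>t c w. \<Sum>j<N. (root_char N t j * c j) * e j w)"
    have SX: "S t c \<in> X" for t c unfolding S_def by (rule syn)
    have SN: "NX (S t c) \<le> c1 * (\<Sum>j<N. cmod (c j) powr p) powr (1/p)" for t c
      using synb[where c="\<lambda>j. root_char N t j * c j" and N=N] unfolding S_def by (simp add: norm_mult)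
    have AS: "A (S t c) u = (\<Sum>j<N. root_char N t j * c j * A (e j) u)" for t c u
      unfolding S_def by (subst linear_between_sum[OF lin syn]) simp
    \<comment> \<open>Pull back functionals along the synthesis operator.\<close>
    have step1: "(\<Sum>i<k. NY (A (S t (x i))) powr r) powr (1/r) \<le> C * (c1 * W)" for t
    proof -
      have "(\<Sum>i<k. NY (A (S t (x i))) powr r) powr (1/r)
          \<le> C * (SUP l\<in>dual_ball X NX. (\<Sum>i<k. cmod (l (S t (x i))) powr r) powr (1/r))"
        using sb[unfolded summing_bound_def, THEN conjunct2, rule_format, of k "\<lambda>i. S t (x i)"] SX by simp
      also have "\<dots> \<le> C * (c1 * W)"
      proof (intro mult_left_mono C0 cSUP_least)
        show "dual_ball X NX \<noteq> {}" using zero_in_dual_ball[of X NX] NX by blast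
        fix l assume l: "l \<in> dual_ball X NX"
        define l' where "l' = (\<lambda>c. l (S t c) / of_real c1)"
        have ladd: "l (\<lambda>w. u w + v w) = l u + l v" if "u \<in> X" "v \<in> X" for u v using l that unfolding dual_ball_def by blast
        have lmul: "l (\<lambda>w. a * u w) = a * l u" if "u \<in> X" for a u using l that unfolding dual_ball_def by blast
        have lb: "cmod (l u) \<le> NX u" if "u \<in> X" for u using l that unfolding dual_ball_def by blast
        have l': "l' \<in> dual_ball (lseq p) (lseq_norm p)"
          unfolding dual_ball_def mem_Collect_eq
        proof (intro conjI ballI allI)
          fix u v :: "nat \<Rightarrow> complex"
          have "S t (\<lambda>j. u j + v j) = (\<lambda>w. S t u w + S t v w)"
            by (simp add: S_def fun_eq_iff sum.distrib[symmetric] algebra_simps)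
          then show "l' (\<lambda>j. u j + v j) = l' u + l' v"
            unfolding l'_def using ladd[OF SX SX] by (simp add: add_divide_distrib)
        next
          fix a and u :: "nat \<Rightarrow> complex"
          have "S t (\<lambda>j. a * u j) = (\<lambda>w. a * S t u w)"
            by (simp add: S_def fun_eq_iff sum_distrib_left mult_ac)
          then show "l' (\<lambda>j. a * u j) = a * l' u" unfolding l'_def using lmul[OF SX] by simp
        next
          fix u assume u: "u \<in> lseq p"
          have "cmod (l (S t u)) \<le> c1 * (\<Sum>j<N. cmod (u j) powr p) powr (1/p)"
            using lb[OF SX] SN order_trans by blast
          also have "\<dots> \<le> c1 * lseq_norm p u" using c1 p by (intro mult_left_mono lseq_norm_partial u) auto
          finally show "cmod (l' u) \<le> lseq_norm p u"
            using c1 by (simp add: l'_def norm_divide field_simps)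
        qed
        have ll: "cmod (l (S t c)) = c1 * cmod (l' c)" for c using c1 by (simp add: l'_def norm_divide)
        have "(\<Sum>i<k. cmod (l (S t (x i))) powr r) = c1 powr r * (\<Sum>i<k. cmod (l' (x i)) powr r)"
          using c1 by (simp add: ll powr_mult sum_distrib_left)
        then have "(\<Sum>i<k. cmod (l (S t (x i))) powr r) powr (1/r) = c1 * (\<Sum>i<k. cmod (l' (x i)) powr r) powr (1/r)"
          using c1 r by (simp add: powr_mult powr_powr)
        also have "\<dots> \<le> c1 * W"
          unfolding W_def using c1 r x
          by (intro mult_left_mono cSUP_upper l' dual_ball_sup_bounded) auto
        finally show "(\<Sum>i<k. cmod (l (S t (x i))) powr r) powr (1/r) \<le> c1 * W" .
      qed
      finally show ?thesis .
    qed
    \<comment> \<open>The mean over the characters of the \<open>j\<close>-th entry of \<open>R A S D\<^sub>t c\<close>, twisted back by the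
      conjugate character, keeps only the term with \<open>l = j\<close>.\<close>
    have diag: "of_nat N * (b j * c j) = (\<Sum>t<N. cnj (root_char N t j) * (wt j * A (S t c) (pt j)))" if j: "j < N" for j c
    proof -
      have "(\<Sum>t<N. cnj (root_char N t j) * (wt j * A (S t c) (pt j)))
        = (\<Sum>t<N. \<Sum>l<N. (wt j * c l * A (e l) (pt j)) * (cnj (root_char N t j) * root_char N t l))"
        unfolding AS sum_distrib_left by (intro sum.cong refl) (simp add: mult_ac)
      also have "\<dots> = (\<Sum>l<N. (wt j * c l * A (e l) (pt j)) * (if j = l then of_nat N else 0))"
        by (subst sum.swap) (simp add: sum_distrib_left[symmetric] root_char_orthogonal[OF j])
      also have "\<dots> = of_nat N * (b j * c j)"
        using j by (simp add: b_def if_distrib mult_ac cong: if_cong)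
      finally show ?thesis by simp
    qed
    have step2: "real N * lseq_norm q (diag_op (truncate N b) c) \<le> (\<Sum>t<N. c2 * NY (A (S t c)))" for c
    proof -
      have tr: "lseq_norm q (diag_op (truncate N b) c) = (\<Sum>j<N. cmod (b j * c j) powr q) powr (1/q)"
        by (subst lseq_norm_finite[of N]) (auto simp: diag_op_def truncate_def)
      have "real N * lseq_norm q (diag_op (truncate N b) c) = (\<Sum>j<N. cmod (of_nat N * (b j * c j)) powr q) powr (1/q)"
      proof -
        have "(\<Sum>j<N. cmod (of_nat N * (b j * c j)) powr q) = real N powr q * (\<Sum>j<N. cmod (b j * c j) powr q)"
          by (simp add: norm_mult powr_mult sum_distrib_left)
        then show ?thesis unfolding tr using q by (simp add: powr_mult powr_powr)
      qed
      also have "\<dots> \<le> (\<Sum>j<N. (\<Sum>t<N. cmod (wt j * A (S t c) (pt j))) powr q) powr (1/q)"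
      proof (intro powr_mono2 sum_mono sum_nonneg)
        fix j assume "j \<in> {..<N}"
        then have "cmod (of_nat N * (b j * c j)) \<le> (\<Sum>t<N. cmod (cnj (root_char N t j) * (wt j * A (S t c) (pt j))))"
          using diag[of j c] norm_sum by simp
        then show "cmod (of_nat N * (b j * c j)) \<le> (\<Sum>t<N. cmod (wt j * A (S t c) (pt j)))"
          by (simp add: norm_mult)
      qed (use q in auto)
      also have "\<dots> \<le> (\<Sum>t<N. (\<Sum>j<N. cmod (wt j * A (S t c) (pt j)) powr q) powr (1/q))"
        by (rule minkowski_sum) (use q in auto)
      also have "\<dots> \<le> (\<Sum>t<N. c2 * NY (A (S t c)))"
        by (intro sum_mono samp AY SX)
      finally show ?thesis .
    qed
    have "real N * (\<Sum>i<k. lseq_norm q (diag_op (truncate N b) (x i)) powr r) powr (1/r)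
       = (\<Sum>i<k. (real N * lseq_norm q (diag_op (truncate N b) (x i))) powr r) powr (1/r)"
    proof -
      have "(\<Sum>i<k. (real N * lseq_norm q (diag_op (truncate N b) (x i))) powr r)
        = real N powr r * (\<Sum>i<k. lseq_norm q (diag_op (truncate N b) (x i)) powr r)"
        by (simp add: powr_mult sum_distrib_left)
      then show ?thesis using r by (simp add: powr_mult powr_powr)
    qed
    also have "\<dots> \<le> (\<Sum>i<k. (\<Sum>t<N. c2 * NY (A (S t (x i)))) powr r) powr (1/r)"
      using step2 r by (intro powr_mono2 sum_mono sum_nonneg) (auto simp: lseq_norm_def)
    also have "\<dots> \<le> (\<Sum>t<N. (\<Sum>i<k. (c2 * NY (A (S t (x i)))) powr r) powr (1/r))"
      using minkowski_sum[of "{..<N}" "{..<k}" "\<lambda>t i. c2 * NY (A (S t (x i)))" r] c2 NY AY SX r by simp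
    also have "\<dots> = (\<Sum>t<N. c2 * (\<Sum>i<k. NY (A (S t (x i))) powr r) powr (1/r))"
    proof (rule sum.cong)
      fix t
      have "(\<Sum>i<k. (c2 * NY (A (S t (x i)))) powr r) = c2 powr r * (\<Sum>i<k. NY (A (S t (x i))) powr r)"
        by (simp add: powr_mult sum_distrib_left)
      then show "(\<Sum>i<k. (c2 * NY (A (S t (x i)))) powr r) powr (1/r) = c2 * (\<Sum>i<k. NY (A (S t (x i))) powr r) powr (1/r)"
        using c2 r by (simp add: powr_mult powr_powr)
    qed simp
    also have "\<dots> \<le> (\<Sum>t<N. c2 * (C * (c1 * W)))"
      by (intro sum_mono mult_left_mono step1 c2)
    also have "\<dots> = real N * (C * c1 * c2 * W)" by simp
    finally show "(\<Sum>i<k. lseq_norm q (diag_op (truncate N b) (x i)) powr r) powr (1/r)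
      \<le> C * c1 * c2 * (SUP l\<in>dual_ball (lseq p) (lseq_norm p). (\<Sum>i<k. cmod (l (x i)) powr r) powr (1/r))"
      using N unfolding W_def by simp
  qed
qed

text \<open>A summing operator is bounded, by the case of a family with one member.\<close>
lemma summing_bound_single:
  assumes sb: "summing_bound r X NX NY A C" and x: "x \<in> X" and r: "1 \<le> r"
    and NX: "\<And>x. x \<in> X \<Longrightarrow> 0 \<le> NX x" and NY: "0 \<le> NY (A x)"
  shows "NY (A x) \<le> C * NX x"
proof -
  have C0: "0 \<le> C" using sb by (simp add: summing_bound_def)
  have "(NY (A x) powr r) powr (1/r) \<le> C * (SUP l\<in>dual_ball X NX. (cmod (l x) powr r) powr (1/r))"
    using sb[unfolded summing_bound_def, THEN conjunct2, rule_format, of 1 "\<lambda>i. x"] x by simp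
  also have "\<dots> \<le> C * NX x"
  proof (intro mult_left_mono C0 cSUP_least)
    show "dual_ball X NX \<noteq> {}" using zero_in_dual_ball[of X NX] NX by blast
    fix l assume "l \<in> dual_ball X NX"
    then have "cmod (l x) \<le> NX x" using x unfolding dual_ball_def by blast
    then show "(cmod (l x) powr r) powr (1/r) \<le> NX x" using r by (simp add: powr_powr)
  qed
  finally show ?thesis using r NY by (simp add: powr_powr)
qed

text \<open>For a fixed finite family the bound passes to the limit of the truncations. Replacing \<open>b\<close> by \<open>b'\<close>
  increases the norms of the images by at most the factor \<open>2\<close>; this is the loss in choosing points
  where a function is nearly maximal.\<close>
lemma diag_from_truncations:
  assumes p: "1 \<le> p" and q: "1 \<le> q" and r: "1 \<le> r"
    and sb: "\<And>N. summing_bound r (lseq p) (lseq_norm p) (lseq_norm q) (diag_op (truncate N b)) C"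
    and le: "\<And>j. cmod (b' j) \<le> 2 * cmod (b j)"
  shows "linear_between (lseq p) (lseq q) (diag_op b')"
    and "summing_bound r (lseq p) (lseq_norm p) (lseq_norm q) (diag_op b') (2 * C)"
proof -
  have C0: "0 \<le> C" using sb[of 0] by (simp add: summing_bound_def)
  have ln0: "0 \<le> lseq_norm s c" for s c by (simp add: lseq_norm_def)
  have tr: "lseq_norm q (diag_op (truncate N b) x) = (\<Sum>j<N. cmod (b j * x j) powr q) powr (1/q)" for N x
    by (subst lseq_norm_finite[of N]) (auto simp: diag_op_def truncate_def)
  have sumb: "summable (\<lambda>j. cmod (b j * x j) powr q)" if x: "x \<in> lseq p" for x
  proof (rule bounded_imp_summable[where B="(C * lseq_norm p x) powr q"])
    fix n
    have "(\<Sum>j<Suc n. cmod (b j * x j) powr q) powr (1/q) \<le> C * lseq_norm p x"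
      unfolding tr[symmetric] by (rule summing_bound_single[OF sb x r ln0 ln0])
    then have "((\<Sum>j<Suc n. cmod (b j * x j) powr q) powr (1/q)) powr q \<le> (C * lseq_norm p x) powr q"
      using q by (intro powr_mono2) auto
    then show "(\<Sum>j\<le>n. cmod (b j * x j) powr q) \<le> (C * lseq_norm p x) powr q"
      using q by (simp add: powr_powr sum_nonneg lessThan_Suc_atMost)
  qed simp
  have le': "cmod (b' j * x j) powr q \<le> 2 powr q * cmod (b j * x j) powr q" for j x
  proof -
    have "cmod (b' j * x j) \<le> 2 * cmod (b j * x j)" using mult_right_mono[OF le[of j], of "cmod (x j)"] by (simp add: norm_mult mult_ac)
    then have "cmod (b' j * x j) powr q \<le> (2 * cmod (b j * x j)) powr q" using q by (intro powr_mono2) auto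
    then show ?thesis by (simp add: powr_mult)
  qed
  have sumb': "summable (\<lambda>j. cmod (b' j * x j) powr q)" if x: "x \<in> lseq p" for x
    by (rule summable_comparison_test'[OF summable_mult[OF sumb[OF x], of "2 powr q"]]) (use le' in simp)
  show "linear_between (lseq p) (lseq q) (diag_op b')"
    using sumb' unfolding linear_between_def by (auto simp: lseq_def diag_op_def algebra_simps)
  have nb: "lseq_norm q (diag_op b' x) \<le> 2 * lseq_norm q (diag_op b x)" if x: "x \<in> lseq p" for x
  proof -
    have "(\<Sum>j. cmod (b' j * x j) powr q) \<le> (\<Sum>j. 2 powr q * cmod (b j * x j) powr q)"
      by (rule suminf_le[OF _ sumb'[OF x] summable_mult[OF sumb[OF x]]]) (rule le')
    also have "\<dots> = 2 powr q * (\<Sum>j. cmod (b j * x j) powr q)" by (rule suminf_mult[OF sumb[OF x]])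
    finally have "(\<Sum>j. cmod (b' j * x j) powr q) powr (1/q) \<le> (2 powr q * (\<Sum>j. cmod (b j * x j) powr q)) powr (1/q)"
      using q by (intro powr_mono2 suminf_nonneg sumb' x) auto
    then show ?thesis using q by (simp add: lseq_norm_def diag_op_def powr_mult powr_powr)
  qed
  show "summing_bound r (lseq p) (lseq_norm p) (lseq_norm q) (diag_op b') (2 * C)"
    unfolding summing_bound_def
  proof (intro conjI allI impI)
    show "0 \<le> 2 * C" using C0 by simp
    fix k :: nat and x :: "nat \<Rightarrow> nat \<Rightarrow> complex"
    assume x: "\<forall>i<k. x i \<in> lseq p"
    let ?W = "SUP l\<in>dual_ball (lseq p) (lseq_norm p). (\<Sum>i<k. cmod (l (x i)) powr r) powr (1/r)"
    have lim: "(\<lambda>N. lseq_norm q (diag_op (truncate N b) (x i))) \<longlonglongrightarrow> lseq_norm q (diag_op b (x i))" if "i < k" for i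
    proof -
      have "(\<lambda>N. \<Sum>j<N. cmod (b j * x i j) powr q) \<longlonglongrightarrow> (\<Sum>j. cmod (b j * x i j) powr q)"
        using sumb x that by (intro summable_LIMSEQ) auto
      then show ?thesis unfolding tr unfolding lseq_norm_def diag_op_def
        using q by (intro tendsto_powr') (auto intro!: tendsto_intros always_eventually sum_nonneg)
    qed
    have "(\<lambda>N. (\<Sum>i<k. lseq_norm q (diag_op (truncate N b) (x i)) powr r) powr (1/r)) \<longlonglongrightarrow>
       (\<Sum>i<k. lseq_norm q (diag_op b (x i)) powr r) powr (1/r)"
      using r lim ln0 by (intro tendsto_powr' tendsto_sum) (auto intro!: tendsto_intros always_eventually sum_nonneg)
    moreover have "(\<Sum>i<k. lseq_norm q (diag_op (truncate N b) (x i)) powr r) powr (1/r) \<le> C * ?W" for N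
      using sb[of N, unfolded summing_bound_def, THEN conjunct2, rule_format, of k x] x by simp
    ultimately have lb: "(\<Sum>i<k. lseq_norm q (diag_op b (x i)) powr r) powr (1/r) \<le> C * ?W"
      by (intro LIMSEQ_le_const2) auto
    have "(\<Sum>i<k. lseq_norm q (diag_op b' (x i)) powr r) powr (1/r) \<le> (\<Sum>i<k. (2 * lseq_norm q (diag_op b (x i))) powr r) powr (1/r)"
      using nb x r ln0 by (intro powr_mono2 sum_mono sum_nonneg) auto
    also have "\<dots> = (2 powr r * (\<Sum>i<k. lseq_norm q (diag_op b (x i)) powr r)) powr (1/r)"
      by (simp add: powr_mult sum_distrib_left)
    also have "\<dots> = 2 * (\<Sum>i<k. lseq_norm q (diag_op b (x i)) powr r) powr (1/r)"
      using r by (simp add: powr_mult powr_powr)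
    also have "\<dots> \<le> 2 * C * ?W" using lb by simp
    finally show "(\<Sum>i<k. lseq_norm q (diag_op b' (x i)) powr r) powr (1/r) \<le> 2 * C * ?W" .
  qed
qed

section \<open>The Berezin transform on the lattice cells\<close>

lemma cell_borel: "cell j \<in> sets borel"
proof -
  have "cell j = (\<Inter>i. {z. real_of_int (fst (j $ i)) - 1/2 \<le> Re (z $ i)} \<inter> {z. Re (z $ i) < real_of_int (fst (j $ i)) + 1/2} \<inter>
     ({z. real_of_int (snd (j $ i)) - 1/2 \<le> Im (z $ i)} \<inter> {z. Im (z $ i) < real_of_int (snd (j $ i)) + 1/2}))"
    by (auto simp: cell_def)
  also have "\<dots> \<in> sets borel"
    by (intro sets.countable_INT'' sets.Int borel_closed borel_open closed_Collect_le open_Collect_less continuous_intros) auto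
  finally show ?thesis .
qed

lemma cell_emeasure_pos: "emeasure (lebesgue_on (cell j)) (space (lebesgue_on (cell j))) \<noteq> 0"
proof -
  have "0 < emeasure lborel (ball (cell_center j) (1/2))"
    using content_ball_pos[of "1/2" "cell_center j"] by (simp add: measure_def zero_less_iff_neq_zero) (metis enn2real_0 less_irrefl)
  also have "\<dots> \<le> emeasure lborel (cell j)"
    by (rule emeasure_mono[OF cell_center_ball]) (simp add: cell_borel)
  finally show ?thesis using cell_borel[of j]
    by (simp add: space_restrict_space emeasure_restrict_space emeasure_completion)
qed

lemma cell_exists: "\<exists>j. (z :: complex ^ 'n::finite) \<in> cell (lattice_enum j)"
proof -
  define l :: "'n lattice" where "l = (\<chi> i. (\<lfloor>Re (z $ i) + 1/2\<rfloor>, \<lfloor>Im (z $ i) + 1/2\<rfloor>))"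
  have "x \<in> {real_of_int \<lfloor>x + 1/2\<rfloor> - 1/2 ..< real_of_int \<lfloor>x + 1/2\<rfloor> + 1/2}" for x :: real
    unfolding atLeastLessThan_iff by linarith
  then have "z \<in> cell l" by (simp add: cell_def l_def)
  moreover obtain j where "lattice_enum j = l" using bij_lattice_enum by (metis bij_pointE)
  ultimately show ?thesis by blast
qed

lemma cell_center_in_cell: "cell_center j \<in> cell j"
  using cell_center_ball[of j] by auto

lemma cell_sup_bounds:
  assumes u: "u \<in> borel_measurable borel" and B: "\<And>z. cmod (u z) \<le> B"
  shows "0 \<le> cell_sup u j" "cell_sup u j \<le> ereal B"
    and "\<And>b. (\<And>z. z \<in> cell j \<Longrightarrow> cmod (u z) \<le> b) \<Longrightarrow> cell_sup u j \<le> ereal b"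
proof -
  have "(\<lambda>z. ereal (cmod (u z))) \<in> borel_measurable lborel" using u by simp
  then have m: "(\<lambda>z. ereal (cmod (u z))) \<in> borel_measurable (lebesgue_on (cell j))"
    by (intro measurable_restrict_space1 measurable_completion)
  have "esssup (lebesgue_on (cell j)) (\<lambda>z. 0 :: ereal) \<le> cell_sup u j"
    unfolding cell_sup_def by (rule esssup_mono) auto
  then show "0 \<le> cell_sup u j" using esssup_const[OF cell_emeasure_pos, of j "0 :: ereal"] by simp
  show le: "cell_sup u j \<le> ereal b" if "\<And>z. z \<in> cell j \<Longrightarrow> cmod (u z) \<le> b" for b
    unfolding cell_sup_def using that
    by (intro esssup_I m AE_I2) (auto simp: space_restrict_space)
  show "cell_sup u j \<le> ereal B" using B by (intro le)
qed

text \<open>Otherwise \<open>2 |u|\<close> would stay below the essential supremum on the whole cell, which would then be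
  at most half of itself and hence \<open>0\<close>, while it exceeds \<open>2 |u|\<close> at the centre.\<close>
lemma cell_seq_attained:
  assumes u: "u \<in> borel_measurable borel" and B: "\<And>z. cmod (u z) \<le> B"
  shows "\<exists>z\<in>cell (lattice_enum j). cmod (cell_seq u j) \<le> 2 * cmod (u z)"
proof (rule ccontr)
  let ?l = "lattice_enum j"
  define s where "s = real_of_ereal (cell_sup u ?l)"
  have b: "0 \<le> cell_sup u ?l" "cell_sup u ?l \<le> ereal B" by (rule cell_sup_bounds[OF u B])+
  then have s: "cell_sup u ?l = ereal s" unfolding s_def by (cases "cell_sup u ?l") auto
  with b have s0: "0 \<le> s" by simp
  have cs: "cmod (cell_seq u j) = s" using s0 by (simp add: cell_seq_def s)
  assume "\<not> ?thesis"
  then have n: "2 * cmod (u z) < s" if "z \<in> cell ?l" for z using that cs by force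
  have "cell_sup u ?l \<le> ereal (s / 2)"
    by (rule cell_sup_bounds(3)[OF u B]) (use n in fastforce)
  moreover have "0 < s"
    using n[OF cell_center_in_cell] by (rule le_less_trans[rotated]) simp
  ultimately show False by (simp add: s)
qed

definition synthesis_const :: "'n::finite itself \<Rightarrow> real \<Rightarrow> real \<Rightarrow> real \<Rightarrow> real" where
  "synthesis_const T m M p = (kernel_sum_const T m M powr (p - 1) * kernel_norm_const T m M) powr (1 / p) + 1"

definition sampling_const :: "'n::finite itself \<Rightarrow> real \<Rightarrow> real \<Rightarrow> real \<Rightarrow> real" where
  "sampling_const T m M q = sqrt (peak_const T m) * (mean_const M q TYPE(complex ^ 'n) * overlap T) powr (1 / q) + 1"

context
  fixes m M p q r :: real and \<phi> :: "complex ^ 'n::finite \<Rightarrow> real" and G and K :: "complex ^ 'n \<Rightarrow> complex ^ 'n \<Rightarrow> complex"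
  assumes qw: "quadratic_weight m M \<phi> G" and rk: "reproducing_kernel \<phi> K"
    and p: "1 \<le> p" and q: "1 \<le> q" and r: "1 \<le> r"
begin

lemma transform_const_pos: "0 < synthesis_const TYPE('n) m M p" "0 < sampling_const TYPE('n) m M q"
proof -
  show "0 < synthesis_const TYPE('n) m M p"
    unfolding synthesis_const_def by (rule add_nonneg_pos) auto
  show "0 < sampling_const TYPE('n) m M q"
    unfolding sampling_const_def using peak_const_pos[OF qw rk]
    by (intro add_nonneg_pos mult_nonneg_nonneg) auto
qed

lemma weighted_sampling:
  assumes zs: "\<And>j. zs j \<in> cell (lattice_enum j)" and y: "y \<in> Fock \<phi> q"
  shows "(\<Sum>j<N. cmod (1 / of_real (kroot \<phi> K (zs j)) * y (zs j)) powr q) powr (1/q)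
    \<le> sampling_const TYPE('n) m M q * Lphi_norm \<phi> q y"
proof -
  let ?P = "sqrt (peak_const TYPE('n) m)" and ?D = "mean_const M q TYPE(complex ^ 'n) * overlap TYPE('n)"
  let ?I = "LINT w|lborel. (cmod (y w) * exp (- \<phi> w)) powr q"
  have ye: "entire y" and yi: "integrable lborel (\<lambda>w. (cmod (y w) * exp (- \<phi> w)) powr q)"
    using y by (auto simp: Fock_iff[OF weight_continuous[OF qw rk]])
  have P0: "0 \<le> ?P" using peak_const_pos[OF qw rk] by simp
  have D0: "0 \<le> ?D" using mean_const_nonneg[OF qw rk] by (simp add: overlap_def)
  have I0: "0 \<le> ?I" by simp
  have pt: "cmod (1 / of_real (kroot \<phi> K (zs j)) * y (zs j)) \<le> ?P * (cmod (y (zs j)) * exp (- \<phi> (zs j)))" for j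
    using mult_right_mono[OF kroot_inverse[OF qw rk, of "zs j"], of "cmod (y (zs j))"] kroot_pos[OF qw rk, of "zs j"]
    by (simp add: norm_divide mult_ac)
  have "(\<Sum>j<N. cmod (1 / of_real (kroot \<phi> K (zs j)) * y (zs j)) powr q)
      \<le> (\<Sum>j<N. (?P * (cmod (y (zs j)) * exp (- \<phi> (zs j)))) powr q)"
    using q by (intro sum_mono powr_mono2 pt) auto
  also have "\<dots> = ?P powr q * (\<Sum>j<N. (cmod (y (zs j)) * exp (- \<phi> (zs j))) powr q)"
    using P0 by (simp add: powr_mult sum_distrib_left)
  also have "\<dots> \<le> ?P powr q * (?D * ?I)"
    by (intro mult_left_mono sampling[OF qw rk zs ye q yi]) simp
  finally have "(\<Sum>j<N. cmod (1 / of_real (kroot \<phi> K (zs j)) * y (zs j)) powr q) powr (1/q)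
      \<le> (?P powr q * (?D * ?I)) powr (1/q)"
    using q by (intro powr_mono2) (auto intro: sum_nonneg)
  also have "\<dots> = ?P * ?D powr (1/q) * ?I powr (1/q)"
    using P0 D0 I0 q by (simp add: powr_mult powr_powr)
  also have "\<dots> \<le> (?P * ?D powr (1/q) + 1) * ?I powr (1/q)"
    by (intro mult_right_mono) auto
  finally show ?thesis unfolding sampling_const_def Fock_norm[OF weight_continuous[OF qw rk] ye] .
qed

lemma normalized_kernel_in_span: "normalized_kernel K z \<in> kernel_span K"
  unfolding kernel_span_def by (auto intro!: exI[of _ "{z}"] exI[of _ "\<lambda>_. 1"])

text \<open>Instance of \<open>diagonal_summing\<close> for the normalized kernels at the points \<open>zs j\<close>. These lie in
  \<open>kernel_span K\<close>, where the extension \<open>A\<close> is the Toeplitz operator itself.\<close>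
lemma berezin_truncations:
  assumes A: "A \<in> toeplitz_extensions \<phi> K p q r f"
    and sb: "summing_bound r (Fock \<phi> p) (Lphi_norm \<phi> p) (Lphi_norm \<phi> q) A C"
    and zs: "\<And>j. zs j \<in> cell (lattice_enum j)"
  shows "summing_bound r (lseq p) (lseq_norm p) (lseq_norm q)
    (diag_op (truncate N (\<lambda>j. berezin \<phi> K f (zs j))))
    (C * synthesis_const TYPE('n) m M p * sampling_const TYPE('n) m M q)"
proof -
  let ?e = "\<lambda>j. normalized_kernel K (zs j)" and ?wt = "\<lambda>j. 1 / complex_of_real (kroot \<phi> K (zs j))"
  have lin: "linear_between (Fock \<phi> p) (Fock \<phi> q) A"
    using A by (simp add: toeplitz_extensions_def summing_ops_def)
  have b: "?wt j * A (?e j) (zs j) = berezin \<phi> K f (zs j)" for j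
  proof -
    have "A (?e j) = toeplitz \<phi> K f (?e j)"
      using A normalized_kernel_in_span by (simp add: toeplitz_extensions_def)
    then show ?thesis using toeplitz_at_kernel[OF qw rk, of f "zs j"] kroot_pos[OF qw rk, of "zs j"] by simp
  qed
  have synb: "Lphi_norm \<phi> p (\<lambda>w. \<Sum>j<n. c j * ?e j w)
      \<le> synthesis_const TYPE('n) m M p * (\<Sum>j<n. cmod (c j) powr p) powr (1/p)" for c n
  proof -
    have "Lphi_norm \<phi> p (\<lambda>w. \<Sum>j<n. c j * ?e j w)
      \<le> (kernel_sum_const TYPE('n) m M powr (p - 1) * kernel_norm_const TYPE('n) m M) powr (1 / p) * (\<Sum>j<n. cmod (c j) powr p) powr (1/p)"
      by (rule synthesis(2)[OF qw rk zs p])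
    also have "\<dots> \<le> synthesis_const TYPE('n) m M p * (\<Sum>j<n. cmod (c j) powr p) powr (1/p)"
      unfolding synthesis_const_def by (intro mult_right_mono) auto
    finally show ?thesis .
  qed
  have N0: "0 \<le> Lphi_norm \<phi> s g" for s g by (simp add: Lphi_norm_def)
  have "summing_bound r (lseq p) (lseq_norm p) (lseq_norm q) (diag_op (truncate N (\<lambda>j. ?wt j * A (?e j) (zs j))))
     (C * synthesis_const TYPE('n) m M p * sampling_const TYPE('n) m M q)"
    by (rule diagonal_summing[OF lin sb p q r synthesis(1)[OF qw rk zs p] synb weighted_sampling[OF zs]
          transform_const_pos(1) less_imp_le[OF transform_const_pos(2)] N0 N0])
  then show ?thesis unfolding b .
qed

text \<open>Since \<open>cell_seq\<close> replaces infinite suprema by \<open>0\<close>, finiteness has to be known beforehand. Any \<open>z\<close>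
  can be made the sample point of its own cell, and then the truncated diagonal operator takes a
  unit vector to a vector of norm \<open>|berezin \<phi> K f z|\<close>.\<close>
lemma berezin_bounded:
  assumes A: "A \<in> toeplitz_extensions \<phi> K p q r f"
    and sb: "summing_bound r (Fock \<phi> p) (Lphi_norm \<phi> p) (Lphi_norm \<phi> q) A C"
  shows "cmod (berezin \<phi> K f z) \<le> C * synthesis_const TYPE('n) m M p * sampling_const TYPE('n) m M q"
    (is "_ \<le> ?C")
proof -
  obtain j where j: "z \<in> cell (lattice_enum j)" using cell_exists by blast
  define zs where "zs = (\<lambda>i. if i = j then z else cell_center (lattice_enum i))"
  have zs: "zs i \<in> cell (lattice_enum i)" for i using j by (simp add: zs_def cell_center_in_cell)
  define c where "c = (\<lambda>i. if i = j then 1 else 0 :: complex)"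
  have s: "lseq_norm s (\<lambda>i. a * c i) = cmod a" if "1 \<le> s" for s a
  proof -
    have "lseq_norm s (\<lambda>i. a * c i) = (\<Sum>i<Suc j. cmod (a * c i) powr s) powr (1/s)"
      by (rule lseq_norm_finite) (simp add: c_def)
    also have "(\<Sum>i<Suc j. cmod (a * c i) powr s) = cmod a powr s" by (simp add: c_def)
    finally show ?thesis using that by (simp add: powr_powr)
  qed
  have d: "diag_op (truncate (Suc j) (\<lambda>i. berezin \<phi> K f (zs i))) c = (\<lambda>i. berezin \<phi> K f z * c i)"
    by (auto simp: diag_op_def truncate_def c_def zs_def)
  have "summable (\<lambda>i. cmod (c i) powr p)" by (rule summable_finite[of "{j}"]) (auto simp: c_def)
  then have cl: "c \<in> lseq p" by (simp add: lseq_def)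
  have n0: "0 \<le> lseq_norm s x" for s x by (simp add: lseq_norm_def)
  have "lseq_norm q (diag_op (truncate (Suc j) (\<lambda>i. berezin \<phi> K f (zs i))) c) \<le> ?C * lseq_norm p c"
    by (rule summing_bound_single[OF berezin_truncations[OF A sb zs] cl r n0 n0])
  then show ?thesis unfolding d using s[OF q] s[OF p, of 1] by simp
qed

lemma berezin_diagonal:
  assumes f: "f \<in> symbol_class \<phi> K" and A: "A \<in> toeplitz_extensions \<phi> K p q r f"
    and sb: "summing_bound r (Fock \<phi> p) (Lphi_norm \<phi> p) (Lphi_norm \<phi> q) A C"
  defines "C' \<equiv> 2 * (C * synthesis_const TYPE('n) m M p * sampling_const TYPE('n) m M q)"
  shows "berezin \<phi> K f \<in> lattice_space p q r" and "lattice_norm p q r (berezin \<phi> K f) \<le> C'"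
proof -
  let ?u = "berezin \<phi> K f"
  have um: "?u \<in> borel_measurable borel"
    using f by (intro berezin_measurable[OF qw rk]) (simp add: symbol_class_def)
  note B = berezin_bounded[OF A sb]
  obtain zs where zs: "\<And>j. zs j \<in> cell (lattice_enum j)"
    and le: "\<And>j. cmod (cell_seq ?u j) \<le> 2 * cmod (?u (zs j))"
    using cell_seq_attained[OF um B] by metis
  note diag = diag_from_truncations[OF p q r berezin_truncations[OF A sb zs] le, folded C'_def]
  have "?u \<in> borel_measurable lborel" using um by simp
  then have "?u \<in> borel_measurable lebesgue" by (rule measurable_completion)
  moreover have "cell_sup ?u j < \<infinity>" for j
    using cell_sup_bounds(2)[OF um B, of j] by (rule le_less_trans) simp
  ultimately show "?u \<in> lattice_space p q r"
    using diag unfolding lattice_space_def diag_space_def summing_ops_def by blast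
  show "lattice_norm p q r ?u \<le> C'"
    unfolding lattice_norm_def diag_norm_def summing_norm_def
    by (rule cInf_lower) (use diag(2) in \<open>auto intro!: bdd_belowI[of _ 0] simp: summing_bound_def\<close>)
qed

end

theorem corollary6p2:
  fixes p q r m M :: real
  assumes "1 \<le> p" and "1 \<le> q" and "1 \<le> r"
    and "0 < m" and "m \<le> M"
  shows "\<exists>C\<ge>0. \<forall>(\<phi> :: complex ^ 'n::finite \<Rightarrow> real) K f.
    admissible_weight m M \<phi> \<longrightarrow> reproducing_kernel \<phi> K \<longrightarrow>
    f \<in> symbol_class \<phi> K \<longrightarrow> toeplitz_summing \<phi> K p q r f \<longrightarrow>
      berezin \<phi> K f \<in> lattice_space p q r \<and>
      lattice_norm p q r (berezin \<phi> K f) \<le> C * toeplitz_summing_norm \<phi> K p q r f"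
proof -
  \<comment> \<open>The absolute value keeps the constant nonnegative even when no weight is admissible.\<close>
  define C0 where "C0 = 2 * \<bar>synthesis_const TYPE('n) m M p * sampling_const TYPE('n) m M q\<bar>"
  have "berezin \<phi> K f \<in> lattice_space p q r \<and>
      lattice_norm p q r (berezin \<phi> K f) \<le> C0 * toeplitz_summing_norm \<phi> K p q r f"
    if aw: "admissible_weight m M \<phi>" and rk: "reproducing_kernel \<phi> K"
      and f: "f \<in> symbol_class \<phi> K" and t: "toeplitz_summing \<phi> K p q r f"
    for \<phi> :: "complex ^ 'n \<Rightarrow> real" and K f
  proof -
    obtain G where qw: "quadratic_weight m M \<phi> G"
      using admissible_quadratic[OF aw assms(4,5)] .
    let ?E = "toeplitz_extensions \<phi> K p q r f"
    let ?S = "\<lambda>A. {C. summing_bound r (Fock \<phi> p) (Lphi_norm \<phi> p) (Lphi_norm \<phi> q) A C}"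
    have cp: "0 < synthesis_const TYPE('n) m M p" "0 < sampling_const TYPE('n) m M q"
      by (rule transform_const_pos[OF qw rk assms(1,2,3)])+
    then have C0p: "0 < C0" by (simp add: C0_def)
    note main = berezin_diagonal[OF qw rk assms(1,2,3) f]
    have ne: "?E \<noteq> {}" using t by (simp add: toeplitz_summing_def)
    have neS: "?S A \<noteq> {}" if "A \<in> ?E" for A using that by (auto simp: toeplitz_extensions_def summing_ops_def)
    have "lattice_norm p q r (berezin \<phi> K f) / C0 \<le> toeplitz_summing_norm \<phi> K p q r f"
      unfolding toeplitz_summing_norm_def summing_norm_def
    proof (intro cINF_greatest[OF ne] cInf_greatest neS)
      fix A C assume "A \<in> ?E" "C \<in> ?S A"
      then have "lattice_norm p q r (berezin \<phi> K f) \<le> 2 * (C * synthesis_const TYPE('n) m M p * sampling_const TYPE('n) m M q)"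
        by (intro main(2)) auto
      also have "\<dots> = C * C0" using cp by (simp add: C0_def mult_ac)
      finally show "lattice_norm p q r (berezin \<phi> K f) / C0 \<le> C" using C0p by (simp add: pos_divide_le_eq)
    qed
    moreover obtain A C where "A \<in> ?E" "C \<in> ?S A" using ne neS by blast
    ultimately show ?thesis using main(1)[of A C] C0p by (auto simp: pos_divide_le_eq mult.commute)
  qed
  moreover have "0 \<le> C0" by (simp add: C0_def)
  ultimately show ?thesis by blast
qed

end
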